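(* Let $\mathbb H$ be the rational Cherednik algebra of $G(r,1,n)$ with parameters $\kappa,c_0,\dots,c_{r-1}\in\mathbb C$. With $z_i,\pi_i,\sigma_i,\Phi,\Psi,d_j,\epsilon_{ij}$ as in the context: (a) For $1\le i\le n-1$, $$\sigma_i^2=1-\left(\frac{c_0\pi_i}{z_i-z_{i+1}}\right)^2.$$ (b) $$\Psi\Phi=z_1\qquad\text{and}\qquad \Phi\Psi=z_n-\kappa+\sum_{j=0}^{r-1}(d_j-d_{j-1})\epsilon_{nj}.$$
   Context: $\zeta=e^{2\pi i/r}$; $G(r,1,n)$ is the group of $n\times n$ monomial matrices with nonzero entries $r$-th roots of $1$, acting on $\mathfrak h=\mathbb C^n$ (standard basis $y_1,\dots,y_n$) and contragrediently on $\mathfrak h^*$ (dual basis $x_1,\dots,x_n$). $\zeta_i$ is the diagonal matrix with $\zeta$ in position $i$ and $1$ elsewhere, $s_{ij}$ the transposition matrix, $s_i=s_{i,i+1}$. $\mathbb H$ is the $\mathbb C$-algebra generated by $\mathbb C[x_1,\dots,x_n]$, $\mathbb C[y_1,\dots,y_n]$ and $t_w$ ($w\in G(r,1,n)$) with relations $t_wt_v=t_{wv}$, $t_wx=(wx)t_w$, $t_wy=(wy)t_w$ for $x\in\mathfrak h^*$, $y\in\mathfrak h$, and $$y_ix_j=x_jy_i+c_0\sum_{l=0}^{r-1}\zeta^{-l}t_{\zeta_i^ls_{ij}\zeta_i^{-l}}\ (i\ne j),\qquad y_ix_i=x_iy_i+\kappa-\sum_{l=1}^{r-1}c_l(1-\zeta^{-l})t_{\zeta_i^l}-c_0\sum_{j\ne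 i}\sum_{l=0}^{r-1}t_{\zeta_i^ls_{ij}\zeta_i^{-l}}.$$ Definitions: $d_j=\sum_{l=1}^{r-1}\zeta^{lj}c_l$ for $j\in\mathbb Z$; $\epsilon_{ij}=\frac1r\sum_{l=0}^{r-1}\zeta^{-lj}t_{\zeta_i^l}$; $z_i=y_ix_i+c_0\sum_{1\le j<i}\sum_{l=0}^{r-1}t_{\zeta_i^ls_{ij}\zeta_i^{-l}}$ for $1\le i\le n$ (these commute pairwise and are algebraically independent); $$\pi_i=\sum_{l=0}^{r-1}t_{\zeta_i^l\zeta_{i+1}^{-l}},\qquad \sigma_i=t_{s_i}+\frac{c_0}{z_i-z_{i+1}}\pi_i\ (1\le i\le n-1),\qquad \Phi=x_nt_{s_{n-1}s_{n-2}\cdots s_1},\qquad \Psi=y_1t_{s_1s_2\cdots s_{n-1}}.$$ Let $A\subseteq\mathbb H$ be the subalgebra generated by $z_1,\dots,z_n$ and $\mathbb CG(r,1,n)$. Symmetric polynomials in $z_1,\dots,z_n$ are central in $A$; expressions with denominators in the $z_i$ (in particular $\sigma_i$) are read in the localization of $A$ at the nonzero symmetric polynomials in $z_1,\dots,z_n$, which contains the field $\mathbb C(z_1,\dots,z_n)$. *)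

theory Defs
  imports
    "Jordan_Normal_Form.Matrix"
    "HOL-Algebra.QuotRing"
    "HOL-Algebra.Generated_Rings"
    "HOL-Library.Poly_Mapping"
    "HOL-Combinatorics.Permutations"
    Complex_Main
begin

section \<open>Free algebras\<close>

text \<open>Words under concatenation form the free monoid. With this additive instance on lists, the
  convolution product that the library puts on \<^typ>\<open>'g list \<Rightarrow>\<^sub>0 complex\<close> is the
  multiplication of the free associative algebra over the complex numbers on \<^typ>\<open>'g\<close>.\<close>

instantiation list :: (type) monoid_add
begin

definition zero_list :: "'a list" where "zero_list = []"

definition plus_list :: "'a list \<Rightarrow> 'a list \<Rightarrow> 'a list" where "plus_list xs ys = xs @ ys"

instance
  by standard (simp_all add: zero_list_def plus_list_def)

end

type_synonym 'g free_alg = "'g list \<Rightarrow>\<^sub>0 complex"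

definition free_algebra :: "'g set \<Rightarrow> 'g free_alg ring" where
  "free_algebra S = \<lparr>carrier = {p. Poly_Mapping.keys p \<subseteq> lists S},
     mult = (*), one = 1, zero = 0, add = (+)\<rparr>"

definition free_gen :: "'g \<Rightarrow> 'g free_alg" where
  "free_gen g = Poly_Mapping.single [g] 1"

definition free_scalar :: "complex \<Rightarrow> 'g free_alg" where
  "free_scalar a = Poly_Mapping.single [] a"


section \<open>Localization at a multiplicative set of central elements\<close>

definition frac_rel :: "('a, 'b) ring_scheme \<Rightarrow> 'a set \<Rightarrow> (('a \<times> 'a) \<times> ('a \<times> 'a)) set" where
  "frac_rel R S = {((a, s), (b, t)).
     a \<in> carrier R \<and> b \<in> carrier R \<and> s \<in> S \<and> t \<in> S \<and>
     (\<exists>u\<in>S. u \<otimes>\<^bsub>R\<^esub> (a \<otimes>\<^bsub>R\<^esub> t \<ominus>\<^bsub>R\<^esub> b \<otimes>\<^bsub>R\<^esub> s) = \<zero>\<^bsub>R\<^esub>)}"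

definition frac :: "('a, 'b) ring_scheme \<Rightarrow> 'a set \<Rightarrow> 'a \<Rightarrow> 'a \<Rightarrow> ('a \<times> 'a) set" where
  "frac R S a s = frac_rel R S `` {(a, s)}"

text \<open>Addition and multiplication are independent of the representatives when \<open>S\<close> is a
  multiplicatively closed set of central elements; the union is then over equal classes.\<close>

definition localization :: "('a, 'b) ring_scheme \<Rightarrow> 'a set \<Rightarrow> ('a \<times> 'a) set ring" where
  "localization R S =
     \<lparr>carrier = (carrier R \<times> S) // frac_rel R S,
      mult = (\<lambda>X Y. \<Union>(a, s)\<in>X. \<Union>(b, t)\<in>Y. frac R S (a \<otimes>\<^bsub>R\<^esub> b) (s \<otimes>\<^bsub>R\<^esub> t)),
      one = frac R S \<one>\<^bsub>R\<^esub> \<one>\<^bsub>R\<^esub>,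
      zero = frac R S \<zero>\<^bsub>R\<^esub> \<one>\<^bsub>R\<^esub>,
      add = (\<lambda>X Y. \<Union>(a, s)\<in>X. \<Union>(b, t)\<in>Y.
               frac R S (a \<otimes>\<^bsub>R\<^esub> t \<oplus>\<^bsub>R\<^esub> b \<otimes>\<^bsub>R\<^esub> s) (s \<otimes>\<^bsub>R\<^esub> t))\<rparr>"


section \<open>Symmetric polynomials\<close>

text \<open>Polynomials in the variables numbered \<open>1, \<dots>, n\<close>: finitely supported families of
  coefficients indexed by finitely supported exponent vectors.\<close>

type_synonym mpoly = "(nat \<Rightarrow>\<^sub>0 nat) \<Rightarrow>\<^sub>0 complex"

definition symmetric_poly :: "nat \<Rightarrow> mpoly \<Rightarrow> bool" where
  "symmetric_poly n p \<longleftrightarrow>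
     (\<forall>m\<in>Poly_Mapping.keys p. Poly_Mapping.keys m \<subseteq> {1..n}) \<and>
     (\<forall>\<sigma> m. \<sigma> permutes {1..n} \<longrightarrow>
        Poly_Mapping.lookup p (Poly_Mapping.map_key \<sigma> m) = Poly_Mapping.lookup p m)"


section \<open>The complex reflection group \<open>G(r,1,n)\<close>\<close>

text \<open>Matrix and vector entries are numbered from \<open>0\<close> in the library; all indices below
  (of basis vectors, of \<open>\<zeta>\<^sub>i\<close>, of \<open>s\<^sub>i\<^sub>j\<close>, of the generators of the algebra) are numbered from
  \<open>1\<close>.\<close>

definition zeta :: "nat \<Rightarrow> complex" where
  "zeta r = exp (2 * of_real pi * \<i> / of_nat r)"

definition monomial_mat :: "nat \<Rightarrow> complex mat \<Rightarrow> bool" where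
  "monomial_mat n w \<longleftrightarrow> w \<in> carrier_mat n n \<and>
     (\<forall>i<n. \<exists>!j. j < n \<and> w $$ (i, j) \<noteq> 0) \<and>
     (\<forall>j<n. \<exists>!i. i < n \<and> w $$ (i, j) \<noteq> 0)"

definition Grn :: "nat \<Rightarrow> nat \<Rightarrow> complex mat monoid" where
  "Grn r n = \<lparr>carrier = {w. monomial_mat n w \<and>
                  (\<forall>i<n. \<forall>j<n. w $$ (i, j) \<noteq> 0 \<longrightarrow> (w $$ (i, j)) ^ r = 1)},
              mult = (*), one = 1\<^sub>m n\<rparr>"

definition zeta_mat :: "nat \<Rightarrow> nat \<Rightarrow> nat \<Rightarrow> complex mat" where
  "zeta_mat r n i = mat n n (\<lambda>(a, b). if a = b then (if Suc a = i then zeta r else 1) else 0)"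

definition transp_mat :: "nat \<Rightarrow> nat \<Rightarrow> nat \<Rightarrow> complex mat" where
  "transp_mat n i j =
     mat n n (\<lambda>(a, b). if Transposition.transpose i j (Suc b) = Suc a then 1 else 0)"

text \<open>The coordinates, in the dual basis, of \<open>w x\<close> for the linear form \<open>x\<close> with coordinates \<open>a\<close>:
  the value of \<open>w x\<close> at a basis vector \<open>y\<close> is \<open>x (w\<inverse> y)\<close>.\<close>

definition dual_act :: "nat \<Rightarrow> nat \<Rightarrow> complex mat \<Rightarrow> complex vec \<Rightarrow> complex vec" where
  "dual_act r n w a = vec n (\<lambda>k. a \<bullet> ((inv\<^bsub>Grn r n\<^esub> w) *\<^sub>v unit_vec n k))"

definition mat_prod_list :: "nat \<Rightarrow> complex mat list \<Rightarrow> complex mat" where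
  "mat_prod_list n ws = foldr (*) ws (1\<^sub>m n)"


section \<open>The rational Cherednik algebra\<close>

datatype gen = X nat | Y nat | T "complex mat"

context
  fixes r n :: nat and \<kappa> :: complex and c :: "nat \<Rightarrow> complex"
begin

definition zeta_pow :: "nat \<Rightarrow> int \<Rightarrow> complex mat" where
  "zeta_pow i l = zeta_mat r n i [^]\<^bsub>Grn r n\<^esub> l"

text \<open>The reflection \<open>\<zeta>\<^sub>i\<^sup>l s\<^sub>i\<^sub>j \<zeta>\<^sub>i\<^sup>-\<^sup>l\<close>.\<close>

definition refl_mat :: "nat \<Rightarrow> nat \<Rightarrow> nat \<Rightarrow> complex mat" where
  "refl_mat i j l = zeta_pow i (int l) * transp_mat n i j * zeta_pow i (- int l)"

definition cherednik_gens :: "gen set" where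
  "cherednik_gens = X ` {1..n} \<union> Y ` {1..n} \<union> T ` carrier (Grn r n)"

text \<open>A pair \<open>(p, q)\<close> stands for the relation \<open>p = q\<close>. The relation \<open>t\<^sub>1 = 1\<close> makes the \<open>t\<^sub>w\<close> span a
  homomorphic image of the unital group algebra; it does not follow from \<open>t\<^sub>w t\<^sub>v = t\<^sub>w\<^sub>v\<close>.\<close>

definition cherednik_rels :: "(gen free_alg \<times> gen free_alg) set" where
  "cherednik_rels =
    (let x = (\<lambda>i. free_gen (X i)); y = (\<lambda>i. free_gen (Y i)); t = (\<lambda>w. free_gen (T w));
         sc = free_scalar;
         xvec = (\<lambda>a. \<Sum>i\<in>{1..n}. sc (a $ (i - 1)) * x i);
         yvec = (\<lambda>v. \<Sum>i\<in>{1..n}. sc (v $ (i - 1)) * y i)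
     in
       {(x i * x j, x j * x i) | i j. i \<in> {1..n} \<and> j \<in> {1..n}} \<union>
       {(y i * y j, y j * y i) | i j. i \<in> {1..n} \<and> j \<in> {1..n}} \<union>
       {(t (1\<^sub>m n), 1)} \<union>
       {(t w * t v, t (w * v)) | w v. w \<in> carrier (Grn r n) \<and> v \<in> carrier (Grn r n)} \<union>
       {(t w * xvec a, xvec (dual_act r n w a) * t w) | w a.
          w \<in> carrier (Grn r n) \<and> a \<in> carrier_vec n} \<union>
       {(t w * yvec v, yvec (w *\<^sub>v v) * t w) | w v.
          w \<in> carrier (Grn r n) \<and> v \<in> carrier_vec n} \<union>
       {(y i * x j,
         x j * y i + sc (c 0) * (\<Sum>l<r. sc (zeta r powi (- int l)) * t (refl_mat i j l))) | i j.
          i \<in> {1..n} \<and> j \<in> {1..n} \<and> i \<noteq> j} \<union>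
       {(y i * x i,
         x i * y i + sc \<kappa>
           - (\<Sum>l\<in>{1..<r}. sc (c l * (1 - zeta r powi (- int l))) * t (zeta_pow i (int l)))
           - sc (c 0) * (\<Sum>j\<in>{1..n} - {i}. \<Sum>l<r. t (refl_mat i j l))) | i.
          i \<in> {1..n}})"

definition cherednik_ideal :: "gen free_alg set" where
  "cherednik_ideal =
     Idl\<^bsub>free_algebra cherednik_gens\<^esub> {p - q | p q. (p, q) \<in> cherednik_rels}"

definition cherednik :: "gen free_alg set ring" where
  "cherednik = free_algebra cherednik_gens Quot cherednik_ideal"

definition cherednik_class :: "gen free_alg \<Rightarrow> gen free_alg set" where
  "cherednik_class p = cherednik_ideal +>\<^bsub>free_algebra cherednik_gens\<^esub> p"

definition hx :: "nat \<Rightarrow> gen free_alg set" where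
  "hx i = cherednik_class (free_gen (X i))"

definition hy :: "nat \<Rightarrow> gen free_alg set" where
  "hy i = cherednik_class (free_gen (Y i))"

definition ht :: "complex mat \<Rightarrow> gen free_alg set" where
  "ht w = cherednik_class (free_gen (T w))"

definition hscalar :: "complex \<Rightarrow> gen free_alg set" where
  "hscalar a = cherednik_class (free_scalar a)"


subsection \<open>The distinguished elements\<close>

definition d_coeff :: "int \<Rightarrow> complex" where
  "d_coeff j = (\<Sum>l\<in>{1..<r}. zeta r powi (int l * j) * c l)"

definition epsilon_elt :: "nat \<Rightarrow> int \<Rightarrow> gen free_alg set" where
  "epsilon_elt i j = hscalar (1 / of_nat r) \<otimes>\<^bsub>cherednik\<^esub>
     (\<Oplus>\<^bsub>cherednik\<^esub>l\<in>{..<r}. hscalar (zeta r powi (- (int l * j))) \<otimes>\<^bsub>cherednik\<^esub> ht (zeta_pow i (int l)))"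

definition z_elt :: "nat \<Rightarrow> gen free_alg set" where
  "z_elt i = hy i \<otimes>\<^bsub>cherednik\<^esub> hx i \<oplus>\<^bsub>cherednik\<^esub>
     hscalar (c 0) \<otimes>\<^bsub>cherednik\<^esub> (\<Oplus>\<^bsub>cherednik\<^esub>j\<in>{1..<i}. \<Oplus>\<^bsub>cherednik\<^esub>l\<in>{..<r}. ht (refl_mat i j l))"

definition pi_elt :: "nat \<Rightarrow> gen free_alg set" where
  "pi_elt i = (\<Oplus>\<^bsub>cherednik\<^esub>l\<in>{..<r}. ht (zeta_pow i (int l) * zeta_pow (i + 1) (- int l)))"

definition simple_refl :: "nat \<Rightarrow> complex mat" where
  "simple_refl i = transp_mat n i (i + 1)"

definition Phi_elt :: "gen free_alg set" where
  "Phi_elt = hx n \<otimes>\<^bsub>cherednik\<^esub> ht (mat_prod_list n (map simple_refl (rev [1..<n])))"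

definition Psi_elt :: "gen free_alg set" where
  "Psi_elt = hy 1 \<otimes>\<^bsub>cherednik\<^esub> ht (mat_prod_list n (map simple_refl [1..<n]))"


subsection \<open>The subalgebra generated by the \<open>z\<^sub>i\<close> and the group algebra, and its localization\<close>

text \<open>A subalgebra is a subring containing the scalars; the group algebra is spanned by the
  \<open>t\<^sub>w\<close>.\<close>

definition A_ring :: "gen free_alg set ring" where
  "A_ring = cherednik\<lparr>carrier :=
     generate_ring cherednik (range hscalar \<union> z_elt ` {1..n} \<union> ht ` carrier (Grn r n))\<rparr>"

text \<open>Since the \<open>z\<^sub>i\<close> commute, fixing the order of the factors in each monomial is immaterial.\<close>

definition z_eval :: "mpoly \<Rightarrow> gen free_alg set" where
  "z_eval p = (\<Oplus>\<^bsub>cherednik\<^esub>m\<in>Poly_Mapping.keys p. hscalar (Poly_Mapping.lookup p m) \<otimes>\<^bsub>cherednik\<^esub>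
     foldr (\<lambda>k u. (z_elt k [^]\<^bsub>cherednik\<^esub> Poly_Mapping.lookup m k) \<otimes>\<^bsub>cherednik\<^esub> u) [1..<Suc n] \<one>\<^bsub>cherednik\<^esub>)"

text \<open>Nonzero as polynomials; as the \<open>z\<^sub>i\<close> are algebraically independent, this is the same as
  having a nonzero value.\<close>

definition sym_denoms :: "gen free_alg set set" where
  "sym_denoms = z_eval ` {p. symmetric_poly n p \<and> p \<noteq> 0}"

definition A_loc :: "(gen free_alg set \<times> gen free_alg set) set ring" where
  "A_loc = localization A_ring sym_denoms"

definition to_loc :: "gen free_alg set \<Rightarrow> (gen free_alg set \<times> gen free_alg set) set" where
  "to_loc a = frac A_ring sym_denoms a \<one>\<^bsub>cherednik\<^esub>"

text \<open>The inverse of \<open>z\<^sub>i - z\<^sub>i\<^sub>+\<^sub>1\<close> exists in the localization because this element divides the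
  symmetric polynomial \<open>\<Prod>\<^sub>j\<^sub><\<^sub>k (z\<^sub>j - z\<^sub>k)\<^sup>2\<close>.\<close>

definition z_diff_inv :: "nat \<Rightarrow> (gen free_alg set \<times> gen free_alg set) set" where
  "z_diff_inv i = inv\<^bsub>A_loc\<^esub> (to_loc (z_elt i \<ominus>\<^bsub>cherednik\<^esub> z_elt (i + 1)))"

definition sigma_elt :: "nat \<Rightarrow> (gen free_alg set \<times> gen free_alg set) set" where
  "sigma_elt i = to_loc (ht (simple_refl i)) \<oplus>\<^bsub>A_loc\<^esub>
     (to_loc (hscalar (c 0)) \<otimes>\<^bsub>A_loc\<^esub> z_diff_inv i) \<otimes>\<^bsub>A_loc\<^esub> to_loc (pi_elt i)"

end

end

theory Submission
  imports Defs
begin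

text \<open>Part (b) is a direct computation: the permutations in \<open>\<Phi>\<close> and \<open>\<Psi>\<close> are inverse to each other and
  interchange the indices \<open>1\<close> and \<open>n\<close>, so \<open>\<Psi>\<Phi> = y\<^sub>1 x\<^sub>1\<close> and \<open>\<Phi>\<Psi> = x\<^sub>n y\<^sub>n\<close>; the latter is compared with
  \<open>z\<^sub>n\<close> through the defining relation for \<open>y\<^sub>n x\<^sub>n\<close>, and the idempotents enter by orthogonality of characters
  of \<open>\<int>/r\<close>.

  Part (a) follows from \<open>s\<^sub>i z\<^sub>i = z\<^sub>i\<^sub>+\<^sub>1 s\<^sub>i - c\<^sub>0 \<pi>\<^sub>i\<close>: with \<open>D = z\<^sub>i - z\<^sub>i\<^sub>+\<^sub>1\<close> and \<open>P = c\<^sub>0 \<pi>\<^sub>i\<close> it gives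
  \<open>s\<^sub>i D = - D s\<^sub>i - 2 P\<close>, hence \<open>s\<^sub>i D\<inverse> P + D\<inverse> P s\<^sub>i = - 2 (D\<inverse> P)\<^sup>2\<close>. For the localization to be a ring in
  which \<open>D\<close> is a unit, the \<open>z\<^sub>i\<close> have to commute and symmetric polynomials in them have to be central.
  The first is reduced, by \<open>z\<^sub>i\<^sub>+\<^sub>1 = s\<^sub>i z\<^sub>i s\<^sub>i + c\<^sub>0 \<pi>\<^sub>i s\<^sub>i\<close>, to \<open>z\<^sub>1 z\<^sub>2 = z\<^sub>2 z\<^sub>1\<close>; the second is the vanishing of the
  divided difference of a symmetric polynomial.\<close>

section \<open>Monomial matrices and roots of unity\<close>

text \<open>Elements of the algebra are cosets, and its operations are record operations guarded by
  carriers. Calculations are therefore done on representatives in the free algebra, an ordinary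
  noncommutative ring type; an identity in the algebra is an equality of \<open>cl\<close> values,
  and relations are applied inside products and sums through congruence rules for \<open>cl\<close>.
  Nonvanishing and cancellation are handled on formal polynomials, which form a domain: a
  denominator is the value of a nonzero symmetric polynomial, and the division by z_i - z_(i+1) in a
  divided difference happens before evaluation. Since z_i - z_(i+1) is not symmetric, it is inverted
  through a symmetric multiple, the product of all differences over ordered pairs. Sums over
  exponents modulo r are rewritten as sums over the set of r-th roots of unity. Conjugating a
  reflection then multiplies or inverts the root, which leaves such a sum unchanged.\<close>

definition mono_mat :: "nat \<Rightarrow> (nat \<Rightarrow> nat) \<Rightarrow> (nat \<Rightarrow> complex) \<Rightarrow> complex mat" where
  "mono_mat n \<sigma> a = mat n n (\<lambda>(p, q). if \<sigma> (Suc q) = Suc p then a (Suc q) else 0)"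

lemma mono_mat_carrier [simp]: "mono_mat n \<sigma> a \<in> carrier_mat n n"
  by (simp add: mono_mat_def)

lemma mono_mat_cong:
  assumes "\<And>k. k \<in> {1..n} \<Longrightarrow> \<sigma> k = \<tau> k" "\<And>k. k \<in> {1..n} \<Longrightarrow> a k = b k"
  shows "mono_mat n \<sigma> a = mono_mat n \<tau> b"
  using assms by (intro eq_matI) (auto simp: mono_mat_def)

text \<open>A coefficient belongs to the source of its column: basis vector k goes to
  \<open>a k\<close> times basis vector \<open>\<sigma> k\<close>. The left factor therefore
  contributes its coefficient at \<open>\<tau> k\<close>.\<close>

lemma mono_mat_mult:
  assumes "\<tau> permutes {1..n}"
  shows "mono_mat n \<sigma> a * mono_mat n \<tau> b = mono_mat n (\<sigma> \<circ> \<tau>) (\<lambda>k. a (\<tau> k) * b k)"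
proof (rule eq_matI)
  fix p q assume "p < dim_row (mono_mat n (\<sigma> \<circ> \<tau>) (\<lambda>k. a (\<tau> k) * b k))"
    and "q < dim_col (mono_mat n (\<sigma> \<circ> \<tau>) (\<lambda>k. a (\<tau> k) * b k))"
  then have pq: "p < n" "q < n" by (auto simp: mono_mat_def)
  then have "\<tau> (Suc q) \<in> {1..n}" using permutes_in_image[OF assms, of "Suc q"] by auto
  then obtain m where m: "\<tau> (Suc q) = Suc m" "m < n" by (cases "\<tau> (Suc q)") auto
  have "(mono_mat n \<sigma> a * mono_mat n \<tau> b) $$ (p, q) =
      (\<Sum>k\<in>{0..<n}. (if \<sigma> (Suc k) = Suc p then a (Suc k) else 0) * (if m = k then b (Suc q) else 0))"
    using pq m by (simp add: mono_mat_def scalar_prod_def)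
  also have "\<dots> = (\<Sum>k\<in>{0..<n}. if m = k then (if \<sigma> (Suc k) = Suc p then a (Suc k) else 0) * b (Suc q) else 0)"
    by (intro sum.cong) auto
  also have "\<dots> = mono_mat n (\<sigma> \<circ> \<tau>) (\<lambda>k. a (\<tau> k) * b k) $$ (p, q)"
    using pq m by (simp add: mono_mat_def)
  finally show "(mono_mat n \<sigma> a * mono_mat n \<tau> b) $$ (p, q) = mono_mat n (\<sigma> \<circ> \<tau>) (\<lambda>k. a (\<tau> k) * b k) $$ (p, q)" .
qed (auto simp: mono_mat_def)

lemma mono_mat_one: "mono_mat n id (\<lambda>_. 1) = 1\<^sub>m n"
  by (intro eq_matI) (auto simp: mono_mat_def)

lemma mono_mat_in_Grn:
  assumes \<sigma>: "\<sigma> permutes {1..n}" and a: "\<And>k. k \<in> {1..n} \<Longrightarrow> a k ^ r = 1" and "r \<ge> 1"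
  shows "mono_mat n \<sigma> a \<in> carrier (Grn r n)"
proof -
  have nz: "a k \<noteq> 0" if "k \<in> {1..n}" for k
    using a[OF that] \<open>r \<ge> 1\<close> by (auto simp: power_0_left)
  have nz_iff: "mono_mat n \<sigma> a $$ (p, q) \<noteq> 0 \<longleftrightarrow> \<sigma> (Suc q) = Suc p" if "p < n" "q < n" for p q
    using that nz[of "Suc q"] by (auto simp: mono_mat_def)
  have row: "\<exists>!q. q < n \<and> \<sigma> (Suc q) = Suc p" if p: "p < n" for p
  proof -
    have "Hilbert_Choice.inv \<sigma> (Suc p) \<in> {1..n}" using permutes_in_image[OF permutes_inv[OF \<sigma>], of "Suc p"] p by auto
    then obtain q where q: "Hilbert_Choice.inv \<sigma> (Suc p) = Suc q" "q < n" by (cases "Hilbert_Choice.inv \<sigma> (Suc p)") auto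
    have "\<sigma> (Suc q) = Suc p" using q(1) permutes_inverses(1)[OF \<sigma>] by metis
    moreover have "q' = q" if "\<sigma> (Suc q') = Suc p" for q'
      using that q(1) permutes_inverses(2)[OF \<sigma>] by (metis Suc_inject)
    ultimately show ?thesis using q(2) by blast
  qed
  have col: "\<exists>!p. p < n \<and> \<sigma> (Suc q) = Suc p" if q: "q < n" for q
  proof -
    have "\<sigma> (Suc q) \<in> {1..n}" using permutes_in_image[OF \<sigma>, of "Suc q"] q by auto
    then show ?thesis by (cases "\<sigma> (Suc q)") auto
  qed
  have "monomial_mat n (mono_mat n \<sigma> a)"
    unfolding monomial_mat_def
  proof (intro conjI allI impI)
    show "\<exists>!q. q < n \<and> mono_mat n \<sigma> a $$ (p, q) \<noteq> 0" if "p < n" for p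
      using row[OF that] nz_iff[OF that] by (simp cong: conj_cong)
    show "\<exists>!p. p < n \<and> mono_mat n \<sigma> a $$ (p, q) \<noteq> 0" if "q < n" for q
      using col[OF that] nz_iff[OF _ that] by (simp cong: conj_cong)
  qed simp
  then show ?thesis
    using a by (auto simp: Grn_def mono_mat_def)
qed

lemma Grn_mono_mat:
  assumes "w \<in> carrier (Grn r n)"
  obtains \<sigma> a where "\<sigma> permutes {1..n}" "\<And>k. k \<in> {1..n} \<Longrightarrow> a k ^ r = 1" "w = mono_mat n \<sigma> a"
proof -
  have w: "w \<in> carrier_mat n n" and row: "\<And>p. p < n \<Longrightarrow> \<exists>!q. q < n \<and> w $$ (p, q) \<noteq> 0"
    and col: "\<And>q. q < n \<Longrightarrow> \<exists>!p. p < n \<and> w $$ (p, q) \<noteq> 0"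
    and root: "\<And>p q. p < n \<Longrightarrow> q < n \<Longrightarrow> w $$ (p, q) \<noteq> 0 \<Longrightarrow> w $$ (p, q) ^ r = 1"
    using assms by (auto simp: Grn_def monomial_mat_def)
  \<comment> \<open>The row of the only nonzero entry in column \<open>q\<close>. Uniqueness within
    columns makes this a function, uniqueness within rows makes it injective.\<close>
  define f where "f q = (THE p. p < n \<and> w $$ (p, q) \<noteq> 0)" for q
  have f: "f q < n" "w $$ (f q, q) \<noteq> 0" if "q < n" for q
    using theI'[OF col[OF that]] by (auto simp: f_def)
  have f_unique: "p = f q" if "p < n" "q < n" "w $$ (p, q) \<noteq> 0" for p q
    using col[OF that(2)] f[OF that(2)] that by blast
  define \<sigma> where "\<sigma> k = (if k \<in> {1..n} then Suc (f (k - 1)) else k)" for k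
  define a where "a k = w $$ (f (k - 1), k - 1)" for k
  have inj: "inj_on \<sigma> {1..n}"
  proof (rule inj_onI)
    fix j k assume jk: "j \<in> {1..n}" "k \<in> {1..n}" "\<sigma> j = \<sigma> k"
    then have eq: "f (j - 1) = f (k - 1)" by (auto simp: \<sigma>_def)
    have lt: "j - 1 < n" "k - 1 < n" using jk by auto
    have "j - 1 = k - 1"
      using row[OF f(1)[OF lt(1)]] f[OF lt(1)] f[OF lt(2)] eq lt by metis
    then show "j = k" using jk by auto
  qed
  have im: "\<sigma> ` {1..n} \<subseteq> {1..n}"
  proof
    fix i assume "i \<in> \<sigma> ` {1..n}"
    then obtain k where k: "k \<in> {1..n}" "i = Suc (f (k - 1))" by (auto simp: \<sigma>_def)
    then have "k - 1 < n" by auto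
    then show "i \<in> {1..n}" using f(1) k(2) by fastforce
  qed
  have "\<sigma> permutes {1..n}"
    using inj endo_inj_surj[OF _ im inj] by (intro bij_imp_permutes) (auto simp: bij_betw_def \<sigma>_def)
  moreover have "a k ^ r = 1" if "k \<in> {1..n}" for k
  proof -
    have "k - 1 < n" using that by auto
    then show ?thesis using f root by (auto simp: a_def)
  qed
  moreover have "w = mono_mat n \<sigma> a"
    using w f_unique by (intro eq_matI) (auto simp: mono_mat_def \<sigma>_def a_def)
  ultimately show thesis using that by blast
qed

lemma Grn_simps [simp]:
  "mult (Grn r n) = (*)" "one (Grn r n) = 1\<^sub>m n"
  by (simp_all add: Grn_def)

lemma Grn_carrier_mat: "w \<in> carrier (Grn r n) \<Longrightarrow> w \<in> carrier_mat n n"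
  by (auto simp: Grn_def monomial_mat_def)

lemma one_in_Grn: "r \<ge> 1 \<Longrightarrow> 1\<^sub>m n \<in> carrier (Grn r n)"
  using mono_mat_in_Grn[of id n "\<lambda>_. 1" r] by (simp add: mono_mat_one permutes_id)

lemma root_inverse_comp:
  assumes "\<sigma> permutes {1..n}" "\<And>k. k \<in> {1..n} \<Longrightarrow> a k ^ r = (1::complex)" "k \<in> {1..n}"
  shows "(1 / a (Hilbert_Choice.inv \<sigma> k)) ^ r = 1"
  using assms(2)[of "Hilbert_Choice.inv \<sigma> k"] permutes_in_image[OF permutes_inv[OF assms(1)], of k] assms(3)
  by (simp add: power_one_over)

lemma mono_mat_left_inverse:
  assumes \<sigma>: "\<sigma> permutes {1..n}" and a: "\<And>k. k \<in> {1..n} \<Longrightarrow> a k \<noteq> 0"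
  shows "mono_mat n (Hilbert_Choice.inv \<sigma>) (\<lambda>k. 1 / a (Hilbert_Choice.inv \<sigma> k)) * mono_mat n \<sigma> a = 1\<^sub>m n"
  unfolding mono_mat_mult[OF \<sigma>] mono_mat_one[symmetric]
  using a permutes_inverses[OF \<sigma>] by (intro mono_mat_cong) auto

lemma root_nonzero: "r \<ge> 1 \<Longrightarrow> (x::complex) ^ r = 1 \<Longrightarrow> x \<noteq> 0"
  by (auto simp: power_0_left)

lemma group_Grn:
  assumes r: "r \<ge> 1"
  shows "group (Grn r n)"
proof (rule groupI)
  fix v w assume "v \<in> carrier (Grn r n)" "w \<in> carrier (Grn r n)"
  then obtain \<sigma> a \<tau> b where v: "\<sigma> permutes {1..n}" "\<And>k. k \<in> {1..n} \<Longrightarrow> a k ^ r = 1" "v = mono_mat n \<sigma> a"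
    and w: "\<tau> permutes {1..n}" "\<And>k. k \<in> {1..n} \<Longrightarrow> b k ^ r = 1" "w = mono_mat n \<tau> b"
    by (metis Grn_mono_mat)
  have "\<tau> k \<in> {1..n}" if "k \<in> {1..n}" for k using that permutes_in_image[OF w(1)] by blast
  then have "mono_mat n (\<sigma> \<circ> \<tau>) (\<lambda>k. a (\<tau> k) * b k) \<in> carrier (Grn r n)"
    using v w r by (intro mono_mat_in_Grn permutes_compose) (auto simp: power_mult_distrib)
  then show "v \<otimes>\<^bsub>Grn r n\<^esub> w \<in> carrier (Grn r n)"
    by (simp add: v(3) w(3) mono_mat_mult[OF w(1)])
next
  fix w assume "w \<in> carrier (Grn r n)"
  then obtain \<sigma> a where w: "\<sigma> permutes {1..n}" "\<And>k. k \<in> {1..n} \<Longrightarrow> a k ^ r = 1" "w = mono_mat n \<sigma> a"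
    by (metis Grn_mono_mat)
  have "mono_mat n (Hilbert_Choice.inv \<sigma>) (\<lambda>k. 1 / a (Hilbert_Choice.inv \<sigma> k)) \<in> carrier (Grn r n)"
    using w r root_inverse_comp[OF w(1), of a r] by (intro mono_mat_in_Grn permutes_inv) auto
  moreover have "mono_mat n (Hilbert_Choice.inv \<sigma>) (\<lambda>k. 1 / a (Hilbert_Choice.inv \<sigma> k)) * w = 1\<^sub>m n"
    using mono_mat_left_inverse[OF w(1), of a] w root_nonzero[OF r] by auto
  ultimately show "\<exists>y\<in>carrier (Grn r n). y \<otimes>\<^bsub>Grn r n\<^esub> w = \<one>\<^bsub>Grn r n\<^esub>"
    by auto
qed (use one_in_Grn[OF r] Grn_carrier_mat in \<open>auto simp: assoc_mult_mat[of _ n n _ n _ n] left_mult_one_mat[of _ n n]\<close>)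

lemma inv_mono_mat:
  assumes r: "r \<ge> 1" and \<sigma>: "\<sigma> permutes {1..n}" and a: "\<And>k. k \<in> {1..n} \<Longrightarrow> a k ^ r = 1"
  shows "inv\<^bsub>Grn r n\<^esub> (mono_mat n \<sigma> a) = mono_mat n (Hilbert_Choice.inv \<sigma>) (\<lambda>k. 1 / a (Hilbert_Choice.inv \<sigma> k))"
proof (rule group.inv_equality[OF group_Grn[OF r]])
  show "mono_mat n (Hilbert_Choice.inv \<sigma>) (\<lambda>k. 1 / a (Hilbert_Choice.inv \<sigma> k)) \<otimes>\<^bsub>Grn r n\<^esub> mono_mat n \<sigma> a = \<one>\<^bsub>Grn r n\<^esub>"
    using mono_mat_left_inverse[OF \<sigma>, of a] a root_nonzero[OF r] by simp
qed (use mono_mat_in_Grn[OF \<sigma> a r] mono_mat_in_Grn[OF permutes_inv[OF \<sigma>] root_inverse_comp[OF \<sigma> a] r] in auto)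

section \<open>Powers of \<zeta>, the reflections, and sums over r-th roots of unity\<close>

lemma zeta_power: "r \<ge> 1 \<Longrightarrow> zeta r ^ r = 1"
  by (simp add: zeta_def flip: exp_of_nat_mult)

lemma zeta_nonzero [simp]: "zeta r \<noteq> 0"
  by (simp add: zeta_def)

lemma zeta_powi_root: "r \<ge> 1 \<Longrightarrow> (zeta r powi l) ^ r = 1"
  using zeta_power[of r] by (metis power_int_mult power_int_of_nat mult.commute power_int_1_left)

lemma zeta_mat_mono_mat: "zeta_mat r n i = mono_mat n id (\<lambda>k. if k = i then zeta r else 1)"
  by (intro eq_matI) (auto simp: mono_mat_def zeta_mat_def)

lemma transp_mat_mono_mat: "transp_mat n i j = mono_mat n (transpose i j) (\<lambda>_. 1)"
  by (intro eq_matI) (auto simp: mono_mat_def transp_mat_def)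

lemma transp_mat_in_Grn:
  "i \<in> {1..n} \<Longrightarrow> j \<in> {1..n} \<Longrightarrow> r \<ge> 1 \<Longrightarrow> transp_mat n i j \<in> carrier (Grn r n)"
  unfolding transp_mat_mono_mat by (intro mono_mat_in_Grn permutes_swap_id) auto

lemma zeta_pow_nat:
  assumes r: "r \<ge> 1"
  shows "zeta_mat r n i [^]\<^bsub>Grn r n\<^esub> (m::nat) = mono_mat n id (\<lambda>k. if k = i then zeta r ^ m else 1)"
proof (induction m)
  case 0
  show ?case by (simp flip: mono_mat_one) (auto intro!: mono_mat_cong)
next
  case (Suc m)
  then show ?case
    by (simp add: zeta_mat_mono_mat mono_mat_mult[OF permutes_id] cong: if_cong)
       (auto intro!: mono_mat_cong)
qed

lemma zeta_pow_mono_mat: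
  assumes r: "r \<ge> 1"
  shows "zeta_pow r n i l = mono_mat n id (\<lambda>k. if k = i then zeta r powi l else 1)"
proof (cases "l < 0")
  case False
  then show ?thesis
    by (simp add: zeta_pow_def int_pow_def2 zeta_pow_nat[OF r])
       (auto intro!: mono_mat_cong simp: power_int_def)
next
  case True
  have "inv\<^bsub>Grn r n\<^esub> (mono_mat n id (\<lambda>k. if k = i then zeta r ^ nat (- l) else 1)) =
     mono_mat n (Hilbert_Choice.inv id) (\<lambda>k. 1 / (if Hilbert_Choice.inv id k = i then zeta r ^ nat (- l) else 1))"
    by (rule inv_mono_mat[OF r permutes_id]) (use zeta_power[OF r] in \<open>auto simp: power_commutes simp flip: power_mult\<close>, metis mult.commute power_mult power_one)
  then show ?thesis
    using True
    by (simp add: zeta_pow_def int_pow_def2 zeta_pow_nat[OF r] power_int_def inverse_eq_divide power_one_over)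
       (auto intro!: mono_mat_cong simp: power_int_def field_simps)
qed

text \<open>The reflection \<open>refl_mat\<close> with the root \<open>u\<close> in place of the
  l-th power of \<zeta>. Indexing by roots turns shifts and negations of exponents modulo r into
  multiplication and inversion.\<close>

definition root_refl :: "nat \<Rightarrow> nat \<Rightarrow> nat \<Rightarrow> complex \<Rightarrow> complex mat" where
  "root_refl n i j u = mono_mat n (transpose i j) (\<lambda>k. if k = i then 1 / u else if k = j then u else 1)"

lemma refl_mat_eq:
  assumes r: "r \<ge> 1" and i: "i \<in> {1..n}" and j: "j \<in> {1..n}" and "i \<noteq> j"
  shows "refl_mat r n i j l = root_refl n i j (zeta r ^ l)"
  unfolding refl_mat_def zeta_pow_mono_mat[OF r] transp_mat_mono_mat root_refl_def
    mono_mat_mult[OF permutes_id] mono_mat_mult[OF permutes_swap_id[OF i j]]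
  using \<open>i \<noteq> j\<close>
  by (intro mono_mat_cong) (auto simp: power_int_minus inverse_eq_divide transpose_def)

lemma bij_betw_zeta:
  assumes r: "r \<ge> 1"
  shows "bij_betw (\<lambda>l. zeta r ^ l) {..<r} {u. u ^ r = 1}"
proof -
  have "zeta r ^ l = cis (2 * pi * real l / real r)" for l
    by (simp add: zeta_def cis_conv_exp mult_ac flip: exp_of_nat_mult)
  then show ?thesis
    using bij_betw_roots_unity[of r] r by simp
qed

lemma finite_roots: "r \<ge> 1 \<Longrightarrow> finite {u::complex. u ^ r = 1}"
  using bij_betw_finite[OF bij_betw_zeta[of r]] by simp

lemma sum_zeta_roots:
  assumes "r \<ge> 1"
  shows "(\<Sum>l<r. f (zeta r ^ l)) = (\<Sum>u | u ^ r = 1. f u)"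
  by (rule sum.reindex_bij_betw[OF bij_betw_zeta[OF assms]])

text \<open>Multiplication by \<open>v\<close> permutes the group of roots. This absorbs the ratio
  of matrix entries that conjugation puts on the root of a reflection.\<close>

lemma sum_roots_mult:
  assumes r: "r \<ge> 1" and v: "v ^ r = (1::complex)"
  shows "(\<Sum>u | u ^ r = 1. f (v * u)) = (\<Sum>u | u ^ r = 1. f u)"
proof -
  have "v \<noteq> 0" using root_nonzero[OF r v] .
  then have "bij_betw ((*) v) {u. u ^ r = 1} {u. u ^ r = 1}"
    using v by (intro bij_betw_byWitness[where f' = "\<lambda>u. u / v"])
      (auto simp: power_mult_distrib power_divide)
  then show ?thesis by (rule sum.reindex_bij_betw)
qed

lemma sum_roots_inverse: "(\<Sum>u | u ^ r = (1::complex). f (1 / u)) = (\<Sum>u | u ^ r = 1. f u)"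
  by (rule sum.reindex_bij_betw, rule bij_betw_byWitness[where f' = "\<lambda>u. 1 / u"])
    (auto simp: power_divide)

lemma mono_mat_unit_vec:
  assumes \<sigma>: "\<sigma> permutes {1..n}" and "j \<in> {1..n}"
  shows "mono_mat n \<sigma> a *\<^sub>v unit_vec n (j - 1) = a j \<cdot>\<^sub>v unit_vec n (\<sigma> j - 1)"
proof (rule eq_vecI)
  have sj: "\<sigma> j \<in> {1..n}" using assms permutes_in_image[OF \<sigma>] by blast
  fix p assume p: "p < dim_vec (a j \<cdot>\<^sub>v unit_vec n (\<sigma> j - 1))"
  have "row (mono_mat n \<sigma> a) p \<bullet> unit_vec n (j - 1) = row (mono_mat n \<sigma> a) p $ (j - 1)"
    using assms by (intro scalar_prod_right_unit) auto
  also have "\<dots> = (a j \<cdot>\<^sub>v unit_vec n (\<sigma> j - 1)) $ p"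
    using assms sj p by (auto simp: mono_mat_def unit_vec_def)
  finally show "(mono_mat n \<sigma> a *\<^sub>v unit_vec n (j - 1)) $ p = (a j \<cdot>\<^sub>v unit_vec n (\<sigma> j - 1)) $ p"
    using p by (simp add: mono_mat_def)
qed (simp add: mono_mat_def)

text \<open>Linear forms are acted on through the inverse matrix, hence the reciprocal of the
  coefficient that vectors receive.\<close>

lemma dual_act_unit_vec:
  assumes r: "r \<ge> 1" and \<sigma>: "\<sigma> permutes {1..n}" and a: "\<And>k. k \<in> {1..n} \<Longrightarrow> a k ^ r = 1"
    and j: "j \<in> {1..n}"
  shows "dual_act r n (mono_mat n \<sigma> a) (unit_vec n (j - 1)) = (1 / a j) \<cdot>\<^sub>v unit_vec n (\<sigma> j - 1)"
proof (rule eq_vecI)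
  have sj: "\<sigma> j \<in> {1..n}" using j permutes_in_image[OF \<sigma>] by blast
  fix p assume "p < dim_vec ((1 / a j) \<cdot>\<^sub>v unit_vec n (\<sigma> j - 1))"
  then have p: "p < n" by simp
  then have isp: "Hilbert_Choice.inv \<sigma> (Suc p) \<in> {1..n}" using permutes_in_image[OF permutes_inv[OF \<sigma>], of "Suc p"] by auto
  \<comment> \<open>Both indices are at least 1, so the truncated subtraction loses nothing.\<close>
  have eq_pred: "Hilbert_Choice.inv \<sigma> (Suc p) - Suc 0 = j - Suc 0 \<longleftrightarrow> Hilbert_Choice.inv \<sigma> (Suc p) = j"
    using j isp unfolding atLeastAtMost_iff by arith
  have inv_eq: "inv\<^bsub>Grn r n\<^esub> (mono_mat n \<sigma> a) = mono_mat n (Hilbert_Choice.inv \<sigma>) (\<lambda>k. 1 / a (Hilbert_Choice.inv \<sigma> k))"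
    by (rule inv_mono_mat[OF r \<sigma> a])
  have eq: "Hilbert_Choice.inv \<sigma> (Suc p) = j \<longleftrightarrow> Suc p = \<sigma> j" using permutes_inverses[OF \<sigma>] by metis
  have "dual_act r n (mono_mat n \<sigma> a) (unit_vec n (j - 1)) $ p =
      unit_vec n (j - 1) \<bullet> (mono_mat n (Hilbert_Choice.inv \<sigma>) (\<lambda>k. 1 / a (Hilbert_Choice.inv \<sigma> k)) *\<^sub>v unit_vec n (Suc p - 1))"
    using p by (simp add: dual_act_def inv_eq)
  also have "\<dots> = unit_vec n (j - 1) \<bullet> ((1 / a (Hilbert_Choice.inv \<sigma> (Suc p))) \<cdot>\<^sub>v unit_vec n (Hilbert_Choice.inv \<sigma> (Suc p) - 1))"
    using p by (subst mono_mat_unit_vec[OF permutes_inv[OF \<sigma>]]) auto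
  also have "\<dots> = (1 / a (Hilbert_Choice.inv \<sigma> (Suc p))) * (if Hilbert_Choice.inv \<sigma> (Suc p) = j then 1 else 0)"
    using j isp eq_pred by auto
  also have "\<dots> = ((1 / a j) \<cdot>\<^sub>v unit_vec n (\<sigma> j - 1)) $ p"
    using eq sj j p permutes_inverses[OF \<sigma>] by (auto simp: unit_vec_def)
  finally show "dual_act r n (mono_mat n \<sigma> a) (unit_vec n (j - 1)) $ p = ((1 / a j) \<cdot>\<^sub>v unit_vec n (\<sigma> j - 1)) $ p" .
qed (simp add: dual_act_def)

section \<open>Orthogonality of characters and Fourier inversion for the parameters d_j\<close>

lemma sum_zeta_orthogonal:
  assumes r: "r \<ge> 1" and "l < r" "m < r"
  shows "(\<Sum>j<r. zeta r powi (int l * int j) * zeta r powi (- (int m * int j))) = (if l = m then of_nat r else 0)"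
proof -
  \<comment> \<open>The sum is a geometric series in this root of unity, which is 1 only for equal
    exponents because both lie below \<open>r\<close>.\<close>
  define w where "w = zeta r ^ l / zeta r ^ m"
  have pw: "zeta r powi (int l * int j) * zeta r powi (- (int m * int j)) = w ^ j" for j
    by (simp add: w_def power_int_mult power_int_minus power_mult_distrib power_inverse divide_inverse)
  have "w = 1 \<longleftrightarrow> l = m"
    using bij_betw_zeta[OF r] assms by (auto simp: w_def bij_betw_def inj_on_def)
  moreover have "w ^ r = 1"
  proof -
    have "w ^ r = (zeta r ^ r) ^ l / (zeta r ^ r) ^ m"
      by (simp add: w_def power_divide mult.commute flip: power_mult)
    then show ?thesis using zeta_power[OF r] by simp
  qed
  moreover have "(\<Sum>j<r. w ^ j) = (w ^ r - 1) / (w - 1)" if "w \<noteq> 1"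
    using that by (rule geometric_sum)
  ultimately show ?thesis unfolding pw by (cases "w = 1") auto
qed

lemma d_coeff_diff:
  "d_coeff r c j - d_coeff r c (j - 1) = (\<Sum>l\<in>{1..<r}. c l * (1 - zeta r powi (- int l)) * zeta r powi (int l * j))"
  unfolding d_coeff_def sum_subtractf[symmetric]
  by (intro sum.cong) (auto simp: power_int_diff power_int_minus field_simps)

text \<open>By \<open>d_coeff_diff\<close> the differences of the d_j are the Fourier transform of
  \<open>c l * (1 - zeta r powi (- int l))\<close>, supported on 1 \<le> l < r; this inverts the
  transform. The coefficient at 0 is 0, and \<open>c 0\<close> belongs to the reflections exchanging
  coordinates instead.\<close>

lemma d_coeff_fourier:
  assumes r: "r \<ge> 1" and m: "m < r"
  shows "(\<Sum>j<r. (d_coeff r c (int j) - d_coeff r c (int j - 1)) * (1 / of_nat r) * zeta r powi (- (int m * int j)))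
    = (if m = 0 then 0 else c m * (1 - zeta r powi (- int m)))"
proof -
  have "(\<Sum>j<r. (d_coeff r c (int j) - d_coeff r c (int j - 1)) * (1 / of_nat r) * zeta r powi (- (int m * int j)))
     = (\<Sum>j<r. \<Sum>l\<in>{1..<r}. c l * (1 - zeta r powi (- int l)) / of_nat r *
          (zeta r powi (int l * int j) * zeta r powi (- (int m * int j))))"
    unfolding d_coeff_diff sum_distrib_right by (intro sum.cong refl) (simp add: mult_ac)
  also have "\<dots> = (\<Sum>l\<in>{1..<r}. c l * (1 - zeta r powi (- int l)) / of_nat r *
      (\<Sum>j<r. zeta r powi (int l * int j) * zeta r powi (- (int m * int j))))"
    by (subst sum.swap) (simp only: sum_distrib_left)
  also have "\<dots> = (\<Sum>l\<in>{1..<r}. c l * (1 - zeta r powi (- int l)) / of_nat r * (if l = m then of_nat r else 0))"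
    using m by (intro sum.cong refl) (simp add: sum_zeta_orthogonal[OF r])
  also have "\<dots> = (\<Sum>l\<in>{1..<r}. if l = m then c l * (1 - zeta r powi (- int l)) else 0)"
    using r by (intro sum.cong) auto
  also have "\<dots> = (if m = 0 then 0 else c m * (1 - zeta r powi (- int m)))"
    using m by simp
  finally show ?thesis .
qed

section \<open>Products of simple transpositions\<close>

definition swap_prod :: "nat list \<Rightarrow> nat \<Rightarrow> nat" where
  "swap_prod is = foldr (\<lambda>i f. transpose i (Suc i) \<circ> f) is id"

lemma swap_prod_simps [simp]:
  "swap_prod [] = id" "swap_prod (i # is) = transpose i (Suc i) \<circ> swap_prod is"
  by (simp_all add: swap_prod_def)

lemma swap_prod_append: "swap_prod (is @ js) = swap_prod is \<circ> swap_prod js"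
  by (induction "is") (auto simp: comp_assoc)

lemma swap_prod_permutes: "set is \<subseteq> {1..<n} \<Longrightarrow> swap_prod is permutes {1..n}"
  by (induction "is") (auto simp: permutes_id intro!: permutes_compose permutes_swap_id)

lemma swap_prod_rev: "swap_prod (rev is) \<circ> swap_prod is = id"
proof (induction "is")
  case (Cons i "is")
  then show ?case by (simp add: swap_prod_append fun_eq_iff)
qed simp

lemma swap_prod_rev': "swap_prod is \<circ> swap_prod (rev is) = id"
  using swap_prod_rev[of "rev is"] by simp

text \<open>The rightmost factor acts first and takes m to m - 1; the others carry it on down to 1.
  This is what turns x_n into x_1 inside \<Psi>\<Phi>.\<close>

lemma swap_prod_upt: "m \<ge> 1 \<Longrightarrow> swap_prod [1..<m] m = 1"
  by (induction m rule: dec_induct) (auto simp: swap_prod_append)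

lemma mat_prod_list_swaps:
  "set is \<subseteq> {1..<n} \<Longrightarrow> mat_prod_list n (map (simple_refl n) is) = mono_mat n (swap_prod is) (\<lambda>_. 1)"
proof (induction "is")
  case Nil
  show ?case using mono_mat_one[of n] by (simp add: mat_prod_list_def id_def)
next
  case (Cons i "is")
  then have "mat_prod_list n (map (simple_refl n) (i # is)) =
      mono_mat n (transpose i (Suc i)) (\<lambda>_. 1) * mono_mat n (swap_prod is) (\<lambda>_. 1)"
    by (simp add: mat_prod_list_def) (simp add: simple_refl_def transp_mat_mono_mat)
  also have "\<dots> = mono_mat n (swap_prod (i # is)) (\<lambda>_. 1)"
    using Cons.prems by (subst mono_mat_mult[OF swap_prod_permutes]) auto
  finally show ?case .
qed

section \<open>Symmetric polynomials\<close>

lemma poly_mapping_sum_singles: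
  "p = (\<Sum>k\<in>Poly_Mapping.keys p. Poly_Mapping.single k (Poly_Mapping.lookup p k))"
  by (rule poly_mapping_eqI)
     (auto simp: lookup_sum lookup_single when_def in_keys_iff)

text \<open>One induction principle for three uses: polynomials, their exponent vectors, and
  elements of the free algebra.\<close>

lemma poly_mapping_single_induct:
  assumes "P 0" and "\<And>k v. P (Poly_Mapping.single k v)" and "\<And>p q. P p \<Longrightarrow> P q \<Longrightarrow> P (p + q)"
  shows "P (p :: 'a \<Rightarrow>\<^sub>0 'b::comm_monoid_add)"
proof -
  have "P (\<Sum>k\<in>K. Poly_Mapping.single k (f k))" if "finite K" for K and f :: "'a \<Rightarrow> 'b"
    using that by induction (auto simp: assms)
  from this[of "Poly_Mapping.keys p" "Poly_Mapping.lookup p"] show ?thesis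
    by (simp flip: poly_mapping_sum_singles)
qed

text \<open>The inner \<open>map_key\<close> acts on exponent vectors, the outer one on families
  indexed by them. Each pulls back, and together they push forward: variable k goes to variable
  \<open>\<sigma> k\<close>.\<close>

definition perm_poly :: "(nat \<Rightarrow> nat) \<Rightarrow> mpoly \<Rightarrow> mpoly" where
  "perm_poly \<sigma> p = Poly_Mapping.map_key (Poly_Mapping.map_key \<sigma>) p"

definition pvar :: "nat \<Rightarrow> mpoly" where
  "pvar k = Poly_Mapping.single (Poly_Mapping.single k 1) 1"

lemma map_key_cancel:
  assumes "\<sigma> permutes S"
  shows "Poly_Mapping.map_key \<sigma> (Poly_Mapping.map_key (Hilbert_Choice.inv \<sigma>) m) = m"
    "Poly_Mapping.map_key (Hilbert_Choice.inv \<sigma>) (Poly_Mapping.map_key \<sigma> m) = m"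
  using map_key_compose[OF permutes_inj[OF assms] permutes_inj[OF permutes_inv[OF assms]], of m]
    map_key_compose[OF permutes_inj[OF permutes_inv[OF assms]] permutes_inj[OF assms], of m]
    permutes_inv_o[OF assms] map_key_id[of m]
  by (simp_all add: id_def)

lemma inj_map_key: "\<sigma> permutes S \<Longrightarrow> inj (Poly_Mapping.map_key \<sigma>)"
  using map_key_cancel(2) by (metis injI)

lemma lookup_perm_poly:
  "\<sigma> permutes S \<Longrightarrow> Poly_Mapping.lookup (perm_poly \<sigma> p) m = Poly_Mapping.lookup p (Poly_Mapping.map_key \<sigma> m)"
  unfolding perm_poly_def by (simp add: map_key.rep_eq[OF inj_map_key])

lemma perm_poly_add: "\<sigma> permutes S \<Longrightarrow> perm_poly \<sigma> (p + q) = perm_poly \<sigma> p + perm_poly \<sigma> q"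
  by (rule poly_mapping_eqI) (simp add: lookup_perm_poly lookup_add)

lemma perm_poly_diff: "\<sigma> permutes S \<Longrightarrow> perm_poly \<sigma> (p - q) = perm_poly \<sigma> p - perm_poly \<sigma> q"
  by (rule poly_mapping_eqI) (simp add: lookup_perm_poly lookup_minus)

lemma perm_poly_single:
  assumes "\<sigma> permutes S"
  shows "perm_poly \<sigma> (Poly_Mapping.single m v) = Poly_Mapping.single (Poly_Mapping.map_key (Hilbert_Choice.inv \<sigma>) m) v"
proof (rule poly_mapping_eqI)
  fix k
  have "m = Poly_Mapping.map_key \<sigma> k \<longleftrightarrow> Poly_Mapping.map_key (Hilbert_Choice.inv \<sigma>) m = k"
    using map_key_cancel[OF assms] by metis
  then show "Poly_Mapping.lookup (perm_poly \<sigma> (Poly_Mapping.single m v)) k =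
      Poly_Mapping.lookup (Poly_Mapping.single (Poly_Mapping.map_key (Hilbert_Choice.inv \<sigma>) m) v) k"
    by (simp add: lookup_perm_poly[OF assms] lookup_single when_def)
qed

lemma perm_poly_0: "\<sigma> permutes S \<Longrightarrow> perm_poly \<sigma> 0 = 0"
  by (rule poly_mapping_eqI) (simp add: lookup_perm_poly)

lemma perm_poly_mult:
  assumes "\<sigma> permutes S"
  shows "perm_poly \<sigma> (p * q) = perm_poly \<sigma> p * perm_poly \<sigma> q"
proof (induction p rule: poly_mapping_single_induct)
  case (2 m v)
  show ?case
    by (induction q rule: poly_mapping_single_induct)
       (auto simp: perm_poly_0[OF assms] mult_single perm_poly_single[OF assms] perm_poly_add[OF assms] distrib_left
          map_key_plus[OF permutes_inj[OF permutes_inv[OF assms]]])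
qed (auto simp: perm_poly_0[OF assms] perm_poly_add[OF assms] distrib_right)

lemma perm_poly_1: "\<sigma> permutes S \<Longrightarrow> perm_poly \<sigma> 1 = 1"
  using perm_poly_single[of \<sigma> S 0 1] by (simp add: map_key_zero[OF permutes_inj[OF permutes_inv]])

lemma perm_poly_prod:
  assumes "\<sigma> permutes S"
  shows "perm_poly \<sigma> (prod f A) = (\<Prod>a\<in>A. perm_poly \<sigma> (f a))"
  by (induction A rule: infinite_finite_induct) (auto simp: perm_poly_1[OF assms] perm_poly_mult[OF assms])

lemma perm_poly_pvar:
  assumes "\<sigma> permutes S"
  shows "perm_poly \<sigma> (pvar k) = pvar (\<sigma> k)"
  using map_key_single[OF permutes_inj[OF permutes_inv[OF assms]], of "\<sigma> k" "1::nat"] permutes_inverses(2)[OF assms, of k]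
  by (simp add: pvar_def perm_poly_single[OF assms] del: One_nat_def)

lemma symmetric_poly_iff:
  "symmetric_poly n p \<longleftrightarrow> (\<forall>m\<in>Poly_Mapping.keys p. Poly_Mapping.keys m \<subseteq> {1..n}) \<and>
     (\<forall>\<sigma>. \<sigma> permutes {1..n} \<longrightarrow> perm_poly \<sigma> p = p)"
  unfolding symmetric_poly_def by (auto simp: poly_mapping_eq_iff fun_eq_iff lookup_perm_poly)

lemma symmetric_poly_1: "symmetric_poly n 1"
  by (auto simp: symmetric_poly_iff perm_poly_1)

lemma keys_add_subset: "Poly_Mapping.keys a \<subseteq> S \<Longrightarrow> Poly_Mapping.keys b \<subseteq> S \<Longrightarrow> Poly_Mapping.keys (a + b) \<subseteq> S"
  using keys_add[of a b] by blast

lemma vars_mult: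
  assumes "\<And>m. m \<in> Poly_Mapping.keys p \<Longrightarrow> Poly_Mapping.keys m \<subseteq> S"
    and "\<And>m. m \<in> Poly_Mapping.keys q \<Longrightarrow> Poly_Mapping.keys m \<subseteq> S"
    and "m \<in> Poly_Mapping.keys (p * q :: mpoly)"
  shows "Poly_Mapping.keys m \<subseteq> S"
proof -
  obtain a b where "m = a + b" "a \<in> Poly_Mapping.keys p" "b \<in> Poly_Mapping.keys q"
    using keys_mult[of p q] assms(3) by auto
  then show ?thesis using assms(1,2) by (simp add: keys_add_subset)
qed

lemma symmetric_poly_mult: "symmetric_poly n p \<Longrightarrow> symmetric_poly n q \<Longrightarrow> symmetric_poly n (p * q)"
  unfolding symmetric_poly_iff using vars_mult[of p "{1..n}" q] by (simp add: perm_poly_mult)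

lemma pvar_eq_iff [simp]: "pvar i = pvar j \<longleftrightarrow> i = j"
  by (auto simp: pvar_def dest!: arg_cong[where f = "Poly_Mapping.keys"])

section \<open>A symmetric polynomial divisible by every difference of two variables\<close>

definition diff_pairs :: "nat \<Rightarrow> (nat \<times> nat) set" where
  "diff_pairs n = {(j, k). j \<in> {1..n} \<and> k \<in> {1..n} \<and> j \<noteq> k}"

text \<open>The squared Vandermonde product up to sign. Taking ordered pairs lets a permutation
  merely reindex the factors, with no sign to track.\<close>

definition discr :: "nat \<Rightarrow> mpoly" where
  "discr n = (\<Prod>(j, k)\<in>diff_pairs n. pvar j - pvar k)"

lemma finite_diff_pairs [simp]: "finite (diff_pairs n)"
  by (rule finite_subset[of _ "{1..n} \<times> {1..n}"]) (auto simp: diff_pairs_def)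

lemma discr_nonzero: "discr n \<noteq> 0"
  by (auto simp: discr_def prod_zero_iff) (auto simp: diff_pairs_def)

lemma vars_diff_pairs_prod:
  assumes "finite A" "A \<subseteq> diff_pairs n"
  shows "m \<in> Poly_Mapping.keys (\<Prod>(j, k)\<in>A. pvar j - pvar k) \<Longrightarrow> Poly_Mapping.keys m \<subseteq> {1..n}"
  using assms
proof (induction A arbitrary: m)
  case (insert jk A)
  obtain j k where jk: "jk = (j, k)" by force
  have "Poly_Mapping.keys m' \<subseteq> {1..n}" if "m' \<in> Poly_Mapping.keys (pvar j - pvar k)" for m'
    using that insert.prems(2) jk by (auto simp: in_keys_iff lookup_minus pvar_def lookup_single when_def diff_pairs_def split: if_splits)
  then show ?case
    using insert jk vars_mult[of "pvar j - pvar k" "{1..n}" "\<Prod>(j, k)\<in>A. pvar j - pvar k" m] by auto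
qed auto

lemma symmetric_discr: "symmetric_poly n (discr n)"
  unfolding symmetric_poly_iff
proof (intro conjI ballI allI impI)
  show "Poly_Mapping.keys m \<subseteq> {1..n}" if "m \<in> Poly_Mapping.keys (discr n)" for m
    using vars_diff_pairs_prod[of "diff_pairs n" n m] that by (simp add: discr_def)
  fix \<sigma> assume \<sigma>: "\<sigma> permutes {1..n}"
  have "bij_betw (\<lambda>(j, k). (\<sigma> j, \<sigma> k)) (diff_pairs n) (diff_pairs n)"
    using permutes_inverses[OF \<sigma>] permutes_in_image[OF \<sigma>] permutes_in_image[OF permutes_inv[OF \<sigma>]]
    by (intro bij_betw_byWitness[where f' = "\<lambda>(j, k). (Hilbert_Choice.inv \<sigma> j, Hilbert_Choice.inv \<sigma> k)"])
       (auto simp: diff_pairs_def, metis+)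
  then have "(\<Prod>x\<in>diff_pairs n. (\<lambda>(j, k). pvar j - pvar k) (case x of (j, k) \<Rightarrow> (\<sigma> j, \<sigma> k))) = discr n"
    unfolding discr_def by (rule prod.reindex_bij_betw)
  then show "perm_poly \<sigma> (discr n) = discr n"
    by (simp add: discr_def perm_poly_prod[OF \<sigma>] case_prod_beta perm_poly_diff[OF \<sigma>] perm_poly_pvar[OF \<sigma>])
qed

section \<open>Localization at central denominators\<close>

locale central_denominators = ring R for R (structure) +
  fixes S
  assumes denom_closed: "S \<subseteq> carrier R"
    and denom_one: "\<one> \<in> S"
    and denom_mult: "\<And>s t. s \<in> S \<Longrightarrow> t \<in> S \<Longrightarrow> s \<otimes> t \<in> S"
    and denom_central: "\<And>s a. s \<in> S \<Longrightarrow> a \<in> carrier R \<Longrightarrow> s \<otimes> a = a \<otimes> s"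
begin

abbreviation L :: "('a \<times> 'a) set ring" where "L \<equiv> localization R S"
abbreviation fr :: "'a \<Rightarrow> 'a \<Rightarrow> ('a \<times> 'a) set" where "fr \<equiv> frac R S"

lemma denom_in [simp]: "s \<in> S \<Longrightarrow> s \<in> carrier R"
  using denom_closed by blast

lemma frac_relI:
  assumes "a \<in> carrier R" "b \<in> carrier R" "s \<in> S" "t \<in> S" "u \<in> S" "u \<otimes> (a \<otimes> t) = u \<otimes> (b \<otimes> s)"
  shows "((a, s), (b, t)) \<in> frac_rel R S"
  unfolding frac_rel_def using assms
  by (auto intro!: bexI[of _ u] simp: minus_eq r_distr r_minus r_neg)

lemma frac_relE:
  assumes "((a, s), (b, t)) \<in> frac_rel R S"
  obtains u where "a \<in> carrier R" "b \<in> carrier R" "s \<in> S" "t \<in> S" "u \<in> S" "u \<otimes> (a \<otimes> t) = u \<otimes> (b \<otimes> s)"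
proof -
  obtain u where u: "a \<in> carrier R" "b \<in> carrier R" "s \<in> S" "t \<in> S" "u \<in> S" "u \<otimes> (a \<otimes> t \<ominus> b \<otimes> s) = \<zero>"
    using assms unfolding frac_rel_def by blast
  then have "u \<otimes> (a \<otimes> t) \<ominus> u \<otimes> (b \<otimes> s) = \<zero>"
    by (simp add: minus_eq r_distr r_minus)
  then show thesis using u that[of u] by (simp add: r_right_minus_eq)
qed

lemma denom_lcomm: "s \<in> S \<Longrightarrow> a \<in> carrier R \<Longrightarrow> b \<in> carrier R \<Longrightarrow> a \<otimes> (s \<otimes> b) = s \<otimes> (a \<otimes> b)"
  by (metis denom_central denom_in m_assoc)

lemma denom_comm: "s \<in> S \<Longrightarrow> a \<in> carrier R \<Longrightarrow> a \<otimes> s = s \<otimes> a"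
  by (simp add: denom_central)

definition act :: "'a \<Rightarrow> 'a \<Rightarrow> 'a" where "act s a = s \<otimes> a"

lemma act_closed [simp]: "s \<in> S \<Longrightarrow> a \<in> carrier R \<Longrightarrow> act s a \<in> carrier R"
  "s \<in> S \<Longrightarrow> t \<in> S \<Longrightarrow> act s t \<in> S"
  by (simp_all add: act_def denom_mult)

text \<open>Multiplication by a denominator as an action: with these rules the simplifier moves all
  denominators to the front.\<close>

lemma act_simps:
  "s \<in> S \<Longrightarrow> a \<in> carrier R \<Longrightarrow> s \<otimes> a = act s a"
  "s \<in> S \<Longrightarrow> a \<in> carrier R \<Longrightarrow> a \<otimes> s = act s a"
  "s \<in> S \<Longrightarrow> a \<in> carrier R \<Longrightarrow> b \<in> carrier R \<Longrightarrow> a \<otimes> act s b = act s (a \<otimes> b)"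
  "s \<in> S \<Longrightarrow> a \<in> carrier R \<Longrightarrow> b \<in> carrier R \<Longrightarrow> act s a \<otimes> b = act s (a \<otimes> b)"
  "s \<in> S \<Longrightarrow> t \<in> S \<Longrightarrow> a \<in> carrier R \<Longrightarrow> act s (act t a) = act t (act s a)"
  "s \<in> S \<Longrightarrow> t \<in> S \<Longrightarrow> act s t = act t s"
  "s \<in> S \<Longrightarrow> t \<in> S \<Longrightarrow> a \<in> carrier R \<Longrightarrow> act (act s t) a = act s (act t a)"
  "s \<in> S \<Longrightarrow> a \<in> carrier R \<Longrightarrow> b \<in> carrier R \<Longrightarrow> act s (a \<oplus> b) = act s a \<oplus> act s b"
  "s \<in> S \<Longrightarrow> act s \<zero> = \<zero>" "s \<in> S \<Longrightarrow> act s \<one> = s" "a \<in> carrier R \<Longrightarrow> act \<one> a = a"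
  by (simp_all add: act_def m_assoc r_distr) (rule denom_comm denom_lcomm; simp)+

lemma equiv_frac_rel: "equiv (carrier R \<times> S) (frac_rel R S)"
proof (rule equivI)
  show "frac_rel R S \<subseteq> (carrier R \<times> S) \<times> (carrier R \<times> S)"
    by (auto simp: frac_rel_def)
  show "refl_on (carrier R \<times> S) (frac_rel R S)"
    by (auto intro!: refl_onI frac_relI[of _ _ _ _ \<one>] denom_one)
  show "sym (frac_rel R S)"
    by (rule symI) (auto elim!: frac_relE intro: frac_relI)
  show "trans (frac_rel R S)"
  proof (rule transI, clarify)
    fix a s b t d v
    assume "((a, s), (b, t)) \<in> frac_rel R S" "((b, t), (d, v)) \<in> frac_rel R S"
    then obtain u w where c: "a \<in> carrier R" "b \<in> carrier R" "d \<in> carrier R" "s \<in> S" "t \<in> S" "v \<in> S" "u \<in> S" "w \<in> S"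
      and u: "u \<otimes> (a \<otimes> t) = u \<otimes> (b \<otimes> s)" and w: "w \<otimes> (b \<otimes> v) = w \<otimes> (d \<otimes> t)"
      by (metis frac_relE)
    \<comment> \<open>The middle denominator \<open>t\<close> cannot be cancelled, so it joins the
      two given witnesses in the new one.\<close>
    have "u \<otimes> w \<otimes> t \<otimes> (a \<otimes> v) = w \<otimes> v \<otimes> (u \<otimes> (a \<otimes> t))"
      using c by (simp add: act_simps m_assoc)
    also have "\<dots> = w \<otimes> v \<otimes> (u \<otimes> (b \<otimes> s))" by (simp only: u)
    also have "\<dots> = u \<otimes> s \<otimes> (w \<otimes> (b \<otimes> v))"
      using c by (simp add: act_simps m_assoc)
    also have "\<dots> = u \<otimes> s \<otimes> (w \<otimes> (d \<otimes> t))" by (simp only: w)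
    also have "\<dots> = u \<otimes> w \<otimes> t \<otimes> (d \<otimes> s)"
      using c by (simp add: act_simps m_assoc)
    finally show "((a, s), (d, v)) \<in> frac_rel R S"
      using c by (intro frac_relI[of _ _ _ _ "u \<otimes> w \<otimes> t"]) (auto intro: denom_mult)
  qed
qed

lemma frac_eqI:
  assumes "a \<in> carrier R" "b \<in> carrier R" "s \<in> S" "t \<in> S" "a \<otimes> t = b \<otimes> s"
  shows "fr a s = fr b t"
  unfolding frac_def using assms
  by (intro equiv_class_eq[OF equiv_frac_rel] frac_relI[of _ _ _ _ \<one>] denom_one) auto

lemma frac_closed [simp]: "a \<in> carrier R \<Longrightarrow> s \<in> S \<Longrightarrow> fr a s \<in> carrier L"
  by (auto simp: localization_def frac_def intro: quotientI)

lemma locE: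
  assumes "x \<in> carrier L"
  obtains a s where "a \<in> carrier R" "s \<in> S" "x = fr a s"
  using assms by (auto simp: localization_def frac_def elim!: quotientE)

lemma frac_self: "a \<in> carrier R \<Longrightarrow> s \<in> S \<Longrightarrow> (a, s) \<in> fr a s"
  unfolding frac_def by (rule equiv_class_self[OF equiv_frac_rel]) simp

lemma frac_memE:
  assumes "(b, t) \<in> fr a s"
  obtains u where "a \<in> carrier R" "b \<in> carrier R" "s \<in> S" "t \<in> S" "u \<in> S" "u \<otimes> (a \<otimes> t) = u \<otimes> (b \<otimes> s)"
  using assms unfolding frac_def by (auto elim: frac_relE)

lemma frac_eqI':
  assumes "a \<in> carrier R" "b \<in> carrier R" "s \<in> S" "t \<in> S" "u \<in> S" "u \<otimes> (a \<otimes> t) = u \<otimes> (b \<otimes> s)"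
  shows "fr a s = fr b t"
  unfolding frac_def using assms
  by (intro equiv_class_eq[OF equiv_frac_rel] frac_relI[of _ _ _ _ u]) auto

text \<open>The union defining the product collapses because all pairs of representatives give the
  same class and at least one pair exists. The witness for independence is the product of the
  witnesses of the two factors.\<close>

lemma frac_mult:
  assumes "a \<in> carrier R" "s \<in> S" "b \<in> carrier R" "t \<in> S"
  shows "fr a s \<otimes>\<^bsub>L\<^esub> fr b t = fr (a \<otimes> b) (s \<otimes> t)"
proof -
  have "fr (a' \<otimes> b') (s' \<otimes> t') = fr (a \<otimes> b) (s \<otimes> t)" if a': "(a', s') \<in> fr a s" and b': "(b', t') \<in> fr b t" for a' s' b' t'
  proof -
    obtain u where u: "a' \<in> carrier R" "s' \<in> S" "u \<in> S" "u \<otimes> (a \<otimes> s') = u \<otimes> (a' \<otimes> s)" using a' by (rule frac_memE)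
    obtain w where w: "b' \<in> carrier R" "t' \<in> S" "w \<in> S" "w \<otimes> (b \<otimes> t') = w \<otimes> (b' \<otimes> t)" using b' by (rule frac_memE)
    have "u \<otimes> w \<otimes> ((a \<otimes> b) \<otimes> (s' \<otimes> t')) = (u \<otimes> (a \<otimes> s')) \<otimes> (w \<otimes> (b \<otimes> t'))"
      using assms u(1-3) w(1-3) by (simp add: act_simps m_assoc)
    also have "\<dots> = (u \<otimes> (a' \<otimes> s)) \<otimes> (w \<otimes> (b' \<otimes> t))" by (simp only: u(4) w(4))
    also have "\<dots> = u \<otimes> w \<otimes> ((a' \<otimes> b') \<otimes> (s \<otimes> t))"
      using assms u(1-3) w(1-3) by (simp add: act_simps m_assoc)
    finally have "fr (a \<otimes> b) (s \<otimes> t) = fr (a' \<otimes> b') (s' \<otimes> t')"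
      using assms u w by (intro frac_eqI'[of _ _ _ _ "u \<otimes> w"] denom_mult) auto
    then show ?thesis by simp
  qed
  then have "(\<Union>(a', s')\<in>fr a s. \<Union>(b', t')\<in>fr b t. fr (a' \<otimes> b') (s' \<otimes> t')) = fr (a \<otimes> b) (s \<otimes> t)"
    using frac_self[OF assms(1,2)] frac_self[OF assms(3,4)] by fast
  then show ?thesis by (simp add: localization_def)
qed

lemma frac_add:
  assumes "a \<in> carrier R" "s \<in> S" "b \<in> carrier R" "t \<in> S"
  shows "fr a s \<oplus>\<^bsub>L\<^esub> fr b t = fr (a \<otimes> t \<oplus> b \<otimes> s) (s \<otimes> t)"
proof -
  have "fr (a' \<otimes> t' \<oplus> b' \<otimes> s') (s' \<otimes> t') = fr (a \<otimes> t \<oplus> b \<otimes> s) (s \<otimes> t)" if a': "(a', s') \<in> fr a s" and b': "(b', t') \<in> fr b t" for a' s' b' t'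
  proof -
    obtain u where u: "a' \<in> carrier R" "s' \<in> S" "u \<in> S" "u \<otimes> (a \<otimes> s') = u \<otimes> (a' \<otimes> s)" using a' by (rule frac_memE)
    obtain w where w: "b' \<in> carrier R" "t' \<in> S" "w \<in> S" "w \<otimes> (b \<otimes> t') = w \<otimes> (b' \<otimes> t)" using b' by (rule frac_memE)
    have "u \<otimes> w \<otimes> ((a \<otimes> t \<oplus> b \<otimes> s) \<otimes> (s' \<otimes> t')) = (u \<otimes> (a \<otimes> s')) \<otimes> (w \<otimes> (t \<otimes> t')) \<oplus> (u \<otimes> (s \<otimes> s')) \<otimes> (w \<otimes> (b \<otimes> t'))"
      using assms u(1-3) w(1-3) by (simp add: l_distr r_distr act_simps m_assoc)
    also have "\<dots> = (u \<otimes> (a' \<otimes> s)) \<otimes> (w \<otimes> (t \<otimes> t')) \<oplus> (u \<otimes> (s \<otimes> s')) \<otimes> (w \<otimes> (b' \<otimes> t))" by (simp only: u(4) w(4))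
    also have "\<dots> = u \<otimes> w \<otimes> ((a' \<otimes> t' \<oplus> b' \<otimes> s') \<otimes> (s \<otimes> t))"
      using assms u(1-3) w(1-3) by (simp add: l_distr r_distr act_simps m_assoc)
    finally have "fr (a \<otimes> t \<oplus> b \<otimes> s) (s \<otimes> t) = fr (a' \<otimes> t' \<oplus> b' \<otimes> s') (s' \<otimes> t')"
      using assms u w by (intro frac_eqI'[of _ _ _ _ "u \<otimes> w"] denom_mult) auto
    then show ?thesis by simp
  qed
  then have "(\<Union>(a', s')\<in>fr a s. \<Union>(b', t')\<in>fr b t. fr (a' \<otimes> t' \<oplus> b' \<otimes> s') (s' \<otimes> t')) = fr (a \<otimes> t \<oplus> b \<otimes> s) (s \<otimes> t)"
    using frac_self[OF assms(1,2)] frac_self[OF assms(3,4)] by fast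
  then show ?thesis by (simp add: localization_def)
qed

lemma L_one: "\<one>\<^bsub>L\<^esub> = fr \<one> \<one>" and L_zero: "\<zero>\<^bsub>L\<^esub> = fr \<zero> \<one>"
  by (simp_all add: localization_def)

lemmas frac_simps = frac_mult frac_add L_one L_zero denom_one denom_mult

lemma ring_localization: "ring L"
proof (rule ringI)
  show "abelian_group L"
  proof (rule abelian_groupI)
    fix x y assume "x \<in> carrier L" "y \<in> carrier L"
    then show "x \<oplus>\<^bsub>L\<^esub> y \<in> carrier L"
      by (elim locE) (simp add: frac_simps)
  next
    show "\<zero>\<^bsub>L\<^esub> \<in> carrier L" by (simp add: frac_simps)
  next
    fix x y z assume "x \<in> carrier L" "y \<in> carrier L" "z \<in> carrier L"
    then show "x \<oplus>\<^bsub>L\<^esub> y \<oplus>\<^bsub>L\<^esub> z = x \<oplus>\<^bsub>L\<^esub> (y \<oplus>\<^bsub>L\<^esub> z)"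
      by (elim locE) (simp add: frac_simps, rule frac_eqI, simp_all add: denom_mult l_distr r_distr act_simps m_assoc a_assoc)
  next
    fix x y assume "x \<in> carrier L" "y \<in> carrier L"
    then show "x \<oplus>\<^bsub>L\<^esub> y = y \<oplus>\<^bsub>L\<^esub> x"
      by (elim locE) (simp add: frac_simps, rule frac_eqI, simp_all add: denom_mult l_distr r_distr act_simps m_assoc a_comm)
  next
    fix x assume "x \<in> carrier L"
    then show "\<zero>\<^bsub>L\<^esub> \<oplus>\<^bsub>L\<^esub> x = x"
      by (elim locE) (simp add: frac_simps)
  next
    fix x assume "x \<in> carrier L"
    then obtain a s where x: "a \<in> carrier R" "s \<in> S" "x = fr a s" by (rule locE)
    then have "fr (\<ominus> a) s \<oplus>\<^bsub>L\<^esub> x = fr \<zero> (s \<otimes> s)"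
      by (simp add: frac_simps l_neg flip: l_distr)
    also have "\<dots> = \<zero>\<^bsub>L\<^esub>"
      unfolding L_zero using x by (intro frac_eqI) (auto simp: denom_mult denom_one)
    finally show "\<exists>y\<in>carrier L. y \<oplus>\<^bsub>L\<^esub> x = \<zero>\<^bsub>L\<^esub>"
      using x by (intro bexI[of _ "fr (\<ominus> a) s"]) auto
  qed
  show "monoid L"
  proof (rule monoidI)
    fix x y assume "x \<in> carrier L" "y \<in> carrier L"
    then show "x \<otimes>\<^bsub>L\<^esub> y \<in> carrier L"
      by (elim locE) (simp add: frac_simps)
  next
    show "\<one>\<^bsub>L\<^esub> \<in> carrier L" by (simp add: frac_simps)
  next
    fix x y z assume "x \<in> carrier L" "y \<in> carrier L" "z \<in> carrier L"
    then show "x \<otimes>\<^bsub>L\<^esub> y \<otimes>\<^bsub>L\<^esub> z = x \<otimes>\<^bsub>L\<^esub> (y \<otimes>\<^bsub>L\<^esub> z)"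
      by (elim locE) (simp add: frac_simps m_assoc)
  next
    fix x assume "x \<in> carrier L"
    then show "\<one>\<^bsub>L\<^esub> \<otimes>\<^bsub>L\<^esub> x = x" "x \<otimes>\<^bsub>L\<^esub> \<one>\<^bsub>L\<^esub> = x"
      by (elim locE; simp add: frac_simps)+
  qed
next
  fix x y z assume xyz: "x \<in> carrier L" "y \<in> carrier L" "z \<in> carrier L"
  then show "(x \<oplus>\<^bsub>L\<^esub> y) \<otimes>\<^bsub>L\<^esub> z = x \<otimes>\<^bsub>L\<^esub> z \<oplus>\<^bsub>L\<^esub> y \<otimes>\<^bsub>L\<^esub> z"
    by (elim locE) (simp add: frac_simps, rule frac_eqI, simp_all add: denom_mult l_distr r_distr act_simps m_assoc)
  from xyz show "z \<otimes>\<^bsub>L\<^esub> (x \<oplus>\<^bsub>L\<^esub> y) = z \<otimes>\<^bsub>L\<^esub> x \<oplus>\<^bsub>L\<^esub> z \<otimes>\<^bsub>L\<^esub> y"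
    by (elim locE) (simp add: frac_simps, rule frac_eqI, simp_all add: denom_mult l_distr r_distr act_simps m_assoc)
qed

lemma to_loc_hom: "(\<lambda>a. fr a \<one>) \<in> ring_hom R L"
  by (rule ring_hom_memI) (simp_all add: frac_simps)

text \<open>The inverse is \<open>b\<close> over the denominator \<open>a \<otimes> b\<close>. This
  makes a divisor of a denominator invertible even when the divisor itself is not central.\<close>

lemma to_loc_Unit:
  assumes "a \<in> carrier R" "b \<in> carrier R" "a \<otimes> b \<in> S" "b \<otimes> a = a \<otimes> b"
  shows "fr a \<one> \<in> Units L"
proof -
  have "fr (a \<otimes> b) (a \<otimes> b) = \<one>\<^bsub>L\<^esub>"
    unfolding L_one using assms by (intro frac_eqI denom_one) auto
  then have "fr b (a \<otimes> b) \<otimes>\<^bsub>L\<^esub> fr a \<one> = \<one>\<^bsub>L\<^esub>" "fr a \<one> \<otimes>\<^bsub>L\<^esub> fr b (a \<otimes> b) = \<one>\<^bsub>L\<^esub>"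
    using assms by (simp_all add: frac_mult denom_one)
  then show ?thesis using assms denom_one by (auto simp: Units_def intro!: bexI[of _ "fr b (a \<otimes> b)"])
qed

end

text \<open>The cross terms of the square amount to minus twice the square of
  \<open>inv D \<otimes> P\<close>, so that square remains with coefficient 1 - 2 = -1. Both orders
  of \<open>P\<close> and \<open>inv D\<close> agree because of \<open>DP\<close>.\<close>

lemma (in ring) intertwiner_square:
  assumes s: "s \<in> carrier R" and D: "D \<in> Units R" and P: "P \<in> carrier R"
    and ss: "s \<otimes> s = \<one>" and sP: "s \<otimes> P = P \<otimes> s" and DP: "D \<otimes> P = P \<otimes> D"
    and sD: "s \<otimes> D = \<ominus> (D \<otimes> s) \<ominus> (P \<oplus> P)"
  shows "(s \<oplus> inv D \<otimes> P) [^] (2::nat) = \<one> \<ominus> (P \<otimes> inv D) [^] (2::nat)"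
proof -
  define e where "e = inv D"
  have c: "D \<in> carrier R" "e \<in> carrier R" and eD: "e \<otimes> D = \<one>" "D \<otimes> e = \<one>"
    using D by (auto simp: e_def)
  note c = c s P
  have eP: "P \<otimes> e = e \<otimes> P"
  proof -
    have "P \<otimes> e = e \<otimes> (D \<otimes> P) \<otimes> e" using c eD by (simp flip: m_assoc)
    also have "\<dots> = e \<otimes> P \<otimes> (D \<otimes> e)" unfolding DP using c by (simp add: m_assoc)
    finally show ?thesis using c eD by simp
  qed
  have es: "e \<otimes> s = \<ominus> (s \<otimes> e) \<ominus> (e \<otimes> (P \<oplus> P) \<otimes> e)"
  proof -
    \<comment> \<open>The hypothesis \<open>sD\<close> is placed between two copies of the inverse
      of \<open>D\<close>.\<close>
    have "e \<otimes> s = e \<otimes> (s \<otimes> D) \<otimes> e" using c eD by (simp add: m_assoc)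
    also have "\<dots> = \<ominus> ((e \<otimes> D) \<otimes> s \<otimes> e) \<ominus> (e \<otimes> (P \<oplus> P) \<otimes> e)"
      unfolding sD using c by (simp add: minus_eq l_distr r_distr l_minus r_minus m_assoc)
    finally show ?thesis using c eD by simp
  qed
  have ePs: "e \<otimes> P \<otimes> s = \<ominus> (s \<otimes> (e \<otimes> P)) \<ominus> (e \<otimes> P \<otimes> (e \<otimes> P) \<oplus> e \<otimes> P \<otimes> (e \<otimes> P))"
  proof -
    have "e \<otimes> P \<otimes> s = (e \<otimes> s) \<otimes> P" using c by (simp add: m_assoc sP)
    also have "\<dots> = \<ominus> (s \<otimes> (e \<otimes> P)) \<ominus> (e \<otimes> P \<otimes> (e \<otimes> P) \<oplus> e \<otimes> P \<otimes> (e \<otimes> P))"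
      unfolding es using c by (simp add: minus_eq l_distr r_distr l_minus r_minus m_assoc)
    finally show ?thesis .
  qed
  define q where "q = e \<otimes> P"
  have q: "q \<in> carrier R" using c by (simp add: q_def)
  have "(s \<oplus> q) \<otimes> (s \<oplus> q) = \<one> \<oplus> s \<otimes> q \<oplus> (q \<otimes> s \<oplus> q \<otimes> q)"
    using c q ss by (simp add: l_distr r_distr a_ac)
  also have "\<dots> = \<one> \<ominus> q \<otimes> q"
  proof -
    have "q \<otimes> s = \<ominus> (s \<otimes> q) \<ominus> (q \<otimes> q \<oplus> q \<otimes> q)" using ePs by (simp add: q_def)
    then show ?thesis using c q m_closed[OF q q] m_closed[OF s q] by simp algebra
  qed
  finally show ?thesis
    using q c by (simp add: numeral_2_eq_2 eP flip: e_def q_def)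
qed

section \<open>The Cherednik algebra as a quotient of the free algebra\<close>

lemma free_scalar_add: "free_scalar (a + b) = free_scalar a + free_scalar b"
  by (simp add: free_scalar_def single_add)

lemma free_scalar_mult: "free_scalar (a * b) = free_scalar a * free_scalar b"
  by (simp add: free_scalar_def mult_single plus_list_def)

lemma free_scalar_0 [simp]: "free_scalar 0 = 0"
  by (simp add: free_scalar_def)

lemma free_scalar_1 [simp]: "free_scalar 1 = 1"
  by (simp add: free_scalar_def flip: zero_list_def)

lemma free_scalar_sum: "free_scalar (sum f A) = (\<Sum>a\<in>A. free_scalar (f a))"
  by (induction A rule: infinite_finite_induct) (auto simp: free_scalar_add)

lemma free_scalar_central: "p * free_scalar a = free_scalar a * p"
  by (induction p rule: poly_mapping_single_induct)
     (auto simp: free_scalar_def mult_single plus_list_def mult.commute distrib_left distrib_right)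

lemma free_scalar_left_commute: "p * (free_scalar a * q) = free_scalar a * (p * q)"
  by (metis free_scalar_central mult.assoc)

lemma free_gen_scalar_left_commute: "free_gen g * (free_scalar a * q) = free_scalar a * (free_gen g * q)"
  by (rule free_scalar_left_commute)

lemma in_free_algebra: "p \<in> carrier (free_algebra S) \<longleftrightarrow> Poly_Mapping.keys p \<subseteq> lists S"
  by (simp add: free_algebra_def)

lemma free_algebra_simps [simp]:
  "mult (free_algebra S) = (*)" "one (free_algebra S) = 1"
  "zero (free_algebra S) = 0" "add (free_algebra S) = (+)"
  by (simp_all add: free_algebra_def)

lemma free_algebra_gen [intro]: "g \<in> S \<Longrightarrow> free_gen g \<in> carrier (free_algebra S)"
  by (simp add: in_free_algebra free_gen_def)

lemma free_algebra_scalar [intro]: "free_scalar a \<in> carrier (free_algebra S)"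
  by (simp add: in_free_algebra free_scalar_def)

lemma free_algebra_0 [intro]: "0 \<in> carrier (free_algebra S)"
  by (simp add: in_free_algebra)

lemma free_algebra_1 [intro]: "1 \<in> carrier (free_algebra S)"
  by (simp add: in_free_algebra zero_list_def)

lemma free_algebra_add [intro]:
  "p \<in> carrier (free_algebra S) \<Longrightarrow> q \<in> carrier (free_algebra S) \<Longrightarrow> p + q \<in> carrier (free_algebra S)"
  using keys_add[of p q] by (auto simp: in_free_algebra)

lemma free_algebra_uminus [intro]: "p \<in> carrier (free_algebra S) \<Longrightarrow> - p \<in> carrier (free_algebra S)"
  by (auto simp: in_free_algebra in_keys_iff subset_iff)

lemma free_algebra_diff [intro]:
  "p \<in> carrier (free_algebra S) \<Longrightarrow> q \<in> carrier (free_algebra S) \<Longrightarrow> p - q \<in> carrier (free_algebra S)"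
  using free_algebra_add[of p S "- q"] by auto

lemma free_algebra_mult [intro]:
  assumes "p \<in> carrier (free_algebra S)" "q \<in> carrier (free_algebra S)"
  shows "p * q \<in> carrier (free_algebra S)"
  using keys_mult[of p q] assms by (fastforce simp: in_free_algebra plus_list_def)

lemma free_algebra_sum [intro]:
  "(\<And>a. a \<in> A \<Longrightarrow> f a \<in> carrier (free_algebra S)) \<Longrightarrow> sum f A \<in> carrier (free_algebra S)"
  by (induction A rule: infinite_finite_induct) auto

lemma ring_free_algebra: "ring (free_algebra S)"
proof (rule ringI)
  show "abelian_group (free_algebra S)"
  proof (rule abelian_groupI)
    fix p assume "p \<in> carrier (free_algebra S)"
    then show "\<exists>q\<in>carrier (free_algebra S). q \<oplus>\<^bsub>free_algebra S\<^esub> p = \<zero>\<^bsub>free_algebra S\<^esub>"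
      by (intro bexI[of _ "- p"]) auto
  qed (auto simp: algebra_simps)
  show "monoid (free_algebra S)"
    by (rule monoidI) (auto simp: algebra_simps)
qed (auto simp: algebra_simps)

definition restrict_words :: "'g set \<Rightarrow> 'g free_alg \<Rightarrow> 'g free_alg" where
  "restrict_words S p = Poly_Mapping.mapp (\<lambda>w a. a when w \<in> lists S) p"

lemma lookup_restrict_words: "Poly_Mapping.lookup (restrict_words S p) w = (Poly_Mapping.lookup p w when w \<in> lists S)"
  by (auto simp: restrict_words_def lookup_mapp when_def in_keys_iff)

lemma restrict_words_closed [simp]: "restrict_words S p \<in> carrier (free_algebra S)"
  by (auto simp: in_free_algebra in_keys_iff lookup_restrict_words when_def split: if_splits)

lemma restrict_words_id: "p \<in> carrier (free_algebra S) \<Longrightarrow> restrict_words S p = p"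
  by (rule poly_mapping_eqI) (auto simp: lookup_restrict_words when_def in_free_algebra in_keys_iff subset_iff)

lemma restrict_words_add: "restrict_words S (p + q) = restrict_words S p + restrict_words S q"
  by (rule poly_mapping_eqI) (auto simp: lookup_restrict_words lookup_add when_def)

lemma restrict_words_single:
  "restrict_words S (Poly_Mapping.single w a) = (if w \<in> lists S then Poly_Mapping.single w a else 0)"
  by (rule poly_mapping_eqI) (auto simp: lookup_restrict_words lookup_single when_def)

lemma restrict_words_0: "restrict_words S 0 = 0"
  by (rule restrict_words_id) auto

text \<open>A concatenation uses only letters of \<open>S\<close> exactly when both of its parts do,
  so discarding all other words respects products.\<close>

lemma restrict_words_mult: "restrict_words S (p * q) = restrict_words S p * restrict_words S q"
proof (induction p rule: poly_mapping_single_induct)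
  case (2 v a)
  show ?case
    by (induction q rule: poly_mapping_single_induct)
       (auto simp: mult_single restrict_words_single restrict_words_0 restrict_words_add plus_list_def distrib_left)
qed (auto simp: restrict_words_0 restrict_words_add distrib_right)


section \<open>The quotient map and the defining relations on representatives\<close>

locale cherednik_params =
  fixes r n :: nat and \<kappa> :: complex and c :: "nat \<Rightarrow> complex"
  assumes r: "r \<ge> 1"
begin

abbreviation H :: "gen free_alg set ring" where "H \<equiv> cherednik r n \<kappa> c"
abbreviation FH :: "gen free_alg ring" where "FH \<equiv> free_algebra (cherednik_gens r n)"

lemma gen_closed [intro]:
  "i \<in> {1..n} \<Longrightarrow> free_gen (X i) \<in> carrier FH"
  "i \<in> {1..n} \<Longrightarrow> free_gen (Y i) \<in> carrier FH"
  "w \<in> carrier (Grn r n) \<Longrightarrow> free_gen (T w) \<in> carrier FH"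
  by (auto simp: cherednik_gens_def)

lemma zeta_pow_in_Grn [intro]: "zeta_pow r n i l \<in> carrier (Grn r n)"
  unfolding zeta_pow_mono_mat[OF r]
  by (intro mono_mat_in_Grn permutes_id r) (auto simp: zeta_powi_root[OF r])

lemma Grn_closed [intro]: "v \<in> carrier (Grn r n) \<Longrightarrow> w \<in> carrier (Grn r n) \<Longrightarrow> v * w \<in> carrier (Grn r n)"
  using monoid.m_closed[OF group.is_monoid[OF group_Grn[OF r]]] by simp

lemma refl_mat_in_Grn [intro]: "i \<in> {1..n} \<Longrightarrow> j \<in> {1..n} \<Longrightarrow> refl_mat r n i j l \<in> carrier (Grn r n)"
  unfolding refl_mat_def by (intro Grn_closed zeta_pow_in_Grn transp_mat_in_Grn r)

lemma cherednik_rels_closed: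
  assumes "(p, q) \<in> cherednik_rels r n \<kappa> c"
  shows "p \<in> carrier FH" "q \<in> carrier FH"
proof -
  have "p \<in> carrier FH \<and> q \<in> carrier FH"
    using assms one_in_Grn[OF r, of n] unfolding cherednik_rels_def Let_def
    by safe (intro free_algebra_mult free_algebra_add free_algebra_diff free_algebra_sum
        free_algebra_scalar free_algebra_1 gen_closed zeta_pow_in_Grn refl_mat_in_Grn Grn_closed; simp)+
  then show "p \<in> carrier FH" "q \<in> carrier FH" by auto
qed

lemma ideal_cherednik: "ideal (cherednik_ideal r n \<kappa> c) FH"
  unfolding cherednik_ideal_def
  using cherednik_rels_closed by (intro ring.genideal_ideal ring_free_algebra) blast

lemma ring_H: "ring H"
  unfolding cherednik_def by (rule ideal.quotient_is_ring[OF ideal_cherednik])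

sublocale H: ring H by (rule ring_H)

text \<open>Words in other letters are sent to zero. This makes the class map a ring homomorphism on the
  whole type, so that no membership conditions arise in computations.\<close>

definition cl :: "gen free_alg \<Rightarrow> gen free_alg set" where
  "cl p = cherednik_class r n \<kappa> c (restrict_words (cherednik_gens r n) p)"

lemma class_hom: "cherednik_class r n \<kappa> c \<in> ring_hom FH H"
  using ideal.rcos_ring_hom[OF ideal_cherednik]
  by (simp add: cherednik_def cherednik_class_def [abs_def])

lemma cl_closed [simp]: "cl p \<in> carrier H"
  using ring_hom_closed[OF class_hom] by (simp add: cl_def)

lemma cl_mult: "cl (p * q) = cl p \<otimes>\<^bsub>H\<^esub> cl q"
  using ring_hom_mult[OF class_hom] by (simp add: cl_def restrict_words_mult)

lemma cl_add: "cl (p + q) = cl p \<oplus>\<^bsub>H\<^esub> cl q"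
  using ring_hom_add[OF class_hom] by (simp add: cl_def restrict_words_add)

lemma cl_1 [simp]: "cl 1 = \<one>\<^bsub>H\<^esub>"
  using ring_hom_one[OF class_hom] by (simp add: cl_def restrict_words_id[OF free_algebra_1])

lemma cl_0 [simp]: "cl 0 = \<zero>\<^bsub>H\<^esub>"
  using ring_hom_zero[OF class_hom ring_free_algebra ring_H] by (simp add: cl_def restrict_words_0)

lemma cl_uminus: "cl (- p) = \<ominus>\<^bsub>H\<^esub> cl p"
  by (rule H.minus_equality[symmetric]) (simp_all flip: cl_add)

lemma cl_diff: "cl (p - q) = cl p \<ominus>\<^bsub>H\<^esub> cl q"
  using cl_add[of p "- q"] by (simp add: cl_uminus a_minus_def)

lemma cl_sum: "cl (sum f A) = (\<Oplus>\<^bsub>H\<^esub>a\<in>A. cl (f a))" if "finite A"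
  using that by induction (auto simp: cl_add H.finsum_insert Pi_def)

text \<open>The gateway for the defining relations: each of them becomes an equality of
  \<open>cl\<close> values here.\<close>

lemma cl_rel:
  assumes "(p, q) \<in> cherednik_rels r n \<kappa> c"
  shows "cl p = cl q"
proof -
  have pq: "p \<in> carrier FH" "q \<in> carrier FH" using cherednik_rels_closed[OF assms] by auto
  interpret I: ideal "cherednik_ideal r n \<kappa> c" FH by (rule ideal_cherednik)
  have "p - q \<in> cherednik_ideal r n \<kappa> c"
    unfolding cherednik_ideal_def
    by (rule subsetD[OF ring.genideal_self[OF ring_free_algebra]])
       (use assms cherednik_rels_closed in blast)+
  then have "cl (p - q) = \<zero>\<^bsub>H\<^esub>"
    using pq abelian_group.a_coset_join2[OF ring.is_abelian_group[OF ring_free_algebra] _ I.a_subgroup]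
    by (simp add: cl_def restrict_words_id free_algebra_diff cherednik_class_def cherednik_def FactRing_def)
  then show ?thesis by (simp add: cl_diff H.r_right_minus_eq)
qed

lemma cl_cong_mult: "cl p = cl p' \<Longrightarrow> cl q = cl q' \<Longrightarrow> cl (p * q) = cl (p' * q')"
  by (simp add: cl_mult)

lemma cl_cong_sum: "finite A \<Longrightarrow> (\<And>a. a \<in> A \<Longrightarrow> cl (f a) = cl (g a)) \<Longrightarrow> cl (sum f A) = cl (sum g A)"
  by (induction A rule: finite_induct) (auto simp: cl_add)

lemma hx_eq: "i \<in> {1..n} \<Longrightarrow> hx r n \<kappa> c i = cl (free_gen (X i))"
  by (simp add: hx_def cl_def restrict_words_id gen_closed)

lemma hy_eq: "i \<in> {1..n} \<Longrightarrow> hy r n \<kappa> c i = cl (free_gen (Y i))"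
  by (simp add: hy_def cl_def restrict_words_id gen_closed)

lemma ht_eq: "w \<in> carrier (Grn r n) \<Longrightarrow> ht r n \<kappa> c w = cl (free_gen (T w))"
  by (simp add: ht_def cl_def restrict_words_id gen_closed)

lemma hscalar_eq: "hscalar r n \<kappa> c a = cl (free_scalar a)"
  by (simp add: hscalar_def cl_def restrict_words_id free_algebra_scalar)

abbreviation xF :: "nat \<Rightarrow> gen free_alg" where "xF i \<equiv> free_gen (X i)"
abbreviation yF :: "nat \<Rightarrow> gen free_alg" where "yF i \<equiv> free_gen (Y i)"
abbreviation sF :: "complex \<Rightarrow> gen free_alg" where "sF a \<equiv> free_scalar a"
abbreviation tF :: "(nat \<Rightarrow> nat) \<Rightarrow> (nat \<Rightarrow> complex) \<Rightarrow> gen free_alg"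
  where "tF \<sigma> a \<equiv> free_gen (T (mono_mat n \<sigma> a))"

lemma cl_x_commute: "i \<in> {1..n} \<Longrightarrow> j \<in> {1..n} \<Longrightarrow> cl (xF i * xF j) = cl (xF j * xF i)"
  by (rule cl_rel) (unfold cherednik_rels_def Let_def, blast)

lemma cl_y_commute: "i \<in> {1..n} \<Longrightarrow> j \<in> {1..n} \<Longrightarrow> cl (yF i * yF j) = cl (yF j * yF i)"
  by (rule cl_rel) (unfold cherednik_rels_def Let_def, blast)

lemma cl_t_one: "cl (tF id (\<lambda>_. 1)) = \<one>\<^bsub>H\<^esub>"
  unfolding mono_mat_one cl_1[symmetric] by (rule cl_rel) (unfold cherednik_rels_def Let_def, blast)

lemma cl_t_mult:
  assumes \<sigma>: "\<sigma> permutes {1..n}" and a: "\<forall>k\<in>{1..n}. a k ^ r = 1"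
    and \<tau>: "\<tau> permutes {1..n}" and b: "\<forall>k\<in>{1..n}. b k ^ r = 1"
  shows "cl (tF \<sigma> a * tF \<tau> b) = cl (tF (\<sigma> \<circ> \<tau>) (\<lambda>k. a (\<tau> k) * b k))"
proof -
  have "mono_mat n \<sigma> a \<in> carrier (Grn r n)" by (rule mono_mat_in_Grn[OF \<sigma> bspec[OF a] r])
  moreover have "mono_mat n \<tau> b \<in> carrier (Grn r n)" by (rule mono_mat_in_Grn[OF \<tau> bspec[OF b] r])
  ultimately have "cl (tF \<sigma> a * tF \<tau> b) = cl (free_gen (T (mono_mat n \<sigma> a * mono_mat n \<tau> b)))"
    by (intro cl_rel) (unfold cherednik_rels_def Let_def, blast)
  then show ?thesis by (simp add: mono_mat_mult[OF \<tau>])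
qed

text \<open>The relations with group elements range over whole vectors; at a multiple of a basis
  vector the coordinate sum collapses to one generator.\<close>

lemma sum_unit_vec:
  assumes "k \<in> {1..n}"
  shows "(\<Sum>i\<in>{1..n}. sF ((b \<cdot>\<^sub>v unit_vec n (k - 1)) $ (i - 1)) * f i) = sF b * f k"
proof -
  have "(\<Sum>i\<in>{1..n}. sF ((b \<cdot>\<^sub>v unit_vec n (k - 1)) $ (i - 1)) * f i)
      = (\<Sum>i\<in>{1..n}. if i = k then sF b * f k else 0)"
    using assms by (intro sum.cong) auto
  then show ?thesis using assms by simp
qed

lemma cl_t_x:
  assumes \<sigma>: "\<sigma> permutes {1..n}" and a: "\<forall>k\<in>{1..n}. a k ^ r = 1" and j: "j \<in> {1..n}"
  shows "cl (tF \<sigma> a * xF j) = cl (sF (1 / a j) * xF (\<sigma> j) * tF \<sigma> a)"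
proof -
  have w: "mono_mat n \<sigma> a \<in> carrier (Grn r n)" by (rule mono_mat_in_Grn[OF \<sigma> bspec[OF a] r])
  let ?xvec = "\<lambda>v. \<Sum>i\<in>{1..n}. sF (v $ (i - 1)) * xF i"
  have "cl (tF \<sigma> a * ?xvec (unit_vec n (j - 1))) =
      cl (?xvec (dual_act r n (mono_mat n \<sigma> a) (unit_vec n (j - 1))) * tF \<sigma> a)"
    using w unit_vec_carrier[of n "j - 1"]
    by (intro cl_rel) (unfold cherednik_rels_def Let_def, blast)
  moreover have "?xvec (unit_vec n (j - 1)) = xF j"
    using sum_unit_vec[OF j, of 1 xF] by simp
  moreover have "\<sigma> j \<in> {1..n}" using j permutes_in_image[OF \<sigma>] by blast
  moreover have "dual_act r n (mono_mat n \<sigma> a) (unit_vec n (j - 1)) = (1 / a j) \<cdot>\<^sub>v unit_vec n (\<sigma> j - 1)"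
    by (rule dual_act_unit_vec[OF r \<sigma> bspec[OF a] j])
  ultimately show ?thesis
    by (simp only: sum_unit_vec)
qed

lemma cl_t_y:
  assumes \<sigma>: "\<sigma> permutes {1..n}" and a: "\<forall>k\<in>{1..n}. a k ^ r = 1" and j: "j \<in> {1..n}"
  shows "cl (tF \<sigma> a * yF j) = cl (sF (a j) * yF (\<sigma> j) * tF \<sigma> a)"
proof -
  have w: "mono_mat n \<sigma> a \<in> carrier (Grn r n)" by (rule mono_mat_in_Grn[OF \<sigma> bspec[OF a] r])
  let ?yvec = "\<lambda>v. \<Sum>i\<in>{1..n}. sF (v $ (i - 1)) * yF i"
  have "cl (tF \<sigma> a * ?yvec (unit_vec n (j - 1))) =
      cl (?yvec (mono_mat n \<sigma> a *\<^sub>v unit_vec n (j - 1)) * tF \<sigma> a)"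
    using w unit_vec_carrier[of n "j - 1"]
    by (intro cl_rel) (unfold cherednik_rels_def Let_def, blast)
  moreover have "?yvec (unit_vec n (j - 1)) = yF j"
    using sum_unit_vec[OF j, of 1 yF] by simp
  moreover have "\<sigma> j \<in> {1..n}" using j permutes_in_image[OF \<sigma>] by blast
  ultimately show ?thesis
    unfolding mono_mat_unit_vec[OF \<sigma> j] by (simp only: sum_unit_vec)
qed

abbreviation roots :: "complex set" where "roots \<equiv> {u. u ^ r = 1}"

lemma finite_roots [simp]: "finite roots"
  using finite_roots[OF r] .

definition swapF :: "nat \<Rightarrow> nat \<Rightarrow> complex \<Rightarrow> gen free_alg" where
  "swapF i j u = tF (transpose i j) (\<lambda>k. if k = i then 1 / u else if k = j then u else 1)"

text \<open>The sum of the r reflections that exchange the i-th and j-th coordinate lines, the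
  building block of both z_i and the relation for y_i x_i.\<close>

definition RF :: "nat \<Rightarrow> nat \<Rightarrow> gen free_alg" where
  "RF i j = (\<Sum>u\<in>roots. swapF i j u)"

lemma cl_y_x_neq:
  assumes "i \<in> {1..n}" "j \<in> {1..n}" "i \<noteq> j"
  shows "cl (yF i * xF j) = cl (xF j * yF i + sF (c 0) * (\<Sum>u\<in>roots. sF (1 / u) * swapF i j u))"
proof -
  have "cl (yF i * xF j) = cl (xF j * yF i + sF (c 0) *
      (\<Sum>l<r. sF (zeta r powi (- int l)) * free_gen (T (refl_mat r n i j l))))"
    using assms by (intro cl_rel) (unfold cherednik_rels_def Let_def, blast)
  also have "(\<Sum>l<r. sF (zeta r powi (- int l)) * free_gen (T (refl_mat r n i j l))) =
      (\<Sum>l<r. sF (1 / zeta r ^ l) * swapF i j (zeta r ^ l))"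
    using assms by (intro sum.cong)
      (auto simp: refl_mat_eq[OF r] root_refl_def swapF_def power_int_minus inverse_eq_divide)
  finally show ?thesis unfolding sum_zeta_roots[OF r, of "\<lambda>u. sF (1 / u) * swapF i j u"] .
qed

lemma sum_refl_mat:
  assumes "i \<in> {1..n}" "j \<in> {1..n}" "i \<noteq> j"
  shows "(\<Sum>l<r. free_gen (T (refl_mat r n i j l))) = RF i j"
proof -
  have "(\<Sum>l<r. free_gen (T (refl_mat r n i j l))) = (\<Sum>l<r. swapF i j (zeta r ^ l))"
    using assms by (intro sum.cong) (auto simp: refl_mat_eq[OF r] root_refl_def swapF_def)
  then show ?thesis unfolding sum_zeta_roots[OF r] by (simp add: RF_def)
qed

definition diagF :: "nat \<Rightarrow> complex \<Rightarrow> gen free_alg" where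
  "diagF i u = tF id (\<lambda>k. if k = i then u else 1)"

lemma cl_y_x_eq:
  assumes "i \<in> {1..n}"
  shows "cl (yF i * xF i) = cl (xF i * yF i + sF \<kappa>
           - (\<Sum>l\<in>{1..<r}. sF (c l * (1 - zeta r powi (- int l))) * diagF i (zeta r ^ l))
           - sF (c 0) * (\<Sum>j\<in>{1..n} - {i}. RF i j))"
proof -
  have "cl (yF i * xF i) = cl (xF i * yF i + sF \<kappa>
           - (\<Sum>l\<in>{1..<r}. sF (c l * (1 - zeta r powi (- int l))) * free_gen (T (zeta_pow r n i (int l))))
           - sF (c 0) * (\<Sum>j\<in>{1..n} - {i}. \<Sum>l<r. free_gen (T (refl_mat r n i j l))))"
    using assms by (intro cl_rel) (unfold cherednik_rels_def Let_def, blast)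
  also have "(\<Sum>j\<in>{1..n} - {i}. \<Sum>l<r. free_gen (T (refl_mat r n i j l))) = (\<Sum>j\<in>{1..n} - {i}. RF i j)"
    using assms by (intro sum.cong sum_refl_mat) auto
  finally show ?thesis by (simp add: zeta_pow_mono_mat[OF r] diagF_def cong: if_cong)
qed

definition zF :: "nat \<Rightarrow> gen free_alg" where
  "zF i = yF i * xF i + sF (c 0) * (\<Sum>j\<in>{1..<i}. RF i j)"

lemma z_elt_eq:
  assumes "i \<in> {1..n}"
  shows "z_elt r n \<kappa> c i = cl (zF i)"
proof -
  have "(\<Oplus>\<^bsub>H\<^esub>j\<in>{1..<i}. \<Oplus>\<^bsub>H\<^esub>l\<in>{..<r}. ht r n \<kappa> c (refl_mat r n i j l)) =
      (\<Oplus>\<^bsub>H\<^esub>j\<in>{1..<i}. cl (\<Sum>l<r. free_gen (T (refl_mat r n i j l))))"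
    using assms by (intro H.finsum_cong') (auto simp: cl_sum ht_eq refl_mat_in_Grn intro!: H.finsum_cong')
  also have "\<dots> = (\<Oplus>\<^bsub>H\<^esub>j\<in>{1..<i}. cl (RF i j))"
    using assms by (intro H.finsum_cong') (auto simp: sum_refl_mat)
  finally show ?thesis
    using assms by (simp add: z_elt_def zF_def cl_add cl_mult cl_sum hx_eq hy_eq hscalar_eq)
qed

definition piF :: "nat \<Rightarrow> gen free_alg" where
  "piF i = (\<Sum>u\<in>roots. tF id (\<lambda>k. if k = i then u else if k = Suc i then 1 / u else 1))"

lemma pi_elt_eq: "pi_elt r n \<kappa> c i = cl (piF i)"
proof -
  have "zeta_pow r n i (int l) * zeta_pow r n (i + 1) (- int l) =
     mono_mat n id (\<lambda>k. if k = i then zeta r ^ l else if k = Suc i then 1 / zeta r ^ l else 1)" for l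
    unfolding zeta_pow_mono_mat[OF r] mono_mat_mult[OF permutes_id]
    by (intro mono_mat_cong) (auto simp: power_int_minus inverse_eq_divide)
  moreover have "zeta_pow r n i (int l) * zeta_pow r n (i + 1) (- int l) \<in> carrier (Grn r n)" for l
    by auto
  ultimately have "pi_elt r n \<kappa> c i = cl (\<Sum>l<r. tF id (\<lambda>k. if k = i then zeta r ^ l else if k = Suc i then 1 / zeta r ^ l else 1))"
    by (simp add: pi_elt_def cl_sum ht_eq)
  then show ?thesis unfolding sum_zeta_roots[OF r, of "\<lambda>u. tF id (\<lambda>k. if k = i then u else if k = Suc i then 1 / u else 1)"]
    by (simp add: piF_def)
qed

end

section \<open>Commutation relations and part (b)\<close>

context cherednik_params
begin

section \<open>Moving group elements past reflections and past the z_i\<close>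

lemma permutes_mem: "\<sigma> permutes {1..n} \<Longrightarrow> k \<in> {1..n} \<Longrightarrow> \<sigma> k \<in> {1..n}"
  by (simp only: permutes_in_image)

lemma cl_cong_mid: "cl q = cl q' \<Longrightarrow> cl (p * q * s) = cl (p * q' * s)"
  by (simp add: cl_mult)

lemma cl_cong_add: "cl p = cl p' \<Longrightarrow> cl q = cl q' \<Longrightarrow> cl (p + q) = cl (p' + q')"
  by (simp add: cl_add)

lemma swap_root: "u \<in> roots \<Longrightarrow> \<forall>k\<in>A. (if k = i then 1 / u else if k = j then u else 1) ^ r = 1"
  by (simp add: power_divide)

lemma diag_root: "u \<in> roots \<Longrightarrow> \<forall>k\<in>A. (if k = i then u else if k = j then 1 / u else 1) ^ r = 1"
  by (simp add: power_divide)

text \<open>Conjugation in the group, written without inverses. Comparing coefficients of the two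
  monomial matrices at i, at j and elsewhere forces the factor \<open>a i / a j\<close> on the
  root.\<close>

lemma cl_t_swap:
  assumes \<sigma>: "\<sigma> permutes {1..n}" and a: "\<forall>k\<in>{1..n}. a k ^ r = 1"
    and i: "i \<in> {1..n}" and j: "j \<in> {1..n}" and ij: "i \<noteq> j" and u: "u \<in> roots"
  shows "cl (tF \<sigma> a * swapF i j u) = cl (swapF (\<sigma> i) (\<sigma> j) (a i / a j * u) * tF \<sigma> a)"
proof -
  have inj: "\<sigma> x = \<sigma> y \<longleftrightarrow> x = y" for x y using permutes_inj[OF \<sigma>] by (auto simp: inj_def)
  have "u ^ r = 1" using u by blast
  note nz = root_nonzero[OF r bspec[OF a i]] root_nonzero[OF r bspec[OF a j]] root_nonzero[OF r this]
  have u': "a i / a j * u \<in> roots"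
    using u bspec[OF a i] bspec[OF a j] by (simp add: power_divide power_mult_distrib)
  have tr: "transpose (\<sigma> i) (\<sigma> j) (\<sigma> k) = \<sigma> (transpose i j k)" for k
    by (simp add: transpose_def inj)
  have "cl (tF \<sigma> a * swapF i j u) = cl (tF (\<sigma> \<circ> transpose i j)
      (\<lambda>k. a (transpose i j k) * (if k = i then 1 / u else if k = j then u else 1)))"
    unfolding swapF_def by (rule cl_t_mult[OF \<sigma> a permutes_swap_id[OF i j] swap_root[OF u]])
  moreover have "cl (swapF (\<sigma> i) (\<sigma> j) (a i / a j * u) * tF \<sigma> a) = cl (tF (transpose (\<sigma> i) (\<sigma> j) \<circ> \<sigma>)
      (\<lambda>k. (if \<sigma> k = \<sigma> i then 1 / (a i / a j * u) else if \<sigma> k = \<sigma> j then a i / a j * u else 1) * a k))"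
    unfolding swapF_def
    by (rule cl_t_mult[OF permutes_swap_id[OF permutes_mem[OF \<sigma> i] permutes_mem[OF \<sigma> j]] swap_root[OF u'] \<sigma> a])
  moreover have "mono_mat n (\<sigma> \<circ> transpose i j)
      (\<lambda>k. a (transpose i j k) * (if k = i then 1 / u else if k = j then u else 1)) =
     mono_mat n (transpose (\<sigma> i) (\<sigma> j) \<circ> \<sigma>) (\<lambda>k. (if \<sigma> k = \<sigma> i then 1 / (a i / a j * u)
       else if \<sigma> k = \<sigma> j then a i / a j * u else 1) * a k)"
  proof (intro mono_mat_cong)
    fix k
    consider "k = i" | "k = j" "k \<noteq> i" | "k \<noteq> i" "k \<noteq> j" by blast
    then show "a (transpose i j k) * (if k = i then 1 / u else if k = j then u else 1) =
        (if \<sigma> k = \<sigma> i then 1 / (a i / a j * u) else if \<sigma> k = \<sigma> j then a i / a j * u else 1) * a k"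
      using nz by cases (simp_all add: inj)
  qed (simp only: o_apply tr)
  ultimately show ?thesis by (simp only:)
qed

text \<open>The rescaled root runs through the same set of roots, so only the permutation part of
  the group element has an effect.\<close>

lemma cl_t_RF:
  assumes \<sigma>: "\<sigma> permutes {1..n}" and a: "\<forall>k\<in>{1..n}. a k ^ r = 1"
    and i: "i \<in> {1..n}" and j: "j \<in> {1..n}" and ij: "i \<noteq> j"
  shows "cl (tF \<sigma> a * RF i j) = cl (RF (\<sigma> i) (\<sigma> j) * tF \<sigma> a)"
proof -
  have v: "(a i / a j) ^ r = 1" using bspec[OF a i] bspec[OF a j] by (simp add: power_divide)
  have "cl (tF \<sigma> a * RF i j) = cl (\<Sum>u\<in>roots. swapF (\<sigma> i) (\<sigma> j) (a i / a j * u) * tF \<sigma> a)"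
    unfolding RF_def sum_distrib_left
    by (intro cl_cong_sum finite_roots cl_t_swap \<sigma> a i j ij)
  also have "\<dots> = cl (RF (\<sigma> i) (\<sigma> j) * tF \<sigma> a)"
    using sum_roots_mult[OF r v, of "\<lambda>u. swapF (\<sigma> i) (\<sigma> j) u * tF \<sigma> a"]
    by (simp add: RF_def sum_distrib_right)
  finally show ?thesis .
qed

text \<open>Interchanging the two indices inverts the root, and inversion permutes the
  roots.\<close>

lemma RF_sym: "i \<noteq> j \<Longrightarrow> RF i j = RF j i"
proof -
  assume "i \<noteq> j"
  then have "swapF i j u = swapF j i (1 / u)" for u
    unfolding swapF_def transpose_commute[of i j]
    by (intro arg_cong[where f = "\<lambda>a. tF (transpose j i) a"]) auto
  then show ?thesis
    using sum_roots_inverse[of "swapF j i" r] by (simp add: RF_def)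
qed

text \<open>The scalar picked up by y_j is the inverse of the one picked up by x_j.\<close>

lemma cl_t_yx:
  assumes \<sigma>: "\<sigma> permutes {1..n}" and a: "\<forall>k\<in>{1..n}. a k ^ r = 1" and j: "j \<in> {1..n}"
  shows "cl (tF \<sigma> a * (yF j * xF j)) = cl (yF (\<sigma> j) * xF (\<sigma> j) * tF \<sigma> a)"
proof -
  have "cl (tF \<sigma> a * (yF j * xF j)) = cl (1 * (tF \<sigma> a * yF j) * xF j)"
    by (simp add: mult.assoc)
  also have "\<dots> = cl (1 * (sF (a j) * yF (\<sigma> j) * tF \<sigma> a) * xF j)"
    by (rule cl_cong_mid[OF cl_t_y[OF \<sigma> a j]])
  also have "\<dots> = cl (sF (a j) * yF (\<sigma> j) * (tF \<sigma> a * xF j) * 1)"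
    by (simp add: mult.assoc)
  also have "\<dots> = cl (sF (a j) * yF (\<sigma> j) * (sF (1 / a j) * xF (\<sigma> j) * tF \<sigma> a) * 1)"
    by (rule cl_cong_mid[OF cl_t_x[OF \<sigma> a j]])
  also have "sF (a j) * yF (\<sigma> j) * (sF (1 / a j) * xF (\<sigma> j) * tF \<sigma> a) * 1
      = sF (a j) * sF (1 / a j) * (yF (\<sigma> j) * xF (\<sigma> j) * tF \<sigma> a)"
    by (simp add: mult.assoc free_gen_scalar_left_commute)
  also have "sF (a j) * sF (1 / a j) = 1"
    using root_nonzero[OF r bspec[OF a j]] by (simp flip: free_scalar_mult)
  finally show ?thesis by simp
qed

text \<open>The result need not be the z-element with index \<open>\<sigma> i\<close>: the
  permutation may move the range j < i, and this is the origin of every correction term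
  below.\<close>

lemma cl_t_z:
  assumes \<sigma>: "\<sigma> permutes {1..n}" and a: "\<forall>k\<in>{1..n}. a k ^ r = 1" and i: "i \<in> {1..n}"
  shows "cl (tF \<sigma> a * zF i) =
    cl ((yF (\<sigma> i) * xF (\<sigma> i) + sF (c 0) * (\<Sum>j\<in>{1..<i}. RF (\<sigma> i) (\<sigma> j))) * tF \<sigma> a)"
proof -
  have "cl (tF \<sigma> a * zF i) = cl (tF \<sigma> a * (yF i * xF i) + sF (c 0) * (\<Sum>j\<in>{1..<i}. tF \<sigma> a * RF i j))"
    by (simp only: zF_def distrib_left free_gen_scalar_left_commute sum_distrib_left)
  also have "\<dots> = cl (yF (\<sigma> i) * xF (\<sigma> i) * tF \<sigma> a + sF (c 0) * (\<Sum>j\<in>{1..<i}. RF (\<sigma> i) (\<sigma> j) * tF \<sigma> a))"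
    using i by (intro cl_cong_add[OF cl_t_yx[OF \<sigma> a i] cl_cong_mult[OF refl cl_cong_sum]] cl_t_RF[OF \<sigma> a]) auto
  also have "\<dots> = cl (
     (yF (\<sigma> i) * xF (\<sigma> i) + sF (c 0) * (\<Sum>j\<in>{1..<i}. RF (\<sigma> i) (\<sigma> j))) * tF \<sigma> a)"
    by (simp only: distrib_right sum_distrib_right mult.assoc)
  finally show ?thesis .
qed

lemma cl_diag_z:
  assumes a: "\<forall>k\<in>{1..n}. a k ^ r = 1" and i: "i \<in> {1..n}"
  shows "cl (tF id a * zF i) = cl (zF i * tF id a)"
proof -
  have "cl (tF id a * zF i) =
    cl ((yF (id i) * xF (id i) + sF (c 0) * (\<Sum>j\<in>{1..<i}. RF (id i) (id j))) * tF id a)"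
    by (rule cl_t_z[OF permutes_id a i])
  then show ?thesis by (simp add: zF_def)
qed

lemma cl_pi_z:
  assumes "j \<in> {1..n}"
  shows "cl (piF i * zF j) = cl (zF j * piF i)"
  unfolding piF_def sum_distrib_left sum_distrib_right
  by (intro cl_cong_sum finite_roots cl_diag_z assms diag_root)

abbreviation stF :: "nat \<Rightarrow> gen free_alg" where "stF i \<equiv> tF (transpose i (Suc i)) (\<lambda>_. 1)"

lemma stF_permutes: "1 \<le> i \<Longrightarrow> i < n \<Longrightarrow> transpose i (Suc i) permutes {1..n}"
  by (intro permutes_swap_id) auto

text \<open>No correction arises: for k + 1 < i the transposition permutes the range of the sum in
  z_i, and for k > i it fixes that range pointwise.\<close>

lemma cl_s_z_other:
  assumes k: "1 \<le> k" "k < n" and i: "i \<in> {1..n}" and "i \<noteq> k" "i \<noteq> Suc k"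
  shows "cl (stF k * zF i) = cl (zF i * stF k)"
proof -
  let ?\<sigma> = "transpose k (Suc k)"
  have "?\<sigma> i = i" using assms by (auto simp: transpose_def)
  moreover have "(\<Sum>j\<in>{1..<i}. RF i (?\<sigma> j)) = (\<Sum>j\<in>{1..<i}. RF i j)"
  proof (cases "k < i")
    case True
    then have "?\<sigma> permutes {1..<i}" using assms by (intro permutes_swap_id) auto
    then show ?thesis by (intro sum.reindex_bij_betw permutes_imp_bij)
  next
    case False
    then show ?thesis using assms by (intro sum.cong) (auto simp: transpose_def)
  qed
  ultimately show ?thesis
    using cl_t_z[OF stF_permutes[OF k] _ i, of "\<lambda>_. 1"] by (simp add: zF_def)
qed

text \<open>A reflection exchanging i and i + 1, multiplied by s_i, is diagonal with mutually
  inverse entries at these places.\<close>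

lemma cl_RF_s:
  assumes i: "1 \<le> i" "i < n"
  shows "cl (RF (Suc i) i * stF i) = cl (piF i)"
proof -
  have "cl (RF (Suc i) i * stF i) =
      cl (\<Sum>u\<in>roots. tF id (\<lambda>k. if k = i then 1 / u else if k = Suc i then 1 / (1 / u) else 1))"
    unfolding RF_def sum_distrib_right
  proof (intro cl_cong_sum finite_roots)
    fix u assume u: "u \<in> roots"
    have "cl (swapF (Suc i) i u * stF i) = cl (tF (transpose (Suc i) i \<circ> transpose i (Suc i))
        (\<lambda>k. (if transpose i (Suc i) k = Suc i then 1 / u else if transpose i (Suc i) k = i then u else 1) * 1))"
      unfolding swapF_def
      by (rule cl_t_mult[OF permutes_swap_id swap_root[OF u] stF_permutes[OF i]]) (use i in simp_all)
    also have "tF (transpose (Suc i) i \<circ> transpose i (Suc i))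
        (\<lambda>k. (if transpose i (Suc i) k = Suc i then 1 / u else if transpose i (Suc i) k = i then u else 1) * 1)
       = tF id (\<lambda>k. if k = i then 1 / u else if k = Suc i then 1 / (1 / u) else 1)"
      by (intro arg_cong[where f = "\<lambda>w. free_gen (T w)"] mono_mat_cong) (auto simp: transpose_def)
    finally show "cl (swapF (Suc i) i u * stF i) = cl (tF id (\<lambda>k. if k = i then 1 / u else if k = Suc i then 1 / (1 / u) else 1))" .
  qed
  also have "(\<Sum>u\<in>roots. tF id (\<lambda>k. if k = i then 1 / u else if k = Suc i then 1 / (1 / u) else 1)) = piF i"
    unfolding piF_def
    by (rule sum_roots_inverse[of "\<lambda>u. tF id (\<lambda>k. if k = i then u else if k = Suc i then 1 / u else 1)"])
  finally show ?thesis .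
qed

text \<open>Passing s_i exchanges the entries u and 1 / u, which only reorders the sum.\<close>

lemma cl_s_pi:
  assumes i: "1 \<le> i" "i < n"
  shows "cl (stF i * piF i) = cl (piF i * stF i)"
proof -
  let ?d = "\<lambda>u k. if k = i then u else if k = Suc i then 1 / u else (1::complex)"
  have *: "cl (stF i * tF id (?d u)) = cl (tF id (?d (1 / u)) * stF i)" if u: "u \<in> roots" for u
  proof -
    have "cl (stF i * tF id (?d u)) = cl (tF (transpose i (Suc i) \<circ> id) (\<lambda>k. 1 * ?d u k))"
      by (rule cl_t_mult[OF stF_permutes[OF i] _ permutes_id diag_root[OF u]]) simp
    moreover have "cl (tF id (?d (1 / u)) * stF i) = cl (tF (id \<circ> transpose i (Suc i)) (\<lambda>k. ?d (1 / u) (transpose i (Suc i) k) * 1))"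
      using u by (intro cl_t_mult stF_permutes i permutes_id diag_root) (simp_all add: power_divide)
    moreover have "mono_mat n (transpose i (Suc i) \<circ> id) (\<lambda>k. 1 * ?d u k) =
        mono_mat n (id \<circ> transpose i (Suc i)) (\<lambda>k. ?d (1 / u) (transpose i (Suc i) k) * 1)"
      by (intro mono_mat_cong) (auto simp: transpose_def)
    ultimately show ?thesis by (simp only:)
  qed
  have "cl (stF i * piF i) = cl (\<Sum>u\<in>roots. tF id (?d (1 / u)) * stF i)"
    unfolding piF_def sum_distrib_left by (intro cl_cong_sum finite_roots *)
  also have "(\<Sum>u\<in>roots. tF id (?d (1 / u)) * stF i) = piF i * stF i"
    unfolding piF_def sum_distrib_right
    by (rule sum_roots_inverse[of "\<lambda>u. tF id (?d u) * stF i"])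
  finally show ?thesis .
qed

lemma cl_s_s:
  assumes i: "1 \<le> i" "i < n"
  shows "cl (stF i * stF i) = \<one>\<^bsub>H\<^esub>"
proof -
  have "cl (stF i * stF i) = cl (tF (transpose i (Suc i) \<circ> transpose i (Suc i)) (\<lambda>k. 1 * 1))"
    by (intro cl_t_mult stF_permutes i) auto
  then show ?thesis using cl_t_one by simp
qed

text \<open>After the exchange of i and i + 1 the sum over j < i lacks the term j = i of z_(i+1);
  that missing term times s_i is \<pi>_i by \<open>cl_RF_s\<close>.\<close>

lemma cl_s_z:
  assumes i: "1 \<le> i" "i < n"
  shows "cl (stF i * zF i) = cl (zF (Suc i) * stF i - sF (c 0) * piF i)"
proof -
  let ?\<sigma> = "transpose i (Suc i)"
  have "cl (stF i * zF i) = cl ((yF (?\<sigma> i) * xF (?\<sigma> i) + sF (c 0) * (\<Sum>j\<in>{1..<i}. RF (?\<sigma> i) (?\<sigma> j))) * stF i)"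
    using i by (intro cl_t_z stF_permutes) auto
  also have "\<dots> = cl (zF (Suc i) * stF i - sF (c 0) * (RF (Suc i) i * stF i))"
  proof -
    have "(\<Sum>j\<in>{1..<i}. RF (?\<sigma> i) (?\<sigma> j)) = (\<Sum>j\<in>{1..<i}. RF (Suc i) j)"
      by (intro sum.cong) (auto simp: transpose_def)
    moreover have "{1..<Suc i} = insert i {1..<i}" using i by auto
    ultimately show ?thesis by (simp add: zF_def algebra_simps)
  qed
  also have "\<dots> = cl (zF (Suc i) * stF i - sF (c 0) * piF i)"
    by (simp add: cl_diff cl_mult cl_RF_s[OF i, unfolded cl_mult])
  finally show ?thesis .
qed

section \<open>Pairwise commutativity of the z_i\<close>

lemma cl_Q_x:
  assumes i: "i \<in> {1..n}" and j: "j \<in> {1..n}" and "i \<noteq> j"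
  shows "cl ((\<Sum>u\<in>roots. sF (1 / u) * swapF i j u) * xF i) = cl (xF j * RF i j)"
  unfolding RF_def sum_distrib_left sum_distrib_right
proof (intro cl_cong_sum finite_roots)
  fix u assume u: "u \<in> roots"
  have "u ^ r = 1" using u by blast
  then have nz: "u \<noteq> 0" by (rule root_nonzero[OF r])
  \<comment> \<open>Passing the reflection turns x_i into u x_j, and this factor u cancels the
    weight 1 / u from the relation for y_i x_j.\<close>
  have "cl (swapF i j u * xF i) = cl (sF (1 / (1 / u)) * xF (transpose i j i) * swapF i j u)"
    unfolding swapF_def using cl_t_x[OF permutes_swap_id[OF i j] swap_root[OF u] i] by simp
  then have "cl (sF (1 / u) * (swapF i j u * xF i)) = cl (sF (1 / u) * (sF (1 / (1 / u)) * xF (transpose i j i) * swapF i j u))"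
    by (rule cl_cong_mult[OF refl])
  also have "\<dots> = cl ((sF (1 / u) * sF u) * (xF j * swapF i j u))"
    by (simp add: mult.assoc)
  also have "\<dots> = cl (xF j * swapF i j u)"
    using nz by (simp flip: free_scalar_mult)
  finally show "cl (sF (1 / u) * swapF i j u * xF i) = cl (xF j * swapF i j u)"
    by (simp add: mult.assoc)
qed

lemma cl_RF_yx:
  assumes i: "i \<in> {1..n}" and j: "j \<in> {1..n}" and "i \<noteq> j"
  shows "cl (RF i j * (yF i * xF i)) = cl (yF j * xF j * RF i j)"
  unfolding RF_def sum_distrib_left sum_distrib_right
proof (intro cl_cong_sum finite_roots)
  fix u assume u: "u \<in> roots"
  show "cl (swapF i j u * (yF i * xF i)) = cl (yF j * xF j * swapF i j u)"
    unfolding swapF_def using cl_t_yx[OF permutes_swap_id[OF i j] swap_root[OF u] i] by simp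
qed

text \<open>By \<open>cl_Q_x\<close> the reflection term supplies exactly what is missing to replace
  x_i y_j by y_j x_i. The point is that the right-hand side is symmetric in i and j modulo the
  relations, because the x commute and the y commute.\<close>

lemma cl_yxyx:
  assumes i: "i \<in> {1..n}" and j: "j \<in> {1..n}" and ij: "i \<noteq> j"
  shows "cl (yF i * xF i * (yF j * xF j) + sF (c 0) * (yF i * xF i * RF i j)) = cl (yF i * yF j * xF i * xF j)"
proof -
  let ?Q = "\<Sum>u\<in>roots. sF (1 / u) * swapF j i u"
  have "cl (yF i * xF i * (yF j * xF j) + sF (c 0) * (yF i * xF i * RF i j)) =
      cl (yF i * xF i * (yF j * xF j) + sF (c 0) * yF i * (xF i * RF j i))"
    using RF_sym[OF ij] by (simp add: mult.assoc)
  also have "\<dots> = cl (yF i * xF i * (yF j * xF j) + sF (c 0) * yF i * (?Q * xF j))"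
    by (rule cl_cong_add[OF refl cl_cong_mult[OF refl cl_Q_x[OF j i ij[symmetric], symmetric]]])
  also have "\<dots> = cl (yF i * (xF i * yF j + sF (c 0) * ?Q) * xF j)"
    by (simp add: algebra_simps free_gen_scalar_left_commute)
  also have "\<dots> = cl (yF i * (yF j * xF i) * xF j)"
    by (rule cl_cong_mid[OF cl_y_x_neq[OF j i ij[symmetric], symmetric]])
  finally show ?thesis by (simp add: mult.assoc)
qed

text \<open>Both products are instances of \<open>cl_yxyx\<close>, one with the indices (1, 2) and
  one with (2, 1).\<close>

lemma cl_z1_z2:
  assumes "2 \<le> n"
  shows "cl (zF 1 * zF 2) = cl (zF 2 * zF 1)"
proof -
  have m: "1 \<in> {1..n}" "2 \<in> {1..n}" using assms by auto
  have R21: "RF 2 1 = RF 1 2" by (rule RF_sym) simp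
  have z: "zF 1 = yF 1 * xF 1" "zF 2 = yF 2 * xF 2 + sF (c 0) * RF 1 2"
    using RF_sym[of 1 2] by (simp_all add: zF_def numeral_2_eq_2)
  have "cl (zF 1 * zF 2) = cl (yF 1 * xF 1 * (yF 2 * xF 2) + sF (c 0) * (yF 1 * xF 1 * RF 1 2))"
    by (simp add: z algebra_simps free_gen_scalar_left_commute del: One_nat_def)
  also have "\<dots> = cl (yF 1 * yF 2 * xF 1 * xF 2)"
    by (rule cl_yxyx) (use m in auto)
  also have "\<dots> = cl (yF 1 * yF 2 * (xF 2 * xF 1))"
    unfolding mult.assoc[of _ "xF 1"] by (rule cl_cong_mult[OF refl cl_x_commute[OF m]])
  also have "\<dots> = cl (yF 2 * yF 1 * (xF 2 * xF 1))"
    by (rule cl_cong_mult[OF cl_y_commute[OF m] refl])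
  also have "\<dots> = cl (yF 2 * xF 2 * (yF 1 * xF 1) + sF (c 0) * (yF 2 * xF 2 * RF 2 1))"
    using cl_yxyx[OF m(2,1)] by (simp add: mult.assoc)
  \<comment> \<open>In z_2 z_1 the reflection sum stands on the left; carrying it across y_1 x_1
    turns that factor into y_2 x_2.\<close>
  also have "\<dots> = cl (yF 2 * xF 2 * (yF 1 * xF 1) + sF (c 0) * (RF 1 2 * (yF 1 * xF 1)))"
    unfolding R21 by (rule cl_cong_add[OF refl cl_cong_mult[OF refl cl_RF_yx[OF m, symmetric]]]) simp
  also have "\<dots> = cl (zF 2 * zF 1)"
    by (simp add: z algebra_simps del: One_nat_def)
  finally show ?thesis .
qed

lemma cl_z_Suc:
  assumes i: "1 \<le> i" "i < n"
  shows "cl (zF (Suc i)) = cl (stF i * zF i * stF i + sF (c 0) * piF i * stF i)"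
proof -
  have "cl (zF (Suc i)) = cl (zF (Suc i) * (stF i * stF i))"
    using cl_s_s[OF i] by (simp add: cl_mult)
  also have "\<dots> = cl ((zF (Suc i) * stF i - sF (c 0) * piF i) * stF i + sF (c 0) * piF i * stF i)"
    by (simp add: algebra_simps)
  also have "\<dots> = cl (stF i * zF i * stF i + sF (c 0) * piF i * stF i)"
    by (rule cl_cong_add[OF cl_cong_mult[OF cl_s_z[OF i, symmetric] refl] refl])
  finally show ?thesis .
qed

text \<open>By \<open>cl_z_Suc\<close> the element z_(i+1) is an expression in z_i, s_i, \<pi>_i and
  scalars.\<close>

lemma cl_commute_z_Suc:
  assumes i: "1 \<le> i" "i < n" and p: "cl (p * zF i) = cl (zF i * p)"
    "cl (p * stF i) = cl (stF i * p)" "cl (p * piF i) = cl (piF i * p)"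
  shows "cl (p * zF (Suc i)) = cl (zF (Suc i) * p)"
proof -
  have comm: "\<And>q s. cl (p * q) = cl (q * p) \<Longrightarrow> cl (p * s) = cl (s * p) \<Longrightarrow> cl (p * (q * s)) = cl (q * s * p)"
    by (metis cl_mult cl_cong_mult mult.assoc)
  have sc: "cl (p * sF (c 0)) = cl (sF (c 0) * p)" by (simp add: free_scalar_central)
  have "cl (p * (stF i * zF i * stF i)) = cl (stF i * zF i * stF i * p)"
    "cl (p * (sF (c 0) * piF i * stF i)) = cl (sF (c 0) * piF i * stF i * p)"
    by (intro comm p sc)+
  then have "cl (p * (stF i * zF i * stF i + sF (c 0) * piF i * stF i)) = cl ((stF i * zF i * stF i + sF (c 0) * piF i * stF i) * p)"
    unfolding distrib_left distrib_right by (intro cl_cong_add)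
  then show ?thesis by (simp add: cl_mult flip: cl_z_Suc[OF i])
qed

text \<open>The larger index is raised from 2 while the smaller one is 1, then the smaller one is
  raised below a fixed \<open>j\<close>. In either step the simple transposition involved commutes
  with the z whose index stays, by \<open>cl_s_z_other\<close>.\<close>

lemma cl_z_z_less:
  assumes "1 \<le> i" "i < j" "j \<le> n"
  shows "cl (zF i * zF j) = cl (zF j * zF i)"
  using assms(1) assms(2,3)
proof (induction i arbitrary: j rule: dec_induct)
  case base
  from base(1) have "Suc 1 \<le> j" by simp
  then show ?case using base(2)
  proof (induction j rule: dec_induct)
    case base
    then show ?case using cl_z1_z2 by (simp add: numeral_2_eq_2)
  next
    case (step j)
    then show ?case
      using cl_s_z_other[of j 1] cl_pi_z[of 1 j] by (intro cl_commute_z_Suc) auto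
  qed
next
  case (step i)
  have "cl (zF j * zF (Suc i)) = cl (zF (Suc i) * zF j)"
    using step cl_s_z_other[of i j] cl_pi_z[of j i] step.IH[of j]
    by (intro cl_commute_z_Suc) auto
  then show ?case by simp
qed

lemma cl_z_z:
  assumes "i \<in> {1..n}" "j \<in> {1..n}"
  shows "cl (zF i * zF j) = cl (zF j * zF i)"
proof -
  consider "i < j" | "i = j" | "j < i" by linarith
  then show ?thesis
    using assms cl_z_z_less[of i j] cl_z_z_less[of j i] by cases auto
qed

section \<open>The two products of \<Phi> and \<Psi>\<close>

lemma Phi_Psi:
  assumes n: "n \<ge> 1"
  defines "w \<equiv> swap_prod [1..<n]" and "v \<equiv> swap_prod (rev [1..<n])"
  shows "Phi_elt r n \<kappa> c = cl (xF n * tF v (\<lambda>_. 1))" "Psi_elt r n \<kappa> c = cl (yF 1 * tF w (\<lambda>_. 1))"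
  and "cl (yF 1 * tF w (\<lambda>_. 1) * (xF n * tF v (\<lambda>_. 1))) = cl (yF 1 * xF 1)"
  and "cl (xF n * tF v (\<lambda>_. 1) * (yF 1 * tF w (\<lambda>_. 1))) = cl (xF n * yF n)"
proof -
  have w: "w permutes {1..n}" and v: "v permutes {1..n}"
    unfolding w_def v_def by (intro swap_prod_permutes; auto)+
  have wv: "w \<circ> v = id" "v \<circ> w = id"
    unfolding w_def v_def by (rule swap_prod_rev' swap_prod_rev)+
  have wn: "w n = 1" unfolding w_def by (rule swap_prod_upt[OF n])
  then have v1: "v 1 = n" using wv(2) by (metis comp_apply id_apply)
  have G: "mono_mat n w (\<lambda>_. 1) \<in> carrier (Grn r n)" "mono_mat n v (\<lambda>_. 1) \<in> carrier (Grn r n)"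
    by (intro mono_mat_in_Grn w v r; simp)+
  have "mat_prod_list n (map (simple_refl n) [1..<n]) = mono_mat n w (\<lambda>_. 1)"
    "mat_prod_list n (map (simple_refl n) (rev [1..<n])) = mono_mat n v (\<lambda>_. 1)"
    unfolding w_def v_def by (intro mat_prod_list_swaps; auto)+
  then show "Phi_elt r n \<kappa> c = cl (xF n * tF v (\<lambda>_. 1))" "Psi_elt r n \<kappa> c = cl (yF 1 * tF w (\<lambda>_. 1))"
    using n G by (simp_all add: Phi_elt_def Psi_elt_def hx_eq hy_eq ht_eq cl_mult)
  have one: "cl (tF w (\<lambda>_. 1) * tF v (\<lambda>_. 1)) = \<one>\<^bsub>H\<^esub>" "cl (tF v (\<lambda>_. 1) * tF w (\<lambda>_. 1)) = \<one>\<^bsub>H\<^esub>"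
    using cl_t_mult[OF w _ v, of "\<lambda>_. 1" "\<lambda>_. 1"] cl_t_mult[OF v _ w, of "\<lambda>_. 1" "\<lambda>_. 1"] wv cl_t_one by simp_all
  have "cl (yF 1 * (tF w (\<lambda>_. 1) * xF n) * tF v (\<lambda>_. 1)) = cl (yF 1 * (xF 1 * tF w (\<lambda>_. 1)) * tF v (\<lambda>_. 1))"
    using cl_t_x[OF w, of "\<lambda>_. 1" n] n wn by (intro cl_cong_mid) simp
  then show "cl (yF 1 * tF w (\<lambda>_. 1) * (xF n * tF v (\<lambda>_. 1))) = cl (yF 1 * xF 1)"
    using one(1) by (simp add: mult.assoc cl_mult)
  have "cl (xF n * (tF v (\<lambda>_. 1) * yF 1) * tF w (\<lambda>_. 1)) = cl (xF n * (yF n * tF v (\<lambda>_. 1)) * tF w (\<lambda>_. 1))"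
    using cl_t_y[OF v, of "\<lambda>_. 1" 1] n v1 by (intro cl_cong_mid) simp
  then show "cl (xF n * tF v (\<lambda>_. 1) * (yF 1 * tF w (\<lambda>_. 1))) = cl (xF n * yF n)"
    using one(2) by (simp add: mult.assoc cl_mult)
qed

text \<open>After the two sums are interchanged, each diagonal group element carries the coefficient
  computed in \<open>d_coeff_fourier\<close>. The outcome is the diagonal part of the relation for
  y_i x_i.\<close>

lemma sum_epsilon:
  assumes i: "i \<in> {1..n}"
  shows "(\<Oplus>\<^bsub>H\<^esub>j\<in>{..<r}. hscalar r n \<kappa> c (d_coeff r c (int j) - d_coeff r c (int j - 1)) \<otimes>\<^bsub>H\<^esub> epsilon_elt r n \<kappa> c i (int j))
    = cl (\<Sum>l\<in>{1..<r}. sF (c l * (1 - zeta r powi (- int l))) * diagF i (zeta r ^ l))"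
proof -
  let ?d = "\<lambda>j. d_coeff r c (int j) - d_coeff r c (int j - 1)"
  let ?e = "\<lambda>j. sF (1 / of_nat r) * (\<Sum>m<r. sF (zeta r powi (- (int m * int j))) * diagF i (zeta r ^ m))"
  have ht: "ht r n \<kappa> c (zeta_pow r n i (int m)) = cl (diagF i (zeta r ^ m))" for m
    using zeta_pow_in_Grn[of i "int m"] by (simp add: ht_eq) (simp add: zeta_pow_mono_mat[OF r] diagF_def cong: if_cong)
  have eps: "epsilon_elt r n \<kappa> c i (int j) = cl (?e j)" for j
    by (simp add: epsilon_elt_def hscalar_eq ht cl_mult cl_sum)
  have sm: "(\<Oplus>\<^bsub>H\<^esub>j\<in>{..<r}. hscalar r n \<kappa> c (?d j) \<otimes>\<^bsub>H\<^esub> epsilon_elt r n \<kappa> c i (int j)) = cl (\<Sum>j<r. sF (?d j) * ?e j)"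
    by (simp add: eps hscalar_eq cl_sum) (simp add: cl_mult)
  have "(\<Sum>j<r. sF (?d j) * ?e j) =
      (\<Sum>j<r. \<Sum>m<r. sF (?d j * (1 / of_nat r) * zeta r powi (- (int m * int j))) * diagF i (zeta r ^ m))"
    by (simp only: sum_distrib_left free_scalar_mult mult.assoc)
  also have "\<dots> = (\<Sum>m<r. sF (\<Sum>j<r. ?d j * (1 / of_nat r) * zeta r powi (- (int m * int j))) * diagF i (zeta r ^ m))"
    by (subst sum.swap) (simp only: free_scalar_sum sum_distrib_right)
  also have "\<dots> = (\<Sum>m<r. sF (if m = 0 then 0 else c m * (1 - zeta r powi (- int m))) * diagF i (zeta r ^ m))"
    using r by (intro sum.cong refl) (simp only: d_coeff_fourier lessThan_iff)
  \<comment> \<open>The identity matrix, m = 0, has coefficient 0, which leaves the range used in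
    the defining relation.\<close>
  also have "\<dots> = (\<Sum>m\<in>{1..<r}. sF (c m * (1 - zeta r powi (- int m))) * diagF i (zeta r ^ m))"
    by (rule sum.mono_neutral_cong_right) auto
  finally have "(\<Sum>j<r. sF (?d j) * ?e j) = (\<Sum>m\<in>{1..<r}. sF (c m * (1 - zeta r powi (- int m))) * diagF i (zeta r ^ m))" .
  then show ?thesis by (simp only: sm)
qed

lemma Psi_Phi_eq: "n \<ge> 1 \<Longrightarrow> Psi_elt r n \<kappa> c \<otimes>\<^bsub>H\<^esub> Phi_elt r n \<kappa> c = z_elt r n \<kappa> c 1"
  using Phi_Psi(3) by (simp add: Phi_Psi(1,2) z_elt_eq zF_def flip: cl_mult)

lemma Phi_Psi_eq:
  assumes n: "n \<ge> 1"
  shows "Phi_elt r n \<kappa> c \<otimes>\<^bsub>H\<^esub> Psi_elt r n \<kappa> c = (z_elt r n \<kappa> c n \<ominus>\<^bsub>H\<^esub> hscalar r n \<kappa> c \<kappa>) \<oplus>\<^bsub>H\<^esub>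
    (\<Oplus>\<^bsub>H\<^esub>j\<in>{..<r}. hscalar r n \<kappa> c (d_coeff r c (int j) - d_coeff r c (int j - 1)) \<otimes>\<^bsub>H\<^esub> epsilon_elt r n \<kappa> c n (int j))"
proof -
  let ?S = "\<Sum>l\<in>{1..<r}. sF (c l * (1 - zeta r powi (- int l))) * diagF n (zeta r ^ l)"
  let ?R = "sF (c 0) * (\<Sum>j\<in>{1..<n}. RF n j)"
  have nn: "n \<in> {1..n}" using n by auto
  \<comment> \<open>For the last index the condition j < n covers every j other than n, so the sum
    in z_n cancels the whole sum of transposition-type reflections in the relation for y_n
    x_n.\<close>
  have "{1..n} - {n} = {1..<n}" by auto
  then have yx: "cl (yF n * xF n) = cl (xF n * yF n + sF \<kappa> - ?S - ?R)"
    using cl_y_x_eq[OF nn] by simp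
  have "cl (xF n * yF n) = cl ((xF n * yF n + sF \<kappa> - ?S - ?R) + (?R - sF \<kappa> + ?S))"
    by simp
  also have "\<dots> = cl (yF n * xF n + (?R - sF \<kappa> + ?S))"
    by (intro cl_cong_add yx[symmetric] refl)
  also have "\<dots> = cl (zF n - sF \<kappa> + ?S)"
    by (simp add: zF_def algebra_simps)
  finally have "cl (xF n * yF n) = cl (zF n - sF \<kappa> + ?S)" .
  then show ?thesis
    unfolding Phi_Psi(1,2)[OF n] cl_mult[symmetric] Phi_Psi(4)[OF n] sum_epsilon[OF nn]
    by (simp add: z_elt_eq[OF nn] hscalar_eq cl_add cl_diff)
qed

end

section \<open>Polynomials in the \<open>z\<^sub>i\<close>\<close>

context cherednik_params
begin

section \<open>Evaluation of polynomials at the commuting elements z_i\<close>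

definition commutes :: "gen free_alg \<Rightarrow> gen free_alg \<Rightarrow> bool" where
  "commutes p q \<longleftrightarrow> cl (p * q) = cl (q * p)"

lemma commutes_sym: "commutes p q \<Longrightarrow> commutes q p"
  by (simp add: commutes_def)

lemma commutes_scalar [simp]: "commutes p (sF a)" "commutes p 1" "commutes p 0"
  by (simp_all add: commutes_def free_scalar_central)

lemma commutes_mult:
  assumes "commutes p q" "commutes p s"
  shows "commutes p (q * s)"
proof -
  have "cl (p * (q * s)) = cl (p * q * s)" by (simp add: mult.assoc)
  also have "\<dots> = cl (q * p * s)" using assms(1) by (simp add: commutes_def cl_mult)
  also have "\<dots> = cl (q * (p * s))" by (simp add: mult.assoc)
  also have "\<dots> = cl (q * (s * p))" using assms(2) by (intro cl_cong_mult[OF refl]) (simp add: commutes_def)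
  finally show ?thesis by (simp add: commutes_def mult.assoc)
qed

lemma commutes_add: "commutes p q \<Longrightarrow> commutes p s \<Longrightarrow> commutes p (q + s)"
  by (simp add: commutes_def distrib_left distrib_right cl_add)

lemma commutes_sum: "(\<And>a. a \<in> A \<Longrightarrow> commutes p (f a)) \<Longrightarrow> commutes p (sum f A)"
  by (induction A rule: infinite_finite_induct) (auto intro: commutes_add)

lemma commutes_power: "commutes p q \<Longrightarrow> commutes p (q ^ k)"
  by (induction k) (auto intro: commutes_mult)

text \<open>The list of indices is a parameter so that statements about monomials can be proved by
  induction on it.\<close>

definition zmonF :: "nat list \<Rightarrow> (nat \<Rightarrow>\<^sub>0 nat) \<Rightarrow> gen free_alg" where
  "zmonF ks m = foldr (\<lambda>k u. zF k ^ Poly_Mapping.lookup m k * u) ks 1"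

lemma zmonF_simps [simp]: "zmonF [] m = 1" "zmonF (k # ks) m = zF k ^ Poly_Mapping.lookup m k * zmonF ks m"
  by (simp_all add: zmonF_def)

text \<open>A chosen representative of \<open>z_eval\<close>. It is additive already in the free
  algebra, but multiplicative only modulo the ideal, where the z_i commute.\<close>

definition evF :: "mpoly \<Rightarrow> gen free_alg" where
  "evF p = (\<Sum>m\<in>Poly_Mapping.keys p. sF (Poly_Mapping.lookup p m) * zmonF [1..<Suc n] m)"

lemma cl_power: "cl (p ^ k) = cl p [^]\<^bsub>H\<^esub> k"
  by (induction k) (simp_all add: cl_mult power_Suc2 del: power_Suc)

lemma z_eval_eq: "z_eval r n \<kappa> c p = cl (evF p)"
proof -
  have "foldr (\<lambda>k u. (z_elt r n \<kappa> c k [^]\<^bsub>H\<^esub> Poly_Mapping.lookup m k) \<otimes>\<^bsub>H\<^esub> u) ks \<one>\<^bsub>H\<^esub> = cl (zmonF ks m)"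
    if "set ks \<subseteq> {1..n}" for ks m
    using that by (induction ks) (simp_all add: z_elt_eq cl_mult cl_power)
  moreover have "set [1..<Suc n] \<subseteq> {1..n}" by auto
  ultimately have "foldr (\<lambda>k u. (z_elt r n \<kappa> c k [^]\<^bsub>H\<^esub> Poly_Mapping.lookup m k) \<otimes>\<^bsub>H\<^esub> u) [1..<Suc n] \<one>\<^bsub>H\<^esub>
      = cl (zmonF [1..<Suc n] m)" for m
    by blast
  then show ?thesis by (simp only: z_eval_def evF_def cl_sum[OF finite_keys] hscalar_eq cl_mult)
qed

lemma evF_add: "evF (p + q) = evF p + evF q"
  unfolding evF_def
  by (rule setsum_keys_plus_distrib) (simp_all add: free_scalar_add distrib_right)

lemma evF_single: "evF (Poly_Mapping.single m v) = sF v * zmonF [1..<Suc n] m"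
  by (cases "v = 0") (simp_all add: evF_def)

lemma evF_0 [simp]: "evF 0 = 0"
  by (simp add: evF_def)

lemma evF_const: "evF (Poly_Mapping.single 0 v) = sF v"
proof -
  have "zmonF ks 0 = 1" for ks by (induction ks) auto
  then show ?thesis by (simp add: evF_single)
qed

lemma evF_1 [simp]: "evF 1 = 1"
  using evF_const[of 1] by simp

lemma evF_uminus: "evF (- p) = - evF p"
  using evF_add[of p "- p"] by (simp add: eq_neg_iff_add_eq_0 add.commute)

lemma evF_diff: "evF (p - q) = evF p - evF q"
  using evF_add[of p "- q"] by (simp add: evF_uminus)

lemma commutes_zmonF:
  assumes "\<And>k. k \<in> {1..n} \<Longrightarrow> commutes p (zF k)" "set ks \<subseteq> {1..n}"
  shows "commutes p (zmonF ks m)"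
  using assms(2) by (induction ks) (auto intro!: commutes_mult commutes_power assms(1))

lemma commutes_evF:
  assumes "\<And>k. k \<in> {1..n} \<Longrightarrow> commutes p (zF k)"
  shows "commutes p (evF f)"
  unfolding evF_def using assms by (intro commutes_sum commutes_mult commutes_zmonF) auto

lemma commutes_z: "i \<in> {1..n} \<Longrightarrow> j \<in> {1..n} \<Longrightarrow> commutes (zF i) (zF j)"
  using cl_z_z by (simp add: commutes_def)

text \<open>Commutativity of the z_i enters here: each power from the second monomial has to pass
  the later factors of the first.\<close>

lemma cl_zmonF_add:
  assumes "set ks \<subseteq> {1..n}"
  shows "cl (zmonF ks (m + m')) = cl (zmonF ks m * zmonF ks m')"
  using assms
proof (induction ks)
  case (Cons k ks)
  let ?a = "zF k ^ Poly_Mapping.lookup m k" and ?b = "zF k ^ Poly_Mapping.lookup m' k"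
  have com: "commutes (zmonF ks m) ?b"
    using Cons.prems by (intro commutes_power commutes_sym[OF commutes_zmonF] commutes_z) auto
  have "cl (zmonF (k # ks) (m + m')) = cl (?a * ?b * zmonF ks (m + m'))"
    by (simp add: lookup_add power_add)
  also have "\<dots> = cl (?a * ?b * (zmonF ks m * zmonF ks m'))"
    using Cons by (intro cl_cong_mult[OF refl]) auto
  also have "\<dots> = cl (?a * (?b * zmonF ks m) * zmonF ks m')"
    by (simp add: mult.assoc)
  also have "\<dots> = cl (?a * (zmonF ks m * ?b) * zmonF ks m')"
    using com by (intro cl_cong_mid) (simp add: commutes_def)
  finally show ?case by (simp add: mult.assoc)
qed simp

lemma cl_evF_mult: "cl (evF (p * q)) = cl (evF p * evF q)"
proof (induction p rule: poly_mapping_single_induct)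
  case (2 m v)
  show ?case
  proof (induction q rule: poly_mapping_single_induct)
    case (2 m' v')
    let ?Z = "zmonF [1..<Suc n]"
    have "cl (evF (Poly_Mapping.single m v * Poly_Mapping.single m' v')) = cl (sF (v * v') * ?Z (m + m'))"
      by (simp only: mult_single evF_single)
    also have "\<dots> = cl (sF (v * v') * (?Z m * ?Z m'))"
      by (rule cl_cong_mult[OF refl cl_zmonF_add]) auto
    also have "\<dots> = cl ((sF v * ?Z m) * (sF v' * ?Z m'))"
      by (simp only: free_scalar_mult mult.assoc free_scalar_left_commute[of "?Z m"])
    finally show ?case by (simp only: evF_single)
  qed (auto simp: evF_add cl_add distrib_left)
qed (auto simp: evF_add cl_add distrib_right)

lemma zmonF_single:
  "distinct ks \<Longrightarrow> zmonF ks (Poly_Mapping.single k a) = (if k \<in> set ks then zF k ^ a else 1)"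
  by (induction ks) (auto simp: lookup_single when_def)

text \<open>Monomials are evaluated along the indices 1 to n, so any other variable gets the default
  value 1.\<close>

lemma evF_pvar: "evF (pvar k) = (if k \<in> {1..n} then zF k else 1)"
  using zmonF_single[of "[1..<Suc n]" k 1]
  by (simp only: pvar_def evF_single) (auto simp: atLeastLessThanSuc_atLeastAtMost simp del: upt_Suc)

text \<open>The commutation rule \<open>s\<^sub>i f(z) = (s\<^sub>i f)(z) s\<^sub>i + c\<^sub>0 \<pi>\<^sub>i g(z)\<close>, where
  \<open>(z\<^sub>i - z\<^sub>i\<^sub>+\<^sub>1) g = s\<^sub>i f - f\<close>. It is recorded for formal polynomials, where \<open>z\<^sub>i - z\<^sub>i\<^sub>+\<^sub>1\<close> can be cancelled.\<close>

definition intertwines :: "nat \<Rightarrow> mpoly \<Rightarrow> mpoly \<Rightarrow> bool" where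
  "intertwines i f g \<longleftrightarrow>
     (pvar i - pvar (Suc i)) * g = perm_poly (transpose i (Suc i)) f - f \<and>
     cl (stF i * evF f) = cl (evF (perm_poly (transpose i (Suc i)) f) * stF i + sF (c 0) * piF i * evF g)"

lemma commutes_pi_evF: "commutes (piF i) (evF f)"
  using cl_pi_z by (intro commutes_evF) (simp add: commutes_def)

text \<open>The twisted Leibniz rule of divided differences: s_i passes the first factor and then
  the second, leaving one correction each time. As \<pi>_i commutes with all values of polynomials,
  both corrections can be written behind c_0 \<pi>_i.\<close>

lemma intertwines_mult:
  assumes i: "1 \<le> i" "i < n" and f1: "intertwines i f1 g1" and f2: "intertwines i f2 g2"
  shows "intertwines i (f1 * f2) (perm_poly (transpose i (Suc i)) f1 * g2 + g1 * f2)"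
  unfolding intertwines_def
proof
  let ?\<tau> = "transpose i (Suc i)"
  have \<tau>: "?\<tau> permutes {1..n}" by (rule stF_permutes[OF i])
  have d: "(pvar i - pvar (Suc i)) * g1 = perm_poly ?\<tau> f1 - f1" "(pvar i - pvar (Suc i)) * g2 = perm_poly ?\<tau> f2 - f2"
    using f1 f2 by (simp_all add: intertwines_def)
  have "(pvar i - pvar (Suc i)) * (perm_poly ?\<tau> f1 * g2 + g1 * f2) =
     perm_poly ?\<tau> f1 * ((pvar i - pvar (Suc i)) * g2) + ((pvar i - pvar (Suc i)) * g1) * f2"
    by (simp add: algebra_simps)
  also have "\<dots> = perm_poly ?\<tau> (f1 * f2) - f1 * f2"
    by (simp only: d perm_poly_mult[OF \<tau>]) (simp add: algebra_simps)
  finally show "(pvar i - pvar (Suc i)) * (perm_poly ?\<tau> f1 * g2 + g1 * f2) = perm_poly ?\<tau> (f1 * f2) - f1 * f2" .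
  let ?C = "sF (c 0) * piF i"
  have C: "commutes (evF p) ?C" for p
    by (intro commutes_mult commutes_scalar commutes_sym[OF commutes_pi_evF])
  have "cl (stF i * evF (f1 * f2)) = cl (stF i * evF f1 * evF f2)"
    unfolding cl_mult[of "stF i"] cl_evF_mult by (simp add: cl_mult H.m_assoc)
  also have "\<dots> = cl ((evF (perm_poly ?\<tau> f1) * stF i + ?C * evF g1) * evF f2)"
    using f1 by (intro cl_cong_mult refl) (simp add: intertwines_def)
  also have "\<dots> = cl (evF (perm_poly ?\<tau> f1) * (stF i * evF f2) + ?C * (evF g1 * evF f2))"
    by (simp only: distrib_right mult.assoc)
  also have "\<dots> = cl (evF (perm_poly ?\<tau> f1) * (evF (perm_poly ?\<tau> f2) * stF i + ?C * evF g2) + ?C * (evF g1 * evF f2))"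
    using f2 by (intro cl_cong_add[OF cl_cong_mult[OF refl] refl]) (simp add: intertwines_def)
  also have "\<dots> = cl (evF (perm_poly ?\<tau> f1) * evF (perm_poly ?\<tau> f2) * stF i
      + (evF (perm_poly ?\<tau> f1) * ?C * evF g2 + ?C * (evF g1 * evF f2)))"
    by (simp only: distrib_left mult.assoc add.assoc)
  also have "\<dots> = cl (evF (perm_poly ?\<tau> f1 * perm_poly ?\<tau> f2) * stF i
      + (?C * evF (perm_poly ?\<tau> f1) * evF g2 + ?C * evF (g1 * f2)))"
    using C[of "perm_poly ?\<tau> f1"] unfolding commutes_def
    by (simp only: cl_add cl_mult[of _ "evF g2"] cl_mult[of _ "stF i"] cl_evF_mult cl_mult[of ?C "evF _"] cl_mult[of ?C "_ * _"])
  also have "\<dots> = cl (evF (perm_poly ?\<tau> (f1 * f2)) * stF i + ?C * (evF (perm_poly ?\<tau> f1) * evF g2 + evF (g1 * f2)))"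
    by (simp only: perm_poly_mult[OF \<tau>] distrib_left mult.assoc)
  also have "\<dots> = cl (evF (perm_poly ?\<tau> (f1 * f2)) * stF i + ?C * evF (perm_poly ?\<tau> f1 * g2 + g1 * f2))"
    by (rule cl_cong_add[OF refl cl_cong_mult[OF refl]]) (simp only: evF_add cl_add cl_evF_mult)
  finally show "cl (stF i * evF (f1 * f2)) = cl (evF (perm_poly ?\<tau> (f1 * f2)) * stF i + ?C * evF (perm_poly ?\<tau> f1 * g2 + g1 * f2))" .
qed

lemma intertwines_add:
  assumes i: "1 \<le> i" "i < n" and f1: "intertwines i f1 g1" and f2: "intertwines i f2 g2"
  shows "intertwines i (f1 + f2) (g1 + g2)"
proof -
  let ?p = "perm_poly (transpose i (Suc i))"
  let ?C = "sF (c 0) * piF i"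
  have "cl (stF i * evF (f1 + f2)) = cl (stF i * evF f1 + stF i * evF f2)"
    by (simp only: evF_add distrib_left)
  also have "\<dots> = cl ((evF (?p f1) * stF i + ?C * evF g1) + (evF (?p f2) * stF i + ?C * evF g2))"
    using f1 f2 by (intro cl_cong_add) (simp_all add: intertwines_def)
  also have "\<dots> = cl (evF (?p (f1 + f2)) * stF i + ?C * evF (g1 + g2))"
    by (simp only: perm_poly_add[OF stF_permutes[OF i]] evF_add distrib_left distrib_right add_ac)
  finally show ?thesis
    using f1 f2 by (simp add: intertwines_def perm_poly_add[OF stF_permutes[OF i]] distrib_left)
qed

lemma intertwines_const:
  assumes i: "1 \<le> i" "i < n"
  shows "intertwines i (Poly_Mapping.single 0 v) 0"
  using permutes_inj[OF permutes_inv[OF stF_permutes[OF i]]]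
  by (simp add: intertwines_def perm_poly_single[OF stF_permutes[OF i]] map_key_zero evF_const free_scalar_central)

text \<open>This is \<open>cl_s_z\<close> multiplied by s_i on both sides, using that s_i is an
  involution commuting with \<pi>_i.\<close>

lemma cl_s_z_Suc:
  assumes i: "1 \<le> i" "i < n"
  shows "cl (stF i * zF (Suc i)) = cl (zF i * stF i + sF (c 0) * piF i)"
proof -
  let ?C = "sF (c 0) * piF i"
  have "cl (stF i * zF (Suc i)) = cl (stF i * (zF (Suc i) * stF i - ?C) * stF i + stF i * ?C * stF i)"
    using cl_s_s[OF i] by (simp add: algebra_simps cl_mult cl_diff cl_add H.m_assoc H.minus_eq H.a_assoc H.l_neg)
  also have "\<dots> = cl (stF i * (stF i * zF i) * stF i + stF i * ?C * stF i)"
    by (rule cl_cong_add[OF cl_cong_mid[OF cl_s_z[OF i, symmetric]] refl])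
  also have "\<dots> = cl ((stF i * stF i) * (zF i * stF i) + sF (c 0) * ((stF i * piF i) * stF i))"
    by (simp only: mult.assoc free_gen_scalar_left_commute)
  also have "\<dots> = cl (1 * (zF i * stF i) + sF (c 0) * ((piF i * stF i) * stF i))"
    by (rule cl_cong_add[OF cl_cong_mult[OF _ refl] cl_cong_mult[OF refl cl_cong_mult[OF cl_s_pi[OF i] refl]]])
       (simp add: cl_s_s[OF i])
  also have "\<dots> = cl (1 * (zF i * stF i) + ?C * (stF i * stF i))"
    by (simp only: mult.assoc)
  also have "\<dots> = cl (1 * (zF i * stF i) + ?C * 1)"
    by (rule cl_cong_add[OF refl cl_cong_mult[OF refl]]) (simp add: cl_s_s[OF i])
  finally show ?thesis by simp
qed

text \<open>The divided difference of a variable is -1 at index i, 1 at index i + 1 and 0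
  elsewhere.\<close>

lemma intertwines_pvar:
  assumes i: "1 \<le> i" "i < n"
  shows "\<exists>g. intertwines i (pvar k) g"
proof -
  have pp: "perm_poly (transpose i (Suc i)) (pvar k) = pvar (transpose i (Suc i) k)"
    by (rule perm_poly_pvar[OF stF_permutes[OF i]])
  consider "k = i" | "k = Suc i" | "k \<noteq> i" "k \<noteq> Suc i" by blast
  then show ?thesis
  proof cases
    case 1
    have "intertwines i (pvar k) (- 1)"
      using cl_s_z[OF i] i 1 pp by (simp add: intertwines_def evF_pvar evF_uminus)
    then show ?thesis ..
  next
    case 2
    have "intertwines i (pvar k) 1"
      using cl_s_z_Suc[OF i] i 2 pp by (simp add: intertwines_def evF_pvar)
    then show ?thesis ..
  next
    case 3
    then have "cl (stF i * evF (pvar k)) = cl (evF (pvar k) * stF i)"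
      using cl_s_z_other[OF i, of k] by (simp add: evF_pvar)
    then have "intertwines i (pvar k) 0"
      using 3 pp by (simp add: intertwines_def)
    then show ?thesis ..
  qed
qed

text \<open>Every polynomial is built from constants and variables by products and sums, and each of
  these operations produces its own \<open>g\<close>.\<close>

lemma intertwines_exists:
  assumes i: "1 \<le> i" "i < n"
  shows "\<exists>g. intertwines i f g"
proof (induction f rule: poly_mapping_single_induct)
  case 1
  then show ?case using intertwines_const[OF i, of 0] by auto
next
  case (2 m v)
  have "\<exists>g. intertwines i (Poly_Mapping.single m 1) g"
  proof (induction m rule: poly_mapping_single_induct)
    case 1
    then show ?case using intertwines_const[OF i, of 1] by auto
  next
    case (2 k a)
    show ?case
    proof (induction a)
      case 0
      then show ?case using intertwines_const[OF i, of 1] by auto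
    next
      case (Suc a)
      have "Poly_Mapping.single (Poly_Mapping.single k (Suc a)) 1 = pvar k * Poly_Mapping.single (Poly_Mapping.single k a) (1::complex)"
        by (simp add: pvar_def mult_single flip: single_add)
      then show ?case using Suc intertwines_pvar[OF i, of k] intertwines_mult[OF i] by metis
    qed
  next
    case (3 m m')
    have "Poly_Mapping.single (m + m') 1 = Poly_Mapping.single m 1 * Poly_Mapping.single m' (1::complex)"
      by (simp add: mult_single)
    then show ?case using 3 intertwines_mult[OF i] by metis
  qed
  moreover have "Poly_Mapping.single m v = Poly_Mapping.single 0 v * Poly_Mapping.single m (1::complex)"
    by (simp add: mult_single)
  ultimately show ?case using intertwines_const[OF i, of v] intertwines_mult[OF i] by metis
next
  case (3 p q)
  then show ?case using intertwines_add[OF i] by blast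
qed

lemma commutes_s_symmetric:
  assumes i: "1 \<le> i" "i < n" and f: "symmetric_poly n f"
  shows "commutes (evF f) (stF i)"
proof -
  obtain g where g: "intertwines i f g" using intertwines_exists[OF i] by blast
  have pf: "perm_poly (transpose i (Suc i)) f = f"
    using f stF_permutes[OF i] by (simp add: symmetric_poly_iff)
  have "(pvar i - pvar (Suc i)) * g = 0"
    using g pf by (simp add: intertwines_def)
  \<comment> \<open>The two variables are distinct and polynomials form a domain, so
    \<open>g\<close> vanishes formally and its value drops out of the commutation rule.\<close>
  then have "g = 0" by (simp only: mult_eq_0_iff right_minus_eq pvar_eq_iff) simp
  then show ?thesis using g pf by (simp add: intertwines_def commutes_def)
qed



section \<open>Symmetric polynomials in the z_i commute with the whole group\<close>

lemma commutes_cong: "cl q = cl q' \<Longrightarrow> commutes p q \<longleftrightarrow> commutes p q'"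
  by (simp add: commutes_def cl_mult)

text \<open>The transposition of a and b + 1 is the conjugate by s_b of the transposition of a and
  b, so the claim spreads from the simple transpositions.\<close>

lemma commutes_transpose_symmetric:
  assumes f: "symmetric_poly n f" and a: "1 \<le> a" and ab: "a < b" and b: "b \<le> n"
  shows "commutes (evF f) (tF (transpose a b) (\<lambda>_. 1))"
proof -
  from ab have "Suc a \<le> b" by simp
  then show ?thesis using b
  proof (induction b rule: dec_induct)
    case base
    then show ?case using a by (intro commutes_s_symmetric f) auto
  next
    case (step b)
    have ab': "transpose a b permutes {1..n}" using a step by (intro permutes_swap_id) auto
    have b': "1 \<le> b" "b < n" using a step by auto
    have "transpose a (Suc b) = transpose b (Suc b) \<circ> transpose a b \<circ> transpose b (Suc b)"
      using step by (auto simp: transpose_def fun_eq_iff)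
    then have "cl (tF (transpose a (Suc b)) (\<lambda>_. 1)) =
        cl (tF (transpose b (Suc b) \<circ> transpose a b \<circ> transpose b (Suc b)) (\<lambda>k. 1 * 1 * 1))"
      by simp
    also have "\<dots> = cl (tF (transpose b (Suc b) \<circ> transpose a b) (\<lambda>k. 1 * 1) * stF b)"
      by (rule sym, rule cl_t_mult[OF permutes_compose[OF ab' stF_permutes[OF b']] _ stF_permutes[OF b']]) auto
    also have "\<dots> = cl (stF b * tF (transpose a b) (\<lambda>_. 1) * stF b)"
      by (rule cl_cong_mult[OF _ refl], rule sym, rule cl_t_mult[OF stF_permutes[OF b'] _ ab']) auto
    finally have eq: "cl (tF (transpose a (Suc b)) (\<lambda>_. 1)) = cl (stF b * tF (transpose a b) (\<lambda>_. 1) * stF b)" .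
    show ?case
      unfolding commutes_cong[OF eq] using step b' by (intro commutes_mult commutes_s_symmetric f) auto
  qed
qed

lemma commutes_perm_symmetric:
  assumes f: "symmetric_poly n f" and \<sigma>: "\<sigma> permutes {1..n}"
  shows "commutes (evF f) (tF \<sigma> (\<lambda>_. 1))"
  using \<sigma> finite_atLeastAtMost
proof (induction rule: permutes_induct)
  case id
  have "cl (tF id (\<lambda>_. 1)) = cl 1" using cl_t_one by simp
  then show ?case using commutes_cong commutes_scalar(2) by blast
next
  case (swap a b p)
  have "cl (tF (transpose a b) (\<lambda>_. 1) * tF p (\<lambda>_. 1)) = cl (tF (transpose a b \<circ> p) (\<lambda>k. 1 * 1))"
    using swap by (intro cl_t_mult permutes_swap_id) auto
  moreover have "commutes (evF f) (tF (transpose a b) (\<lambda>_. 1))"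
    using swap commutes_transpose_symmetric[OF f, of a b] commutes_transpose_symmetric[OF f, of b a]
    by (cases "a < b") (auto simp: transpose_commute)
  ultimately show ?case
    using commutes_mult[OF _ swap.IH] commutes_cong by (metis mult_1)
qed

text \<open>A monomial matrix is a permutation matrix times a diagonal one, and diagonal group
  elements commute with each z_k separately.\<close>

lemma commutes_t_symmetric:
  assumes f: "symmetric_poly n f" and \<sigma>: "\<sigma> permutes {1..n}" and a: "\<forall>k\<in>{1..n}. a k ^ r = 1"
  shows "commutes (evF f) (tF \<sigma> a)"
proof -
  have "cl (tF \<sigma> (\<lambda>_. 1) * tF id a) = cl (tF (\<sigma> \<circ> id) (\<lambda>k. 1 * a k))"
    by (intro cl_t_mult \<sigma> permutes_id a) auto
  moreover have "commutes (evF f) (tF id a)"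
    using cl_diag_z[OF a] by (intro commutes_sym[OF commutes_evF]) (simp add: commutes_def)
  moreover have "commutes (evF f) (tF \<sigma> (\<lambda>_. 1))"
    by (rule commutes_perm_symmetric[OF f \<sigma>])
  ultimately show ?thesis
    using commutes_mult[of "evF f" "tF \<sigma> (\<lambda>_. 1)" "tF id a"] commutes_cong[of "tF \<sigma> (\<lambda>_. 1) * tF id a" "tF \<sigma> a" "evF f"]
    by simp
qed

section \<open>The subalgebra A and its central denominators\<close>

abbreviation A :: "gen free_alg set ring" where "A \<equiv> A_ring r n \<kappa> c"
abbreviation S :: "gen free_alg set set" where "S \<equiv> sym_denoms r n \<kappa> c"

definition Agens :: "gen free_alg set set" where
  "Agens = range (hscalar r n \<kappa> c) \<union> z_elt r n \<kappa> c ` {1..n} \<union> ht r n \<kappa> c ` carrier (Grn r n)"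

lemma A_eq: "A = H\<lparr>carrier := generate_ring H Agens\<rparr>"
  by (simp add: A_ring_def Agens_def)

lemma carrier_A: "carrier A = generate_ring H Agens"
  by (simp add: A_eq)

lemma Agens_closed: "Agens \<subseteq> carrier H"
  by (auto simp: Agens_def hscalar_eq z_elt_eq ht_eq)

lemma A_subring: "subring (carrier A) H"
  unfolding carrier_A by (rule H.generate_ring_is_subring[OF Agens_closed])

lemma ring_A: "ring A"
  unfolding A_eq by (rule H.generate_ring_is_ring[OF Agens_closed])

lemma A_simps [simp]:
  "mult A = mult H" "one A = one H" "zero A = zero H" "add A = add H"
  by (simp_all add: A_eq)

lemma A_in_H: "a \<in> carrier A \<Longrightarrow> a \<in> carrier H"
  using subringE(1)[OF A_subring] by blast

text \<open>In contrast to the operations in \<open>A_simps\<close>, negation depends on the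
  carrier: it is the inverse in the additive group of the subring.\<close>

lemma A_uminus: "a \<in> carrier A \<Longrightarrow> \<ominus>\<^bsub>A\<^esub> a = \<ominus>\<^bsub>H\<^esub> a"
  using H.subring_iff[of "carrier A"] by (intro abelian_group.minus_equality[OF ring.is_abelian_group[OF ring_A]])
    (auto simp: H.l_neg A_in_H subringE(5)[OF A_subring])

lemma in_A:
  "cl (sF a) \<in> carrier A" "k \<in> {1..n} \<Longrightarrow> cl (zF k) \<in> carrier A"
  "w \<in> carrier (Grn r n) \<Longrightarrow> cl (free_gen (T w)) \<in> carrier A"
  unfolding carrier_A
  by (auto simp flip: hscalar_eq z_elt_eq ht_eq simp: Agens_def intro!: generate_ring.incl)

lemma in_A_add: "cl p \<in> carrier A \<Longrightarrow> cl q \<in> carrier A \<Longrightarrow> cl (p + q) \<in> carrier A"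
  unfolding carrier_A cl_add by (rule generate_ring.eng_add)

lemma in_A_mult: "cl p \<in> carrier A \<Longrightarrow> cl q \<in> carrier A \<Longrightarrow> cl (p * q) \<in> carrier A"
  unfolding carrier_A cl_mult by (rule generate_ring.eng_mult)

lemma in_A_sum: "(\<And>a. a \<in> I \<Longrightarrow> cl (f a) \<in> carrier A) \<Longrightarrow> cl (sum f I) \<in> carrier A"
proof (induction I rule: infinite_finite_induct)
  case (insert a I)
  then show ?case by (auto intro: in_A_add)
qed (use in_A(1)[of 0] in auto)

lemma in_A_power: "cl p \<in> carrier A \<Longrightarrow> cl (p ^ k) \<in> carrier A"
  using in_A(1)[of 1] by (induction k) (auto intro: in_A_mult)

lemma evF_in_A: "cl (evF f) \<in> carrier A"
proof -
  have "cl (zmonF ks m) \<in> carrier A" if "set ks \<subseteq> {1..n}" for ks m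
    using that in_A(1)[of 1] by (induction ks) (auto intro!: in_A_mult in_A_power in_A(2))
  moreover have "set [1..<Suc n] \<subseteq> {1..n}" by (simp only: set_upt) auto
  ultimately have "cl (zmonF [1..<Suc n] m) \<in> carrier A" for m by blast
  then show ?thesis unfolding evF_def by (intro in_A_sum in_A_mult in_A(1))
qed

lemma sym_denomsE:
  assumes "s \<in> S"
  obtains f where "symmetric_poly n f" "f \<noteq> 0" "s = cl (evF f)"
  using assms by (auto simp: sym_denoms_def z_eval_eq)

lemma sym_denomsI: "symmetric_poly n f \<Longrightarrow> f \<noteq> 0 \<Longrightarrow> cl (evF f) \<in> S"
  by (auto simp: sym_denoms_def z_eval_eq)

lemma one_in_S: "\<one>\<^bsub>H\<^esub> \<in> S"
  using sym_denomsI[OF symmetric_poly_1] by simp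

text \<open>The product of two nonzero polynomials is nonzero, and evaluation is multiplicative
  modulo the ideal.\<close>

lemma S_mult: "s \<in> S \<Longrightarrow> t \<in> S \<Longrightarrow> s \<otimes>\<^bsub>H\<^esub> t \<in> S"
  by (elim sym_denomsE) (metis sym_denomsI symmetric_poly_mult cl_evF_mult cl_mult mult_eq_0_iff)

text \<open>Commuting with \<open>s\<close> is preserved by the ring operations, so it is checked on
  the generators of A: scalars, the z_k and the t_w.\<close>

lemma S_central:
  assumes s: "s \<in> S" and a: "a \<in> carrier A"
  shows "s \<otimes>\<^bsub>H\<^esub> a = a \<otimes>\<^bsub>H\<^esub> s"
proof -
  obtain f where f: "symmetric_poly n f" "s = cl (evF f)" using s by (rule sym_denomsE)
  have gen: "s \<otimes>\<^bsub>H\<^esub> cl p = cl p \<otimes>\<^bsub>H\<^esub> s" if "commutes (evF f) p" for p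
    using that by (simp add: f(2) commutes_def cl_mult)
  note sc = A_in_H[unfolded carrier_A]
  have sH: "s \<in> carrier H" by (simp add: f(2))
  show ?thesis
    using a unfolding carrier_A
  proof induction
    case (incl h)
    then consider b where "h = cl (sF b)" | k where "k \<in> {1..n}" "h = cl (zF k)"
      | w where "w \<in> carrier (Grn r n)" "h = cl (free_gen (T w))"
      by (auto simp: Agens_def hscalar_eq z_elt_eq ht_eq)
    then show ?case
    proof cases
      case 1
      then show ?thesis by (simp add: gen)
    next
      case 2
      then show ?thesis using gen[OF commutes_sym[OF commutes_evF[OF commutes_z]]] by blast
    next
      case 3
      then obtain \<sigma> b where "\<sigma> permutes {1..n}" "\<And>k. k \<in> {1..n} \<Longrightarrow> b k ^ r = 1" "w = mono_mat n \<sigma> b"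
        by (metis Grn_mono_mat)
      then show ?thesis using 3 commutes_t_symmetric[OF f(1)] gen by blast
    qed
  next
    case (a_inv h)
    then show ?case using sH sc[of h] by (simp add: H.l_minus H.r_minus)
  next
    case (eng_add h1 h2)
    then show ?case using sH sc[of h1] sc[of h2] by (simp add: H.l_distr H.r_distr)
  next
    case (eng_mult h1 h2)
    then show ?case using sH sc[of h1] sc[of h2] by (metis H.m_assoc)
  qed (use sH in simp)
qed

end

section \<open>The localized subalgebra\<close>

context cherednik_params
begin

lemma central_denominators_A: "central_denominators A S"
proof (intro central_denominators.intro central_denominators_axioms.intro ring_A)
  show "S \<subseteq> carrier A" by (auto elim: sym_denomsE intro: evF_in_A)
qed (simp_all add: one_in_S S_mult, rule S_central)

sublocale Loc: central_denominators A S
  by (rule central_denominators_A)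

abbreviation AL :: "(gen free_alg set \<times> gen free_alg set) set ring" where "AL \<equiv> A_loc r n \<kappa> c"
abbreviation \<iota> :: "gen free_alg set \<Rightarrow> (gen free_alg set \<times> gen free_alg set) set" where "\<iota> \<equiv> to_loc r n \<kappa> c"

lemma ring_AL: "ring AL"
  using Loc.ring_localization by (simp add: A_loc_def)

lemma iota_hom: "ring_hom_ring A AL \<iota>"
  using Loc.to_loc_hom by (intro ring_hom_ringI2 ring_A ring_AL) (simp add: A_loc_def to_loc_def [abs_def])

text \<open>One factor is split off \<open>discr n\<close>; the product of the remaining ones is the
  cofactor that \<open>to_loc_Unit\<close> asks for.\<close>

lemma z_diff_Unit:
  assumes i: "1 \<le> i" "i < n"
  shows "\<iota> (cl (zF i - zF (Suc i))) \<in> Units AL"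
proof -
  let ?p = "pvar i - pvar (Suc i)"
  let ?q = "\<Prod>(j, k)\<in>diff_pairs n - {(i, Suc i)}. pvar j - pvar k"
  have z: "cl (zF i - zF (Suc i)) = cl (evF ?p)"
    using i by (simp add: evF_diff evF_pvar)
  have "(i, Suc i) \<in> diff_pairs n" using i by (auto simp: diff_pairs_def)
  then have pq: "?p * ?q = discr n"
    unfolding discr_def by (subst (2) prod.remove[of _ "(i, Suc i)"]) auto
  have "cl (evF ?p) \<otimes>\<^bsub>H\<^esub> cl (evF ?q) = cl (evF (discr n))" "cl (evF ?q) \<otimes>\<^bsub>H\<^esub> cl (evF ?p) = cl (evF (discr n))"
    using cl_evF_mult[of ?p ?q] cl_evF_mult[of ?q ?p] by (simp_all only: cl_mult pq mult.commute[of ?q ?p])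
  then show ?thesis
    using Loc.to_loc_Unit[of "cl (evF ?p)" "cl (evF ?q)"] sym_denomsI[OF symmetric_discr discr_nonzero] evF_in_A
    by (simp add: z to_loc_def A_loc_def)
qed

lemma pi_in_A: "cl (piF i) \<in> carrier A"
  unfolding piF_def
proof (intro in_A_sum in_A(3) mono_mat_in_Grn permutes_id r)
  fix u k assume "u \<in> roots"
  then show "(if k = i then u else if k = Suc i then 1 / u else 1) ^ r = 1"
    using diag_root[of u UNIV i "Suc i"] by blast
qed

lemma sigma_square:
  assumes i: "1 \<le> i" "i < n"
  shows "sigma_elt r n \<kappa> c i [^]\<^bsub>AL\<^esub> (2::nat) = \<one>\<^bsub>AL\<^esub> \<ominus>\<^bsub>AL\<^esub>
    (\<iota> (hscalar r n \<kappa> c (c 0) \<otimes>\<^bsub>H\<^esub> pi_elt r n \<kappa> c i) \<otimes>\<^bsub>AL\<^esub>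
      inv\<^bsub>AL\<^esub> (\<iota> (z_elt r n \<kappa> c i \<ominus>\<^bsub>H\<^esub> z_elt r n \<kappa> c (i + 1)))) [^]\<^bsub>AL\<^esub> (2::nat)"
proof -
  interpret \<iota>: ring_hom_ring A AL \<iota> by (rule iota_hom)
  have ii: "i \<in> {1..n}" "Suc i \<in> {1..n}" using i by auto
  let ?z = "zF i - zF (Suc i)"
  define s where "s = \<iota> (cl (stF i))"
  define D where "D = \<iota> (cl ?z)"
  define C where "C = \<iota> (cl (sF (c 0)))"
  define p where "p = \<iota> (cl (piF i))"
  have st: "transp_mat n i (Suc i) \<in> carrier (Grn r n)"
    using ii r by (intro transp_mat_in_Grn) auto
  have inA: "cl (stF i) \<in> carrier A" "cl ?z \<in> carrier A" "cl (sF (c 0)) \<in> carrier A" "cl (piF i) \<in> carrier A"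
    using in_A(3)[OF st] evF_in_A[of "pvar i - pvar (Suc i)"] ii pi_in_A[of i] in_A(1)
    by (simp_all add: transp_mat_mono_mat evF_diff evF_pvar)
  have hom: "\<iota> (cl (a * b)) = \<iota> (cl a) \<otimes>\<^bsub>AL\<^esub> \<iota> (cl b)" if "cl a \<in> carrier A" "cl b \<in> carrier A" for a b
    using \<iota>.hom_mult[OF that] by (simp add: cl_mult)
  have car: "s \<in> carrier AL" "D \<in> carrier AL" "C \<in> carrier AL" "p \<in> carrier AL"
    unfolding s_def D_def C_def p_def by (intro \<iota>.hom_closed inA)+
  have DU: "D \<in> Units AL" unfolding D_def by (rule z_diff_Unit[OF i])
  have inv: "inv\<^bsub>AL\<^esub> D \<in> carrier AL" "inv\<^bsub>AL\<^esub> D \<otimes>\<^bsub>AL\<^esub> D = \<one>\<^bsub>AL\<^esub>" "D \<otimes>\<^bsub>AL\<^esub> inv\<^bsub>AL\<^esub> D = \<one>\<^bsub>AL\<^esub>"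
    using DU by auto
  have ss: "s \<otimes>\<^bsub>AL\<^esub> s = \<one>\<^bsub>AL\<^esub>"
    using hom[OF inA(1) inA(1)] cl_s_s[OF i] \<iota>.hom_one by (simp add: s_def)
  have comm: "\<iota> (cl a) \<otimes>\<^bsub>AL\<^esub> \<iota> (cl b) = \<iota> (cl b) \<otimes>\<^bsub>AL\<^esub> \<iota> (cl a)"
    if "cl a \<in> carrier A" "cl b \<in> carrier A" "commutes a b" for a b
    using that hom[of a b] hom[of b a] by (simp add: commutes_def)
  have Cp: "C \<otimes>\<^bsub>AL\<^esub> p = \<iota> (cl (sF (c 0) * piF i))"
    unfolding C_def p_def by (rule hom[OF inA(3,4), symmetric])
  have P: "cl (sF (c 0) * piF i) \<in> carrier A" by (intro in_A_mult inA)
  have sP: "s \<otimes>\<^bsub>AL\<^esub> (C \<otimes>\<^bsub>AL\<^esub> p) = C \<otimes>\<^bsub>AL\<^esub> p \<otimes>\<^bsub>AL\<^esub> s"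
    unfolding Cp s_def using cl_s_pi[OF i]
    by (intro comm inA P commutes_mult commutes_scalar) (simp add: commutes_def)
  have DP: "D \<otimes>\<^bsub>AL\<^esub> (C \<otimes>\<^bsub>AL\<^esub> p) = C \<otimes>\<^bsub>AL\<^esub> p \<otimes>\<^bsub>AL\<^esub> D"
    unfolding Cp D_def using commutes_pi_evF[of i "pvar i - pvar (Suc i)"] ii
    by (intro comm inA P commutes_mult commutes_scalar) (simp add: commutes_sym evF_diff evF_pvar)
  have CD: "C \<otimes>\<^bsub>AL\<^esub> D = D \<otimes>\<^bsub>AL\<^esub> C"
    unfolding C_def D_def by (intro comm inA commutes_sym[OF commutes_scalar(1)])
  \<comment> \<open>The commutation rules for z_i and z_(i+1) carry corrections of opposite sign, so
    in the difference they add up to -2 c_0 \<pi>_i.\<close>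
  have sD: "s \<otimes>\<^bsub>AL\<^esub> D = \<ominus>\<^bsub>AL\<^esub> (D \<otimes>\<^bsub>AL\<^esub> s) \<ominus>\<^bsub>AL\<^esub> (C \<otimes>\<^bsub>AL\<^esub> p \<oplus>\<^bsub>AL\<^esub> C \<otimes>\<^bsub>AL\<^esub> p)"
  proof -
    let ?P = "sF (c 0) * piF i"
    have "cl (stF i * ?z) = cl (stF i * zF i) \<ominus>\<^bsub>H\<^esub> cl (stF i * zF (Suc i))"
      by (simp add: right_diff_distrib cl_diff)
    also have "\<dots> = cl ((zF (Suc i) * stF i - ?P) - (zF i * stF i + ?P))"
      unfolding cl_s_z[OF i] cl_s_z_Suc[OF i] by (rule cl_diff[symmetric])
    also have "\<dots> = cl (- (?z * stF i) + - (?P + ?P))"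
      by (simp add: algebra_simps)
    also have "\<dots> = \<ominus>\<^bsub>A\<^esub> cl (?z * stF i) \<oplus>\<^bsub>A\<^esub> \<ominus>\<^bsub>A\<^esub> (cl ?P \<oplus>\<^bsub>A\<^esub> cl ?P)"
    proof -
      have "\<ominus>\<^bsub>A\<^esub> (cl ?P \<oplus>\<^bsub>A\<^esub> cl ?P) = cl (- (?P + ?P))"
        using A_uminus[OF in_A_add[OF P P]] by (simp only: cl_add cl_uminus A_simps)
      moreover have "\<ominus>\<^bsub>A\<^esub> cl (?z * stF i) = cl (- (?z * stF i))"
        using A_uminus[OF in_A_mult[OF inA(2,1)]] by (simp only: cl_uminus)
      ultimately show ?thesis by (simp only: cl_add A_simps)
    qed
    finally have eq: "cl (stF i * ?z) = \<ominus>\<^bsub>A\<^esub> cl (?z * stF i) \<oplus>\<^bsub>A\<^esub> \<ominus>\<^bsub>A\<^esub> (cl ?P \<oplus>\<^bsub>A\<^esub> cl ?P)" .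
    have "s \<otimes>\<^bsub>AL\<^esub> D = \<iota> (cl (stF i * ?z))"
      unfolding s_def D_def by (rule hom[OF inA(1,2), symmetric])
    also have "\<dots> = \<ominus>\<^bsub>AL\<^esub> \<iota> (cl (?z * stF i)) \<oplus>\<^bsub>AL\<^esub> \<ominus>\<^bsub>AL\<^esub> (\<iota> (cl ?P) \<oplus>\<^bsub>AL\<^esub> \<iota> (cl ?P))"
      unfolding eq using in_A_mult[OF inA(2,1)] P by (simp del: A_simps)
    finally show ?thesis
      unfolding Cp by (simp add: hom[OF inA(2,1)] s_def D_def a_minus_def)
  qed
  \<comment> \<open>In \<open>sigma_elt\<close> the scalar c_0 stands before the inverse of
    \<open>D\<close>, whereas \<open>intertwiner_square\<close> needs it grouped with \<pi>_i behind
    that inverse.\<close>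
  have Ce: "C \<otimes>\<^bsub>AL\<^esub> inv\<^bsub>AL\<^esub> D = inv\<^bsub>AL\<^esub> D \<otimes>\<^bsub>AL\<^esub> C"
  proof -
    have "C \<otimes>\<^bsub>AL\<^esub> inv\<^bsub>AL\<^esub> D = inv\<^bsub>AL\<^esub> D \<otimes>\<^bsub>AL\<^esub> (D \<otimes>\<^bsub>AL\<^esub> C) \<otimes>\<^bsub>AL\<^esub> inv\<^bsub>AL\<^esub> D"
      using car inv by (simp flip: \<iota>.S.m_assoc)
    also have "\<dots> = inv\<^bsub>AL\<^esub> D \<otimes>\<^bsub>AL\<^esub> C \<otimes>\<^bsub>AL\<^esub> (D \<otimes>\<^bsub>AL\<^esub> inv\<^bsub>AL\<^esub> D)"
      unfolding CD[symmetric] using car inv(1) by (simp add: \<iota>.S.m_assoc)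
    finally show ?thesis using car inv by simp
  qed
  have Dz: "z_elt r n \<kappa> c i \<ominus>\<^bsub>H\<^esub> z_elt r n \<kappa> c (i + 1) = cl ?z"
    using ii by (simp add: z_elt_eq cl_diff)
  have st_eq: "ht r n \<kappa> c (simple_refl n i) = cl (stF i)"
    using st by (simp add: simple_refl_def ht_eq) (simp add: transp_mat_mono_mat)
  have "sigma_elt r n \<kappa> c i = s \<oplus>\<^bsub>AL\<^esub> (C \<otimes>\<^bsub>AL\<^esub> inv\<^bsub>AL\<^esub> D) \<otimes>\<^bsub>AL\<^esub> p"
    unfolding sigma_elt_def z_diff_inv_def Dz st_eq hscalar_eq pi_elt_eq by (simp only: s_def C_def D_def p_def)
  also have "\<dots> = s \<oplus>\<^bsub>AL\<^esub> inv\<^bsub>AL\<^esub> D \<otimes>\<^bsub>AL\<^esub> (C \<otimes>\<^bsub>AL\<^esub> p)"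
    unfolding Ce using car inv(1) by (simp add: \<iota>.S.m_assoc)
  finally have "sigma_elt r n \<kappa> c i [^]\<^bsub>AL\<^esub> (2::nat) = \<one>\<^bsub>AL\<^esub> \<ominus>\<^bsub>AL\<^esub> ((C \<otimes>\<^bsub>AL\<^esub> p) \<otimes>\<^bsub>AL\<^esub> inv\<^bsub>AL\<^esub> D) [^]\<^bsub>AL\<^esub> (2::nat)"
    using \<iota>.S.intertwiner_square[OF car(1) DU _ ss sP DP sD] car by simp
  then show ?thesis
    unfolding Dz hscalar_eq pi_elt_eq cl_mult[symmetric] Cp D_def .
qed

end

theorem lemma5p2:
  fixes r n :: nat and \<kappa> :: complex and c :: "nat \<Rightarrow> complex"
  assumes "r \<ge> 1" and "n \<ge> 1"
  defines "H \<equiv> cherednik r n \<kappa> c"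
    and "L \<equiv> A_loc r n \<kappa> c"
    and "sc \<equiv> hscalar r n \<kappa> c"
    and "\<iota> \<equiv> to_loc r n \<kappa> c"
    and "z \<equiv> z_elt r n \<kappa> c"
    and "\<pi> \<equiv> pi_elt r n \<kappa> c"
    and "\<sigma> \<equiv> sigma_elt r n \<kappa> c"
    and "\<Phi> \<equiv> Phi_elt r n \<kappa> c"
    and "\<Psi> \<equiv> Psi_elt r n \<kappa> c"
    and "d \<equiv> d_coeff r c"
    and "\<epsilon> \<equiv> epsilon_elt r n \<kappa> c"
  shows "(\<forall>i. 1 \<le> i \<and> i \<le> n - 1 \<longrightarrow>
           \<sigma> i [^]\<^bsub>L\<^esub> (2::nat) =
             \<one>\<^bsub>L\<^esub> \<ominus>\<^bsub>L\<^esub> (\<iota> (sc (c 0) \<otimes>\<^bsub>H\<^esub> \<pi> i) \<otimes>\<^bsub>L\<^esub> inv\<^bsub>L\<^esub> (\<iota> (z i \<ominus>\<^bsub>H\<^esub> z (i + 1)))) [^]\<^bsub>L\<^esub> (2::nat)) \<and>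
         \<Psi> \<otimes>\<^bsub>H\<^esub> \<Phi> = z 1 \<and>
         \<Phi> \<otimes>\<^bsub>H\<^esub> \<Psi> =
           (z n \<ominus>\<^bsub>H\<^esub> sc \<kappa>) \<oplus>\<^bsub>H\<^esub>
           (\<Oplus>\<^bsub>H\<^esub>j\<in>{..<r}. sc (d (int j) - d (int j - 1)) \<otimes>\<^bsub>H\<^esub> \<epsilon> n (int j))"
proof -
  interpret cherednik_params r n \<kappa> c by unfold_locales (rule assms(1))
  show ?thesis
    unfolding H_def L_def sc_def \<iota>_def z_def \<pi>_def \<sigma>_def \<Phi>_def \<Psi>_def d_def \<epsilon>_def
  proof (intro conjI allI impI, elim conjE)
    fix i assume "1 \<le> i" "i \<le> n - 1"
    then show "sigma_elt r n \<kappa> c i [^]\<^bsub>AL\<^esub> (2::nat) = \<one>\<^bsub>AL\<^esub> \<ominus>\<^bsub>AL\<^esub>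
      (to_loc r n \<kappa> c (hscalar r n \<kappa> c (c 0) \<otimes>\<^bsub>cherednik r n \<kappa> c\<^esub> pi_elt r n \<kappa> c i) \<otimes>\<^bsub>AL\<^esub>
        inv\<^bsub>AL\<^esub> (to_loc r n \<kappa> c (z_elt r n \<kappa> c i \<ominus>\<^bsub>cherednik r n \<kappa> c\<^esub> z_elt r n \<kappa> c (i + 1)))) [^]\<^bsub>AL\<^esub> (2::nat)"
      by (intro sigma_square) auto
  qed (rule Psi_Phi_eq[OF assms(2)] Phi_Psi_eq[OF assms(2)])+
qed

end
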